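(* Let $\mathcal{F}$ be a germ of a singular holomorphic foliation at $(\mathbb{C}^2,0)$, let $X$ be a germ at $0$ of an irreducible reduced curve, and let $\pi:\tilde{\mathbb{C}}^2\to(\mathbb{C}^2,0)$ be the blow-up at $0$. Assume that $X$ is not invariant by $\mathcal{F}$. Let $\tilde{\mathcal{F}}=\pi^*\mathcal{F}$ and $\tilde X$ be the strict transforms of $\mathcal{F}$ and $X$, and let $q\in\pi^{-1}(0)\cap\tilde X$. Denote by $m$ the multiplicity of $X$ (in its Puiseux parametrization), and by $\nu$ the algebraic multiplicity of $\mathcal{F}$ at $0$. Let $\mathcal{D}=\dim_{\mathbb{C}}\dfrac{\tilde\sigma^*\Omega_{\tilde X}}{\sigma^*\Omega_X}$, where $\tilde\sigma:(\overline X,0)\to(\tilde X,q)$ is the normalization and $\sigma=\pi\circ\tilde\sigma$. Then: (a) if $\pi$ is non-dicritical, \[\mu_{BR}^{-}(\mathcal{F},X,0)=\mu_{BR}^{-}(\tilde{\mathcal{F}},\tilde X,q)+\nu m+\frac{m(m-1)}{2}-\mathcal{D};\] (b) if $\pi$ is dicritical, \[\mu_{BR}^{-}(\mathcal{F},X,0)=\mu_{BR}^{-}(\tilde{\mathcal{F}},\tilde X,q)+(\nu+1)m+\frac{m(m-1)}{2}-\mathcal{D}.\]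
   Context: A germ of holomorphic foliation $\mathcal{F}$ at a point $p$ of a complex surface is given in local coordinates $(x,y)$ at $p$ by a holomorphic 1-form $\omega=A\,dx+B\,dy$ with $A,B$ relatively prime; it is singular at $p$ if $A(p)=B(p)=0$. A curve $\{f=0\}$ is invariant by $\mathcal{F}$ if $f$ divides the coefficient of $dx\wedge dy$ in $\omega\wedge df$. The algebraic multiplicity $\nu$ of $\mathcal{F}$ at $0$ is the minimum of the vanishing orders of $A$ and $B$ at $0$. For a germ of reduced curve $X=\{\phi=0\}$ at $p$, let $\mathcal{O}_p$ be the ring of holomorphic germs at $p$, $I_X=\langle\phi\rangle$, let $\Theta_X$ be the module of germs at $p$ of holomorphic vector fields $\xi$ with $d\phi(\xi)\in I_X$, and define the relative Bruce-Roberts number $\mu_{BR}^{-}(\mathcal{F},X,p)=\dim_{\mathbb{C}}\mathcal{O}_p/(\omega(\Theta_X)+I_X)$, where $\omega(\Theta_X)=\{\omega(\xi):\xi\in\Theta_X\}$. The strict transform $\tilde{\mathcal{F}}$ of $\mathcal{F}$ is defined locally by $\pi^*\omega$ divided by the maximal power of the local equation of the exceptional divisor $\pi^{-1}(0)$. The blow-up $\pi$ is dicritical (with respect to $\mathcal{F}$) if $\pi^{-1}(0)$ is not $\tilde{\mathcal{F}}$-invariant, and non-dicritical otherwise. For a reduced plane curve germ $X$ with ideal $I_X$, $\Omega_X=\Omega^1/(I_X\Omega^1+\mathcal{O}\,dI_X)$ is the module of holomorphic 1-forms on $X$, where $\Omega^1$ is the module of germs of holomorphic 1-forms on the ambient surface;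 $\sigma^*\Omega_X$ and $\tilde\sigma^*\Omega_{\tilde X}$ denote the images of the pullback maps into the holomorphic 1-forms on the normalization $\overline X\cong(\mathbb{C},0)$. *)

theory Defs
  imports "HOL-Complex_Analysis.Complex_Analysis" "HOL-Library.Extended_Nat"
begin

text \<open>
  A germ at \<open>p\<close> is represented by any function that is holomorphic near \<open>p\<close>; germs are compared
  with \<open>\<forall>\<^sub>F z in nhds p\<close>.  All subspaces of germs below are closed under changing a
  function away from \<open>p\<close>, so the quotients of spaces of functions formed here coincide with the
  quotients of the corresponding spaces of germs.
\<close>

section \<open>Holomorphic germs in two variables\<close>

type_synonym cfun2 = "complex \<times> complex \<Rightarrow> complex"

definition holomorphic2_on :: "cfun2 \<Rightarrow> (complex \<times> complex) set \<Rightarrow> bool" where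
  "holomorphic2_on f U \<longleftrightarrow>
     (\<forall>z\<in>U. \<exists>a b. (f has_derivative (\<lambda>(h, k). a * h + b * k)) (at z))"

definition hol_germs :: "complex \<times> complex \<Rightarrow> cfun2 set" where
  "hol_germs p = {f. \<exists>U. open U \<and> p \<in> U \<and> holomorphic2_on f U}"

definition partial_x :: "cfun2 \<Rightarrow> cfun2" where
  "partial_x f = (\<lambda>(x, y). deriv (\<lambda>s. f (s, y)) x)"

definition partial_y :: "cfun2 \<Rightarrow> cfun2" where
  "partial_y f = (\<lambda>(x, y). deriv (\<lambda>s. f (x, s)) y)"

definition germ_dvd :: "complex \<times> complex \<Rightarrow> cfun2 \<Rightarrow> cfun2 \<Rightarrow> bool" where
  "germ_dvd p f g \<longleftrightarrow> (\<exists>h\<in>hol_germs p. \<forall>\<^sub>F z in nhds p. g z = h z * f z)"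

definition germ_unit :: "complex \<times> complex \<Rightarrow> cfun2 \<Rightarrow> bool" where
  "germ_unit p f \<longleftrightarrow> germ_dvd p f (\<lambda>_. 1)"

definition germ_coprime :: "complex \<times> complex \<Rightarrow> cfun2 \<Rightarrow> cfun2 \<Rightarrow> bool" where
  "germ_coprime p f g \<longleftrightarrow>
     (\<forall>d\<in>hol_germs p. germ_dvd p d f \<and> germ_dvd p d g \<longrightarrow> germ_unit p d)"

definition germ_irreducible :: "complex \<times> complex \<Rightarrow> cfun2 \<Rightarrow> bool" where
  "germ_irreducible p f \<longleftrightarrow>
     f \<in> hol_germs p \<and> \<not> (\<forall>\<^sub>F z in nhds p. f z = 0) \<and> \<not> germ_unit p f \<and>
     (\<forall>a\<in>hol_germs p. \<forall>b\<in>hol_germs p.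
        (\<forall>\<^sub>F z in nhds p. f z = a z * b z) \<longrightarrow> germ_unit p a \<or> germ_unit p b)"

definition vanishing_order2 :: "cfun2 \<Rightarrow> complex \<times> complex \<Rightarrow> enat" where
  "vanishing_order2 f p = Inf {enat (i + j) |i j. (partial_x ^^ i) ((partial_y ^^ j) f) p \<noteq> 0}"

definition vanishing_order1 :: "(complex \<Rightarrow> complex) \<Rightarrow> complex \<Rightarrow> enat" where
  "vanishing_order1 f t = Inf {enat n |n. (deriv ^^ n) f t \<noteq> 0}"

text \<open>
  The dimension of \<open>V / W\<close> over the complex numbers: the least number of elements of \<open>V\<close> whose
  classes span the quotient, and \<open>\<infinity>\<close> if no finite set does.
\<close>

definition quot_dim :: "('a \<Rightarrow> complex) set \<Rightarrow> ('a \<Rightarrow> complex) set \<Rightarrow> enat" where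
  "quot_dim V W = Inf {enat (card B) |B. finite B \<and> B \<subseteq> V \<and>
     (\<forall>v\<in>V. \<exists>c. (\<lambda>z. v z - (\<Sum>b\<in>B. c b * b z)) \<in> W)}"

section \<open>Foliations, invariant curves, the relative Bruce--Roberts number\<close>

text \<open>
  The pair \<open>(A, B)\<close> stands for the 1-form \<open>A dx + B dy\<close>, and in \<open>log_fields\<close> the pair \<open>(P, Q)\<close> stands
  for the vector field with these components along the coordinate directions.
\<close>

type_synonym form2 = "cfun2 \<times> cfun2"

definition foliation_form :: "complex \<times> complex \<Rightarrow> form2 \<Rightarrow> bool" where
  "foliation_form p \<omega> \<longleftrightarrow>
     fst \<omega> \<in> hol_germs p \<and> snd \<omega> \<in> hol_germs p \<and> germ_coprime p (fst \<omega>) (snd \<omega>)"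

definition singular_at :: "complex \<times> complex \<Rightarrow> form2 \<Rightarrow> bool" where
  "singular_at p \<omega> \<longleftrightarrow> fst \<omega> p = 0 \<and> snd \<omega> p = 0"

definition alg_multiplicity :: "complex \<times> complex \<Rightarrow> form2 \<Rightarrow> enat" where
  "alg_multiplicity p \<omega> = min (vanishing_order2 (fst \<omega>) p) (vanishing_order2 (snd \<omega>) p)"

definition invariant_curve :: "complex \<times> complex \<Rightarrow> form2 \<Rightarrow> cfun2 \<Rightarrow> bool" where
  "invariant_curve p \<omega> f \<longleftrightarrow>
     germ_dvd p f (\<lambda>z. fst \<omega> z * partial_y f z - snd \<omega> z * partial_x f z)"

definition log_fields :: "complex \<times> complex \<Rightarrow> cfun2 \<Rightarrow> (cfun2 \<times> cfun2) set" where
  "log_fields p \<phi> = {(P, Q). P \<in> hol_germs p \<and> Q \<in> hol_germs p \<and>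
     germ_dvd p \<phi> (\<lambda>z. P z * partial_x \<phi> z + Q z * partial_y \<phi> z)}"

definition bruce_roberts_ideal :: "complex \<times> complex \<Rightarrow> form2 \<Rightarrow> cfun2 \<Rightarrow> cfun2 set" where
  "bruce_roberts_ideal p \<omega> \<phi> = {h \<in> hol_germs p. \<exists>(P, Q)\<in>log_fields p \<phi>. \<exists>g\<in>hol_germs p.
     \<forall>\<^sub>F z in nhds p. h z = (fst \<omega> z * P z + snd \<omega> z * Q z) + g z * \<phi> z}"

definition mu_BR_rel :: "complex \<times> complex \<Rightarrow> form2 \<Rightarrow> cfun2 \<Rightarrow> enat" where
  "mu_BR_rel p \<omega> \<phi> = quot_dim (hol_germs p) (bruce_roberts_ideal p \<omega> \<phi>)"

section \<open>The blow-up of the origin\<close>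

text \<open>
  The blow-up is covered by two affine charts; \<open>exc c\<close> is the local equation of the exceptional
  divisor in the chart \<open>c\<close>.
\<close>

datatype chart = ChartX | ChartY

fun blowdown :: "chart \<Rightarrow> complex \<times> complex \<Rightarrow> complex \<times> complex" where
  "blowdown ChartX (x, v) = (x, x * v)"
| "blowdown ChartY (u, y) = (u * y, y)"

fun exc :: "chart \<Rightarrow> cfun2" where
  "exc ChartX = fst"
| "exc ChartY = snd"

definition pullback2 :: "(complex \<times> complex \<Rightarrow> complex \<times> complex) \<Rightarrow> form2 \<Rightarrow> form2" where
  "pullback2 F \<omega> =
     ((\<lambda>z. fst \<omega> (F z) * partial_x (fst \<circ> F) z + snd \<omega> (F z) * partial_x (snd \<circ> F) z),
      (\<lambda>z. fst \<omega> (F z) * partial_y (fst \<circ> F) z + snd \<omega> (F z) * partial_y (snd \<circ> F) z))"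

definition strict_transform_form :: "chart \<Rightarrow> complex \<times> complex \<Rightarrow> form2 \<Rightarrow> form2 \<Rightarrow> bool" where
  "strict_transform_form c q \<omega> \<omega>' \<longleftrightarrow>
     fst \<omega>' \<in> hol_germs q \<and> snd \<omega>' \<in> hol_germs q \<and>
     (\<exists>k. \<forall>\<^sub>F z in nhds q.
        fst (pullback2 (blowdown c) \<omega>) z = exc c z ^ k * fst \<omega>' z \<and>
        snd (pullback2 (blowdown c) \<omega>) z = exc c z ^ k * snd \<omega>' z) \<and>
     \<not> (germ_dvd q (exc c) (fst \<omega>') \<and> germ_dvd q (exc c) (snd \<omega>'))"

definition strict_transform_curve :: "chart \<Rightarrow> complex \<times> complex \<Rightarrow> cfun2 \<Rightarrow> cfun2 \<Rightarrow> bool" where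
  "strict_transform_curve c q \<phi> \<phi>' \<longleftrightarrow>
     \<phi>' \<in> hol_germs q \<and>
     (\<exists>k. \<forall>\<^sub>F z in nhds q. \<phi> (blowdown c z) = exc c z ^ k * \<phi>' z) \<and>
     \<not> germ_dvd q (exc c) \<phi>'"

definition dicritical :: "form2 \<Rightarrow> bool" where
  "dicritical \<omega> \<longleftrightarrow>
     \<not> (\<forall>c p \<omega>'. exc c p = 0 \<and> strict_transform_form c p \<omega> \<omega>' \<longrightarrow> invariant_curve p \<omega>' (exc c))"

section \<open>Normalization and pulled back 1-forms\<close>

text \<open>
  The normalization of an irreducible plane curve germ \<open>{\<phi> = 0}\<close> at \<open>q\<close>: a holomorphic map from
  \<open>(\<complex>, 0)\<close> which is a homeomorphism onto the curve and biholomorphic over the complement of \<open>q\<close>.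
\<close>

definition curve_normalization ::
  "complex \<times> complex \<Rightarrow> cfun2 \<Rightarrow> (complex \<Rightarrow> complex \<times> complex) \<Rightarrow> bool" where
  "curve_normalization q \<phi> \<gamma> \<longleftrightarrow> \<gamma> 0 = q \<and>
     (\<exists>U V \<delta>. open U \<and> 0 \<in> U \<and> open V \<and> q \<in> V \<and>
        (fst \<circ> \<gamma>) holomorphic_on U \<and> (snd \<circ> \<gamma>) holomorphic_on U \<and>
        homeomorphism U {z\<in>V. \<phi> z = 0} \<gamma> \<delta> \<and>
        (\<forall>t\<in>U - {0}. deriv (fst \<circ> \<gamma>) t \<noteq> 0 \<or> deriv (snd \<circ> \<gamma>) t \<noteq> 0))"

text \<open>
  The multiplicity of an irreducible curve through the origin, read off from its normalization \<open>\<sigma>\<close>.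
  It does not change under reparametrization or linear coordinate changes, and for a Puiseux
  parametrization \<open>(t ^ m, \<Sum>i\<ge>m. a i * t ^ i)\<close> it is the exponent \<open>m\<close>.
\<close>

definition param_multiplicity :: "(complex \<Rightarrow> complex \<times> complex) \<Rightarrow> enat" where
  "param_multiplicity \<sigma> = min (vanishing_order1 (fst \<circ> \<sigma>) 0) (vanishing_order1 (snd \<circ> \<sigma>) 0)"

text \<open>
  The image of pullback along a normalization \<open>\<gamma>\<close> of \<open>X\<close> at \<open>p\<close>, the form \<open>h dt\<close> being represented by
  \<open>h\<close>.  Forms in \<open>I\<^sub>X \<Omega>\<^sup>1 + \<O> dI\<^sub>X\<close> pull back to zero because
  equations of \<open>X\<close> vanish along \<open>\<gamma>\<close>, so the image of \<open>\<Omega>\<^sub>X\<close> is the image of \<open>\<Omega>\<^sup>1\<close>.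
\<close>

definition pulled_back_forms ::
  "complex \<times> complex \<Rightarrow> (complex \<Rightarrow> complex \<times> complex) \<Rightarrow> (complex \<Rightarrow> complex) set" where
  "pulled_back_forms p \<gamma> = {h. \<exists>a\<in>hol_germs p. \<exists>b\<in>hol_germs p. \<forall>\<^sub>F t in nhds 0.
     h t = a (\<gamma> t) * deriv (fst \<circ> \<gamma>) t + b (\<gamma> t) * deriv (snd \<circ> \<gamma>) t}"

end

theory Submission imports Defs "HOL-Computational_Algebra.Polynomial"
begin

text \<open>
  Everything is restricted to the branch. Let \<open>\<sigma> = (x, y)\<close> be the normalization of \<open>X\<close> and \<open>R\<close> the
  ring of the restrictions to \<open>X\<close>, inside the ring \<open>S\<close> of germs in \<open>t\<close>. A field \<open>(P, Q)\<close> is tangent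
  to \<open>X\<close> iff on the branch \<open>(P, Q) = g (x', y')\<close> for a meromorphic \<open>g\<close>, so the relative Bruce--Roberts
  number is the codimension in \<open>R\<close> of \<open>\<sigma>\<^sup>*\<omega> \<cdot> {g. g x' \<in> R \<and> g y' \<in> R}\<close>. Since the module of forms
  \<open>R x' + R y'\<close> has two generators, this codimension plus its own codimension in \<open>S\<close> equals
  \<open>ord \<sigma>\<^sup>*\<omega> + \<delta>\<close>, where \<open>\<delta> = dim S / R\<close>. The same holds for the blown-up branch, and in the
  difference the two codimensions of forms leave \<open>\<D>\<close>.

  It remains to compare the orders and the \<open>\<delta>\<close>. The pulled back form is divided by the power \<open>k = \<nu>\<close>
  or \<open>k = \<nu> + 1\<close> of the exceptional divisor, depending on whether the tangent cone of \<open>\<omega>\<close> vanishes,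
  and the divisor has order \<open>m\<close> along the branch: the orders differ by \<open>k m\<close>. If \<open>m = ord x \<le> ord y\<close>,
  then \<open>R\<close> is the sum of \<open>C{x} y^i\<close> and the ring of the blow-up the sum of \<open>C{x} (y / x)^i\<close> over
  \<open>i < m\<close>, so that \<open>\<delta>\<close> drops by \<open>0 + 1 + \<dots> + (m - 1)\<close>.
\<close>

section \<open>Dimensions of quotients\<close>

text \<open>The obstacle is that the hypotheses speak of equations while the count takes place on
  the parametrized branch. One has to know that \<phi> generates the ideal of germs vanishing on X,
  and that R has m generators over C{x}. In a parameter s with x = s^m, the points of the branch
  over x are (x, w(e s)) for the m-th roots of unity e. The product of all y - w(e s) is unchanged
  when s is multiplied by a root of unity, so its coefficients are functions of x. A Cauchy integral
  shows that this polynomial divides every germ vanishing on the branch, and irreducibility makes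
  \<phi> a unit multiple of it. Lagrange interpolation on the fibres, with the discriminant as
  denominator, puts x^N S inside the C{x}-module of the powers of w for some N. Hence the
  codimensions are finite, and a Taylor remainder of high order in y is absorbed. The equation
  \<phi>' gets its unit factor from \<phi>, since the polynomials of the two branches correspond
  under the blow-down up to the factor x^m.\<close>

definition lin_sub :: "('a \<Rightarrow> complex) set \<Rightarrow> bool" where
  "lin_sub W \<longleftrightarrow> (\<lambda>_. 0) \<in> W \<and> (\<forall>u\<in>W. \<forall>v\<in>W. (\<lambda>z. u z + v z) \<in> W) \<and>
     (\<forall>c. \<forall>u\<in>W. (\<lambda>z. c * u z) \<in> W)"

lemma lin_subI:
  assumes "(\<lambda>_. 0) \<in> W" "\<And>u v. u \<in> W \<Longrightarrow> v \<in> W \<Longrightarrow> (\<lambda>z. u z + v z) \<in> W"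
    "\<And>c u. u \<in> W \<Longrightarrow> (\<lambda>z. c * u z) \<in> W"
  shows "lin_sub W"
  using assms by (auto simp: lin_sub_def)

lemma lin_sub_add: "lin_sub W \<Longrightarrow> u \<in> W \<Longrightarrow> v \<in> W \<Longrightarrow> (\<lambda>z. u z + v z) \<in> W"
  and lin_sub_scale: "lin_sub W \<Longrightarrow> u \<in> W \<Longrightarrow> (\<lambda>z. c * u z) \<in> W"
  and lin_sub_zero: "lin_sub W \<Longrightarrow> (\<lambda>_. 0) \<in> W"
  by (auto simp: lin_sub_def)

lemma lin_sub_diff:
  assumes "lin_sub W" "u \<in> W" "v \<in> W" shows "(\<lambda>z. u z - v z) \<in> W"
  using lin_sub_add[OF assms(1,2) lin_sub_scale[OF assms(1,3), of "-1"]] by simp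

lemma lin_sub_sum:
  assumes "lin_sub W" "finite I" "\<And>i. i \<in> I \<Longrightarrow> f i \<in> W"
  shows "(\<lambda>z. \<Sum>i\<in>I. f i z) \<in> W"
  using assms(2,3)
  by (induction I rule: finite_induct) (auto intro: lin_sub_zero lin_sub_add assms(1))

lemma lin_sub_lincomb:
  assumes "lin_sub W" "finite I" "\<And>i. i \<in> I \<Longrightarrow> f i \<in> W"
  shows "(\<lambda>z. \<Sum>i\<in>I. c i * f i z) \<in> W"
  by (rule lin_sub_sum) (use assms lin_sub_scale in auto)

text \<open>Families are indexed rather than sets of functions, so that a basis can be carried
  through a linear map or joined to another one with no injectivity to check.\<close>

definition indep_mod :: "('a \<Rightarrow> complex) set \<Rightarrow> 'i set \<Rightarrow> ('i \<Rightarrow> 'a \<Rightarrow> complex) \<Rightarrow> bool" where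
  "indep_mod W I b \<longleftrightarrow> (\<forall>c. (\<lambda>z. \<Sum>i\<in>I. c i * b i z) \<in> W \<longrightarrow> (\<forall>i\<in>I. c i = 0))"

definition span_mod :: "('a \<Rightarrow> complex) set \<Rightarrow> ('a \<Rightarrow> complex) set \<Rightarrow> 'i set \<Rightarrow> ('i \<Rightarrow> 'a \<Rightarrow> complex) \<Rightarrow> bool" where
  "span_mod V W I b \<longleftrightarrow> (\<forall>v\<in>V. \<exists>c. (\<lambda>z. v z - (\<Sum>i\<in>I. c i * b i z)) \<in> W)"

lemma indep_modD:
  assumes "indep_mod W I b" "(\<lambda>z. \<Sum>i\<in>I. c i * b i z) \<in> W" "i \<in> I"
  shows "c i = 0"
  using assms(1)[unfolded indep_mod_def, rule_format, of c, OF assms(2,3)] .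

lemma span_modE:
  assumes "span_mod V W I b" "v \<in> V"
  obtains c where "(\<lambda>z. v z - (\<Sum>i\<in>I. c i * b i z)) \<in> W"
  using assms unfolding span_mod_def by blast

definition basis_mod :: "('a \<Rightarrow> complex) set \<Rightarrow> ('a \<Rightarrow> complex) set \<Rightarrow> 'i set \<Rightarrow> ('i \<Rightarrow> 'a \<Rightarrow> complex) \<Rightarrow> bool" where
  "basis_mod V W I b \<longleftrightarrow> finite I \<and> b ` I \<subseteq> V \<and> span_mod V W I b \<and> indep_mod W I b"

text \<open>Unlike \<open>quot_dim\<close> this asserts finite dimension, so dimensions add as
  natural numbers. A definition cannot quantify over the index type, hence \<open>nat\<close>;
  \<open>basis_mod_imp_qdim\<close> brings any other index set into it.\<close>

definition qdim :: "('a \<Rightarrow> complex) set \<Rightarrow> ('a \<Rightarrow> complex) set \<Rightarrow> nat \<Rightarrow> bool" where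
  "qdim V W n \<longleftrightarrow> (\<exists>(I :: nat set) b. basis_mod V W I b \<and> card I = n)"

lemma basis_mod_reindex:
  assumes "bij_betw h J I" "basis_mod V W I b"
  shows "basis_mod V W J (\<lambda>j. b (h j))"
proof -
  have fin: "finite J" using assms bij_betw_finite unfolding basis_mod_def by blast
  have im: "h ` J = I" and inj: "inj_on h J" using assms(1) by (auto simp: bij_betw_def)
  have "span_mod V W J (\<lambda>j. b (h j))"
    unfolding span_mod_def
  proof
    fix v assume "v \<in> V"
    then obtain c where c: "(\<lambda>z. v z - (\<Sum>i\<in>I. c i * b i z)) \<in> W"
      using assms(2) unfolding basis_mod_def span_mod_def by blast
    have "(\<Sum>i\<in>I. c i * b i z) = (\<Sum>j\<in>J. c (h j) * b (h j) z)" for z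
      using sum.reindex_bij_betw[OF assms(1), of "\<lambda>i. c i * b i z"] by simp
    with c show "\<exists>c. (\<lambda>z. v z - (\<Sum>j\<in>J. c j * b (h j) z)) \<in> W"
      by (intro exI[of _ "\<lambda>j. c (h j)"]) simp
  qed
  moreover have "indep_mod W J (\<lambda>j. b (h j))"
    unfolding indep_mod_def
  proof (intro allI impI)
    fix c assume c: "(\<lambda>z. \<Sum>j\<in>J. c j * b (h j) z) \<in> W"
    let ?g = "inv_into J h"
    have "(\<Sum>j\<in>J. c j * b (h j) z) = (\<Sum>i\<in>I. c (?g i) * b i z)" for z
    proof -
      have "(\<Sum>j\<in>J. c j * b (h j) z) = (\<Sum>j\<in>J. c (?g (h j)) * b (h j) z)"
        using inj by (intro sum.cong) auto
      also have "\<dots> = (\<Sum>i\<in>I. c (?g i) * b i z)"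
        by (rule sum.reindex_bij_betw[OF assms(1), of "\<lambda>i. c (?g i) * b i z"])
      finally show ?thesis .
    qed
    with c have "(\<lambda>z. \<Sum>i\<in>I. c (?g i) * b i z) \<in> W" by simp
    hence "\<forall>i\<in>I. c (?g i) = 0"
      using indep_modD[of W I b "\<lambda>i. c (?g i)"] assms(2) by (simp add: basis_mod_def)
    thus "\<forall>j\<in>J. c j = 0" using im inj by (metis imageI inv_into_f_f)
  qed
  ultimately show ?thesis
    using fin im assms(2) unfolding basis_mod_def by auto
qed

lemma basis_mod_imp_qdim:
  assumes "basis_mod V W I b" shows "qdim V W (card I)"
proof -
  have "finite I" using assms by (simp add: basis_mod_def)
  then obtain h where h: "bij_betw h {0..<card I} I"
    using ex_bij_betw_nat_finite by blast
  show ?thesis unfolding qdim_def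
    using basis_mod_reindex[OF h assms] by (intro exI conjI) auto
qed

text \<open>Gaussian elimination, by induction on the equations: a nonzero pivot in equation
  \<open>j0\<close> removes one unknown together with that equation, so the surplus of unknowns
  survives.\<close>

lemma underdetermined_system:
  fixes a :: "'i \<Rightarrow> 'j \<Rightarrow> complex"
  assumes "finite J" "finite I" "card J < card I"
  shows "\<exists>c. (\<exists>i\<in>I. c i \<noteq> 0) \<and> (\<forall>j\<in>J. (\<Sum>i\<in>I. c i * a i j) = 0)"
  using assms
proof (induction J arbitrary: I a rule: finite_induct)
  case empty
  then obtain i where "i \<in> I" by (metis card_gt_0_iff card.empty ex_in_conv)
  thus ?case by (intro exI[of _ "\<lambda>_. 1"]) auto
next
  case (insert j0 J)
  show ?case
  proof (cases "\<forall>i\<in>I. a i j0 = 0")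
    case True
    from insert have "card J < card I" by simp
    with insert.IH[of I a] insert.prems obtain c
      where "\<exists>i\<in>I. c i \<noteq> 0" "\<forall>j\<in>J. (\<Sum>i\<in>I. c i * a i j) = 0" by blast
    thus ?thesis using True by (intro exI[of _ c]) auto
  next
    case False
    then obtain i0 where i0: "i0 \<in> I" "a i0 j0 \<noteq> 0" by blast
    define I' where "I' = I - {i0}"
    \<comment> \<open>Subtracting a multiple of row \<open>i0\<close> clears column
      \<open>j0\<close>.\<close>
    define a' where "a' i j = a i j - a i j0 / a i0 j0 * a i0 j" for i j
    have I: "I = insert i0 I'" "i0 \<notin> I'" "finite I'" using i0 insert.prems by (auto simp: I'_def)
    have "card J < card I'" using insert.prems insert.hyps I by simp
    from insert.IH[OF \<open>finite I'\<close> this, of a'] obtain c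
      where c: "\<exists>i\<in>I'. c i \<noteq> 0" "\<And>j. j\<in>J \<Longrightarrow> (\<Sum>i\<in>I'. c i * a' i j) = 0" by blast
    \<comment> \<open>The value of the eliminated unknown that equation \<open>j0\<close>
      forces.\<close>
    define k where "k = - (\<Sum>i\<in>I'. c i * a i j0) / a i0 j0"
    define d where "d = c(i0 := k)"
    have d: "d i = c i" if "i \<in> I'" for i using that I by (auto simp: d_def)
    have eq: "(\<Sum>i\<in>I. d i * a i j) = k * a i0 j + (\<Sum>i\<in>I'. c i * a i j)" for j
      using I d by (simp add: d_def)
    have "(\<Sum>i\<in>I. d i * a i j) = 0" if "j \<in> insert j0 J" for j
    proof (cases "j = j0")
      case True thus ?thesis using eq[of j0] i0 by (simp add: k_def)
    next
      case False
      hence "0 = (\<Sum>i\<in>I'. c i * a' i j)" using c(2) that by simp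
      also have "\<dots> = (\<Sum>i\<in>I'. c i * a i j) - (\<Sum>i\<in>I'. c i * a i j0) / a i0 j0 * a i0 j"
        by (simp add: a'_def algebra_simps sum_subtractf sum_distrib_left sum_divide_distrib)
      finally show ?thesis using eq[of j] by (simp add: k_def)
    qed
    moreover have "\<exists>i\<in>I. d i \<noteq> 0" using c(1) d I by force
    ultimately show ?thesis by blast
  qed
qed

text \<open>If J were smaller, writing each \<open>b i\<close> modulo W through the
  \<open>b' j\<close> would leave fewer equations than unknowns, and a nontrivial solution is a
  relation among the \<open>b i\<close>.\<close>

lemma card_indep_le_span:
  assumes W: "lin_sub W" and fin: "finite I" "finite J"
    and b: "b ` I \<subseteq> V" "indep_mod W I b" and b': "span_mod V W J b'"
  shows "card I \<le> card J"
proof (rule ccontr)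
  assume "\<not> card I \<le> card J"
  hence lt: "card J < card I" by simp
  have "\<forall>i\<in>I. \<exists>a. (\<lambda>z. b i z - (\<Sum>j\<in>J. a j * b' j z)) \<in> W"
    using b b' unfolding span_mod_def by blast
  then obtain a where a: "\<And>i. i \<in> I \<Longrightarrow> (\<lambda>z. b i z - (\<Sum>j\<in>J. a i j * b' j z)) \<in> W"
    by metis
  obtain c where c: "\<exists>i\<in>I. c i \<noteq> 0" "\<And>j. j \<in> J \<Longrightarrow> (\<Sum>i\<in>I. c i * a i j) = 0"
    using underdetermined_system[OF fin(2,1) lt, of a] by blast
  have "(\<lambda>z. \<Sum>i\<in>I. c i * (b i z - (\<Sum>j\<in>J. a i j * b' j z))) \<in> W"
    by (rule lin_sub_lincomb[OF W fin(1)]) (use a in auto)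
  also have "(\<lambda>z. \<Sum>i\<in>I. c i * (b i z - (\<Sum>j\<in>J. a i j * b' j z))) = (\<lambda>z. \<Sum>i\<in>I. c i * b i z)"
  proof
    fix z
    have "(\<Sum>i\<in>I. c i * (\<Sum>j\<in>J. a i j * b' j z)) = (\<Sum>i\<in>I. \<Sum>j\<in>J. c i * a i j * b' j z)"
      by (simp add: sum_distrib_left mult.assoc)
    also have "\<dots> = (\<Sum>j\<in>J. (\<Sum>i\<in>I. c i * a i j) * b' j z)"
      by (subst sum.swap) (simp add: sum_distrib_right)
    also have "\<dots> = 0" using c(2) by simp
    finally show "(\<Sum>i\<in>I. c i * (b i z - (\<Sum>j\<in>J. a i j * b' j z))) = (\<Sum>i\<in>I. c i * b i z)"
      by (simp add: algebra_simps sum_subtractf)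
  qed
  finally show False using b(2) c(1) unfolding indep_mod_def by blast
qed

text \<open>\<open>quot_dim\<close> minimises over spanning sets. Independence makes a basis
  injective, so its image is such a set with n elements, and an independent family is never larger
  than a spanning one.\<close>

lemma qdim_imp_quot_dim:
  assumes W: "lin_sub W" and "qdim V W n"
  shows "quot_dim V W = enat n"
proof -
  from assms(2) obtain I :: "nat set" and b where I: "basis_mod V W I b" "card I = n"
    unfolding qdim_def by blast
  hence fin: "finite I" and bV: "b ` I \<subseteq> V" and sp: "span_mod V W I b" and ind: "indep_mod W I b"
    by (auto simp: basis_mod_def)
  have inj: "inj_on b I"
  proof (rule inj_onI, rule ccontr)
    fix i j assume ij: "i \<in> I" "j \<in> I" "b i = b j" "i \<noteq> j"
    \<comment> \<open>If two members agreed, their difference would be a nontrivial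
      relation.\<close>
    let ?c = "\<lambda>k. if k = i then 1 else if k = j then - 1 else (0::complex)"
    have "(\<Sum>k\<in>I. ?c k * b k z) = 0" for z
    proof -
      have "(\<Sum>k\<in>I. ?c k * b k z) = (\<Sum>k\<in>{i,j}. ?c k * b k z)"
        using ij fin by (intro sum.mono_neutral_right) auto
      thus ?thesis using ij by simp
    qed
    hence "(\<lambda>z. \<Sum>k\<in>I. ?c k * b k z) \<in> W" using lin_sub_zero[OF W] by simp
    hence "?c i = 0" by (rule indep_modD[OF ind _ ij(1)])
    thus False by simp
  qed
  let ?S = "{enat (card B) |B. finite B \<and> B \<subseteq> V \<and>
     (\<forall>v\<in>V. \<exists>c. (\<lambda>z. v z - (\<Sum>b\<in>B. c b * b z)) \<in> W)}"
  have "enat n \<in> ?S"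
  proof -
    have "\<exists>c. (\<lambda>z. v z - (\<Sum>f\<in>b ` I. c f * f z)) \<in> W" if v: "v \<in> V" for v
    proof -
      obtain c where c: "(\<lambda>z. v z - (\<Sum>i\<in>I. c i * b i z)) \<in> W"
        using sp v unfolding span_mod_def by blast
      have "(\<Sum>f\<in>b ` I. c (inv_into I b f) * f z) = (\<Sum>i\<in>I. c i * b i z)" for z
        using inj by (simp add: sum.reindex)
      with c show ?thesis by (intro exI[of _ "\<lambda>f. c (inv_into I b f)"]) simp
    qed
    thus ?thesis using fin bV I(2) inj
      by (intro CollectI exI[of _ "b ` I"]) (auto simp: card_image)
  qed
  moreover have "enat n \<le> s" if "s \<in> ?S" for s
  proof -
    from that obtain B where B: "s = enat (card B)" "finite B"
      "\<forall>v\<in>V. \<exists>c. (\<lambda>z. v z - (\<Sum>b\<in>B. c b * b z)) \<in> W" by blast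
    have "card I \<le> card B"
      by (rule card_indep_le_span[OF W fin B(2) bV ind, of "\<lambda>x. x"]) (use B(3) in \<open>simp add: span_mod_def\<close>)
    thus ?thesis using B I by simp
  qed
  ultimately show ?thesis unfolding quot_dim_def
    by (intro antisym Inf_lower Inf_greatest)
qed

lemma qdim_unique: "lin_sub W \<Longrightarrow> qdim V W n \<Longrightarrow> qdim V W k \<Longrightarrow> n = k"
  using qdim_imp_quot_dim by (metis enat.inject)

text \<open>An independent family of largest cardinality must span: a vector outside its span could
  be added to it.\<close>

lemma qdim_bounded:
  assumes W: "lin_sub W"
    and bound: "\<And>(I :: nat set) b. finite I \<Longrightarrow> b ` I \<subseteq> V \<Longrightarrow> indep_mod W I b \<Longrightarrow> card I \<le> n"
  shows "\<exists>k. qdim V W k"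
proof -
  let ?K = "{card I |(I :: nat set) b. finite I \<and> b ` I \<subseteq> V \<and> indep_mod W I b}"
  have "card ({} :: nat set) \<in> ?K" by (intro CollectI exI[of _ "{}"]) (auto simp: indep_mod_def)
  hence ne: "?K \<noteq> {}" by blast
  have "?K \<subseteq> {..n}" using bound by auto
  hence finK: "finite ?K" by (rule finite_subset) simp
  from Max_in[OF finK ne] obtain I :: "nat set" and b
    where I: "card I = Max ?K" "finite I" "b ` I \<subseteq> V" "indep_mod W I b" by auto
  have "span_mod V W I b"
    unfolding span_mod_def
  proof (rule ballI, rule ccontr)
    fix v assume v: "v \<in> V" and no: "\<nexists>c. (\<lambda>z. v z - (\<Sum>i\<in>I. c i * b i z)) \<in> W"
    obtain k where k: "k \<notin> I" using I(2) ex_new_if_finite infinite_UNIV_nat by blast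
    have "indep_mod W (insert k I) (b(k := v))"
      unfolding indep_mod_def
    proof (intro allI impI)
      fix c assume "(\<lambda>z. \<Sum>i\<in>insert k I. c i * (b(k := v)) i z) \<in> W"
      also have "(\<lambda>z. \<Sum>i\<in>insert k I. c i * (b(k := v)) i z) = (\<lambda>z. c k * v z + (\<Sum>i\<in>I. c i * b i z))"
        using k I(2) by (auto intro!: ext sum.cong)
      finally have c: "(\<lambda>z. c k * v z + (\<Sum>i\<in>I. c i * b i z)) \<in> W" .
      have ck: "c k = 0"
      proof (rule ccontr)
        assume nz: "c k \<noteq> 0"
        have "(\<lambda>z. inverse (c k) * (c k * v z + (\<Sum>i\<in>I. c i * b i z))) \<in> W"
          by (rule lin_sub_scale[OF W c])
        also have "(\<lambda>z. inverse (c k) * (c k * v z + (\<Sum>i\<in>I. c i * b i z))) =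
          (\<lambda>z. v z - (\<Sum>i\<in>I. (- c i / c k) * b i z))"
          using nz by (auto simp: field_simps sum_negf sum_divide_distrib sum_distrib_left intro!: ext)
        finally have "\<exists>c. (\<lambda>z. v z - (\<Sum>i\<in>I. c i * b i z)) \<in> W" by (rule exI[of _ "\<lambda>i. - c i / c k"])
        thus False using no by contradiction
      qed
      with c have "(\<lambda>z. \<Sum>i\<in>I. c i * b i z) \<in> W" by simp
      with ck show "\<forall>i\<in>insert k I. c i = 0" using indep_modD[OF I(4)] by blast
    qed
    moreover have "(b(k := v)) ` insert k I \<subseteq> V" using I(3) v k by auto
    ultimately have "card (insert k I) \<in> ?K" using I(2) by blast
    hence "card (insert k I) \<le> Max ?K" using finK by (rule Max_ge[rotated])
    thus False using I k by simp
  qed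
  thus ?thesis using I unfolding qdim_def basis_mod_def by blast
qed

text \<open>Families independent modulo U are independent modulo the smaller W, and families in U
  lie in V. Both layers therefore inherit the bound n on independent families.\<close>

lemma qdim_intermediate:
  assumes "lin_sub W" "lin_sub U" "W \<subseteq> U" "U \<subseteq> V" "qdim V W n"
  obtains k l where "qdim V U k" "qdim U W l"
proof -
  from assms(5) obtain J :: "nat set" and b' where J: "basis_mod V W J b'" "card J = n"
    unfolding qdim_def by blast
  have "card I \<le> n" if "finite I" "b ` I \<subseteq> V" "indep_mod W I b" for I :: "nat set" and b
    using card_indep_le_span[OF assms(1) that(1) _ that(2,3)] J unfolding basis_mod_def by blast
  note bd = this
  have "\<exists>k. qdim V U k"
    by (rule qdim_bounded[OF assms(2), of _ n], rule bd)
      (use assms(3) in \<open>auto simp: indep_mod_def\<close>)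
  moreover have "\<exists>k. qdim U W k"
    by (rule qdim_bounded[OF assms(1), of _ n], rule bd) (use assms(4) in auto)
  ultimately show ?thesis using that by blast
qed

text \<open>Bases of the two layers are concatenated. A relation modulo W is read modulo U first,
  where the part from J disappears.\<close>

lemma qdim_trans:
  assumes U: "lin_sub U" and W: "lin_sub W" and sub: "W \<subseteq> U" "U \<subseteq> V"
    and "qdim V U k" "qdim U W l"
  shows "qdim V W (k + l)"
proof -
  from assms obtain I J :: "nat set" and b b'
    where I: "basis_mod V U I b" "card I = k" and J: "basis_mod U W J b'" "card J = l"
    unfolding qdim_def by blast
  define B where "B = case_sum b b'"
  have fin: "finite I" "finite J" using I J by (auto simp: basis_mod_def)
  have spI: "span_mod V U I b" and spJ: "span_mod U W J b'" using I J by (auto simp: basis_mod_def)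
  have S: "(\<Sum>i\<in>I <+> J. c i * B i z) = (\<Sum>i\<in>I. c (Inl i) * b i z) + (\<Sum>i\<in>J. c (Inr i) * b' i z)" for c z
    using fin by (simp add: sum.Plus B_def)
  have J_U: "(\<lambda>z. \<Sum>i\<in>J. c i * b' i z) \<in> U" for c
    using J by (intro lin_sub_lincomb[OF U fin(2)]) (auto simp: basis_mod_def)
  have "basis_mod V W (I <+> J) B"
    unfolding basis_mod_def
  proof (intro conjI)
    show "finite (I <+> J)" using fin by simp
    show "B ` (I <+> J) \<subseteq> V" 
    proof -
      have "b ` I \<subseteq> V" "b' ` J \<subseteq> V" using I J sub by (auto simp: basis_mod_def)
      thus ?thesis by (auto simp: B_def)
    qed
    show "span_mod V W (I <+> J) B" unfolding span_mod_def
    proof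
      fix v assume "v \<in> V"
      then obtain c where "(\<lambda>z. v z - (\<Sum>i\<in>I. c i * b i z)) \<in> U"
        using spI span_modE by blast
      from span_modE[OF spJ this]
      obtain d where d: "(\<lambda>z. (v z - (\<Sum>i\<in>I. c i * b i z)) - (\<Sum>i\<in>J. d i * b' i z)) \<in> W" .
      show "\<exists>c. (\<lambda>z. v z - (\<Sum>i\<in>I <+> J. c i * B i z)) \<in> W"
        by (rule exI[of _ "case_sum c d"], unfold S) (use d in \<open>simp add: algebra_simps\<close>)
    qed
    show "indep_mod W (I <+> J) B" unfolding indep_mod_def S
    proof (intro allI impI)
      fix c assume c: "(\<lambda>z. (\<Sum>i\<in>I. c (Inl i) * b i z) + (\<Sum>i\<in>J. c (Inr i) * b' i z)) \<in> W"
      have "(\<lambda>z. ((\<Sum>i\<in>I. c (Inl i) * b i z) + (\<Sum>i\<in>J. c (Inr i) * b' i z))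
          - (\<Sum>i\<in>J. c (Inr i) * b' i z)) \<in> U"
        by (rule lin_sub_diff[OF U]) (use c sub J_U[of "\<lambda>i. c (Inr i)"] in auto)
      hence "(\<lambda>z. \<Sum>i\<in>I. c (Inl i) * b i z) \<in> U" by simp
      hence 1: "\<forall>i\<in>I. c (Inl i) = 0"
        using I indep_modD[of U I b "\<lambda>i. c (Inl i)"] by (simp add: basis_mod_def)
      hence "(\<lambda>z. \<Sum>i\<in>J. c (Inr i) * b' i z) \<in> W" using c by simp
      hence "\<forall>i\<in>J. c (Inr i) = 0"
        using J indep_modD[of W J b' "\<lambda>i. c (Inr i)"] by (simp add: basis_mod_def)
      with 1 show "\<forall>i\<in>I <+> J. c i = 0" by auto
    qed
  qed
  from basis_mod_imp_qdim[OF this] show ?thesis using I J fin by (simp add: card_Plus)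
qed

section \<open>Transport of quotients along linear maps\<close>

definition lin_map :: "(('a \<Rightarrow> complex) \<Rightarrow> 'b \<Rightarrow> complex) \<Rightarrow> bool" where
  "lin_map T \<longleftrightarrow> (\<forall>u v. T (\<lambda>z. u z + v z) = (\<lambda>z. T u z + T v z)) \<and>
     (\<forall>c u. T (\<lambda>z. c * u z) = (\<lambda>z. c * T u z))"

lemma lin_map_add: "lin_map T \<Longrightarrow> T (\<lambda>z. u z + v z) = (\<lambda>z. T u z + T v z)"
  and lin_map_scale: "lin_map T \<Longrightarrow> T (\<lambda>z. c * u z) = (\<lambda>z. c * T u z)"
  by (auto simp: lin_map_def)

lemma lin_map_diff:
  assumes "lin_map T" shows "T (\<lambda>z. u z - v z) = (\<lambda>z. T u z - T v z)"
  using lin_map_add[OF assms, of u "\<lambda>z. (-1) * v z"] lin_map_scale[OF assms, of "-1" v] by simp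

lemma lin_map_lincomb:
  assumes "lin_map T" "finite I"
  shows "T (\<lambda>z. \<Sum>i\<in>I. c i * b i z) = (\<lambda>z. \<Sum>i\<in>I. c i * T (b i) z)"
  using assms(2)
proof (induction I rule: finite_induct)
  case empty
  show ?case using lin_map_scale[OF assms(1), of 0 "\<lambda>_. 0"] by simp
next
  case (insert i I)
  thus ?case by (simp add: lin_map_add[OF assms(1)] lin_map_scale[OF assms(1)])
qed

text \<open>It is enough that T induces an isomorphism of the quotients. Surjectivity is asked for
  only modulo \<open>W'\<close>, because images are known only as germs and functions with the same
  germ may differ away from the point.\<close>

lemma qdim_transport:
  assumes T: "lin_map T" and W': "lin_sub W'"
    and into: "\<And>v. v \<in> V \<Longrightarrow> T v \<in> V'"
    and onto: "\<And>v'. v' \<in> V' \<Longrightarrow> \<exists>v\<in>V. (\<lambda>z. v' z - T v z) \<in> W'"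
    and V: "lin_sub V"
    and ker: "\<And>v. v \<in> V \<Longrightarrow> T v \<in> W' \<longleftrightarrow> v \<in> W"
  shows "qdim V W n \<longleftrightarrow> qdim V' W' n"
proof
  assume "qdim V W n"
  then obtain I :: "nat set" and b where I: "basis_mod V W I b" "card I = n"
    unfolding qdim_def by blast
  hence fin: "finite I" by (simp add: basis_mod_def)
  have lin: "T (\<lambda>z. \<Sum>i\<in>I. c i * b i z) = (\<lambda>z. \<Sum>i\<in>I. c i * T (b i) z)" for c
    by (rule lin_map_lincomb[OF T fin])
  have lV: "(\<lambda>z. \<Sum>i\<in>I. c i * b i z) \<in> V" for c
    using I by (intro lin_sub_lincomb[OF V fin]) (auto simp: basis_mod_def)
  have "basis_mod V' W' I (\<lambda>i. T (b i))"
    unfolding basis_mod_def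
  proof (intro conjI)
    show "finite I" by fact
    show "(\<lambda>i. T (b i)) ` I \<subseteq> V'" using I into by (auto simp: basis_mod_def)
    show "span_mod V' W' I (\<lambda>i. T (b i))" unfolding span_mod_def
    proof
      fix v' assume "v' \<in> V'"
      then obtain v where v: "v \<in> V" "(\<lambda>z. v' z - T v z) \<in> W'" using onto by blast
      with I(1) obtain c where c: "(\<lambda>z. v z - (\<Sum>i\<in>I. c i * b i z)) \<in> W"
        unfolding basis_mod_def by (blast elim: span_modE)
      have "T (\<lambda>z. v z - (\<Sum>i\<in>I. c i * b i z)) \<in> W'"
        using ker[of "\<lambda>z. v z - (\<Sum>i\<in>I. c i * b i z)"] c lin_sub_diff[OF V v(1) lV] by blast
      also have "T (\<lambda>z. v z - (\<Sum>i\<in>I. c i * b i z)) = (\<lambda>z. T v z - (\<Sum>i\<in>I. c i * T (b i) z))"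
        by (simp add: lin_map_diff[OF T] lin)
      finally have "(\<lambda>z. (v' z - T v z) + (T v z - (\<Sum>i\<in>I. c i * T (b i) z))) \<in> W'"
        by (rule lin_sub_add[OF W' v(2)])
      thus "\<exists>c. (\<lambda>z. v' z - (\<Sum>i\<in>I. c i * T (b i) z)) \<in> W'" by auto
    qed
    show "indep_mod W' I (\<lambda>i. T (b i))" unfolding indep_mod_def
    proof (intro allI impI ballI)
      fix c i assume "(\<lambda>z. \<Sum>i\<in>I. c i * T (b i) z) \<in> W'" "i \<in> I"
      moreover from this have "(\<lambda>z. \<Sum>i\<in>I. c i * b i z) \<in> W" by (simp only: lin[of c, symmetric] ker[OF lV])
      ultimately show "c i = 0" using I(1) indep_modD[of W I b c i] by (simp add: basis_mod_def)
    qed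
  qed
  thus "qdim V' W' n" using I unfolding qdim_def by blast
next
  assume "qdim V' W' n"
  then obtain I :: "nat set" and b' where I: "basis_mod V' W' I b'" "card I = n"
    unfolding qdim_def by blast
  hence fin: "finite I" by (simp add: basis_mod_def)
  have "\<forall>i\<in>I. \<exists>v\<in>V. (\<lambda>z. b' i z - T v z) \<in> W'" using onto I by (auto simp: basis_mod_def)
  then obtain b where b: "\<And>i. i \<in> I \<Longrightarrow> b i \<in> V" "\<And>i. i \<in> I \<Longrightarrow> (\<lambda>z. b' i z - T (b i) z) \<in> W'" by metis
  have lin: "T (\<lambda>z. \<Sum>i\<in>I. c i * b i z) = (\<lambda>z. \<Sum>i\<in>I. c i * T (b i) z)" for c
    by (rule lin_map_lincomb[OF T fin])
  have lV: "(\<lambda>z. \<Sum>i\<in>I. c i * b i z) \<in> V" for c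
    using b by (intro lin_sub_lincomb[OF V fin])
  \<comment> \<open>The chosen preimages reproduce the \<open>b' i\<close> only up to errors in
    \<open>W'\<close>, and so do all their linear combinations.\<close>
  have df: "(\<lambda>z. \<Sum>i\<in>I. c i * (b' i z - T (b i) z)) \<in> W'" for c
    by (rule lin_sub_lincomb[OF W' fin]) (use b in auto)
  have "basis_mod V W I b"
    unfolding basis_mod_def
  proof (intro conjI)
    show "finite I" by fact
    show "b ` I \<subseteq> V" using b by auto
    show "span_mod V W I b" unfolding span_mod_def
    proof
      fix v assume v: "v \<in> V"
      have "span_mod V' W' I b'" using I(1) by (simp add: basis_mod_def)
      from span_modE[OF this into[OF v]]
      obtain c where c: "(\<lambda>z. T v z - (\<Sum>i\<in>I. c i * b' i z)) \<in> W'" .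
      have eq: "T (\<lambda>z. v z - (\<Sum>i\<in>I. c i * b i z)) =
          (\<lambda>z. (T v z - (\<Sum>i\<in>I. c i * b' i z)) + (\<Sum>i\<in>I. c i * (b' i z - T (b i) z)))"
        by (simp add: lin_map_diff[OF T] lin algebra_simps sum_subtractf)
      have "T (\<lambda>z. v z - (\<Sum>i\<in>I. c i * b i z)) \<in> W'"
        unfolding eq by (rule lin_sub_add[OF W' c df])
      hence "(\<lambda>z. v z - (\<Sum>i\<in>I. c i * b i z)) \<in> W"
        using ker lin_sub_diff[OF V v lV] by blast
      thus "\<exists>c. (\<lambda>z. v z - (\<Sum>i\<in>I. c i * b i z)) \<in> W" by blast
    qed
    show "indep_mod W I b" unfolding indep_mod_def
    proof (intro allI impI)
      fix c assume "(\<lambda>z. \<Sum>i\<in>I. c i * b i z) \<in> W"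
      hence "(\<lambda>z. \<Sum>i\<in>I. c i * T (b i) z) \<in> W'" by (simp only: lin[of c, symmetric] ker[OF lV])
      from lin_sub_add[OF W' this df[of c]] have "(\<lambda>z. \<Sum>i\<in>I. c i * b' i z) \<in> W'"
        by (simp add: algebra_simps sum_subtractf)
      thus "\<forall>i\<in>I. c i = 0" using I(1) indep_modD[of W' I b' c] by (simp add: basis_mod_def)
    qed
  qed
  thus "qdim V W n" using I unfolding qdim_def by blast
qed

section \<open>Holomorphic functions of two variables\<close>

lemma holomorphic2_on_partials:
  assumes "holomorphic2_on f U" "z \<in> U"
  shows "(f has_derivative (\<lambda>(h, k). partial_x f z * h + partial_y f z * k)) (at z)"
    and "((\<lambda>s. f (s, snd z)) has_field_derivative partial_x f z) (at (fst z))"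
    and "((\<lambda>s. f (fst z, s)) has_field_derivative partial_y f z) (at (snd z))"
proof -
  obtain x y where z: "z = (x, y)" by (cases z)
  from assms obtain a b where ab: "(f has_derivative (\<lambda>(h, k). a * h + b * k)) (at (x, y))"
    unfolding holomorphic2_on_def z by blast
  have "((f \<circ> (\<lambda>s. (s, y))) has_derivative ((\<lambda>(h, k). a * h + b * k) \<circ> (\<lambda>h. (h, 0)))) (at x)"
    by (rule diff_chain_at) (auto intro!: derivative_eq_intros ab)
  hence x: "((\<lambda>s. f (s, y)) has_field_derivative a) (at x)"
    by (simp add: o_def has_field_derivative_def)
  have "((f \<circ> (\<lambda>s. (x, s))) has_derivative ((\<lambda>(h, k). a * h + b * k) \<circ> (\<lambda>h. (0, h)))) (at y)"
    by (rule diff_chain_at) (auto intro!: derivative_eq_intros ab)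
  hence y: "((\<lambda>s. f (x, s)) has_field_derivative b) (at y)"
    by (simp add: o_def has_field_derivative_def)
  have "partial_x f z = a" "partial_y f z = b"
    using x y by (auto simp: partial_x_def partial_y_def z intro: DERIV_imp_deriv)
  with ab x y show "(f has_derivative (\<lambda>(h, k). partial_x f z * h + partial_y f z * k)) (at z)"
    "((\<lambda>s. f (s, snd z)) has_field_derivative partial_x f z) (at (fst z))"
    "((\<lambda>s. f (fst z, s)) has_field_derivative partial_y f z) (at (snd z))"
    by (auto simp: z)
qed

lemma holomorphic2_on_imp_continuous_on: "holomorphic2_on f U \<Longrightarrow> continuous_on U f"
  using holomorphic2_on_partials(1)
  by (meson continuous_at_imp_continuous_on has_derivative_continuous)

lemma holomorphic2_on_subset: "holomorphic2_on f U \<Longrightarrow> V \<subseteq> U \<Longrightarrow> holomorphic2_on f V"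
  by (auto simp: holomorphic2_on_def)

section \<open>Circle integrals depending on parameters\<close>

lemma open_contains_polydisc:
  fixes a b :: complex
  assumes "open U" "(a, b) \<in> U"
  obtains r where "r > 0" "cball a r \<times> cball b r \<subseteq> U"
proof -
  from assms obtain A B where AB: "open A" "open B" "(a, b) \<in> A \<times> B" "A \<times> B \<subseteq> U"
    using open_prod_elim by blast
  obtain r1 where "r1 > 0" "cball a r1 \<subseteq> A" using AB open_contains_cball by (metis SigmaD1)
  moreover obtain r2 where "r2 > 0" "cball b r2 \<subseteq> B" using AB open_contains_cball by (metis SigmaD2)
  ultimately show ?thesis using AB by (intro that[of "min r1 r2"]) (auto intro!: subsetD[OF AB(4)])
qed

text \<open>Over a fixed interval the theorems on continuous and holomorphic dependence on a
  parameter apply.\<close>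

lemma contour_integral_circlepath_eq_integral:
  "contour_integral (circlepath c r) f =
     integral {0..1} (\<lambda>t. f (circlepath c r t) * (2 * pi * \<i> * r * exp (2 * pi * \<i> * complex_of_real t)))"
  by (simp add: contour_integral_integral vector_derivative_circlepath mult_ac)

lemma continuous_on_circle_integral:
  assumes "continuous_on (U \<times> sphere c r) (\<lambda>(z, w). g z w)" "r > 0"
  shows "continuous_on U (\<lambda>z. contour_integral (circlepath c r) (g z))"
proof -
  have "continuous_on U (\<lambda>z. integral (cbox 0 1) (\<lambda>t. g z (circlepath c r t) *
      (2 * pi * \<i> * r * exp (2 * pi * \<i> * complex_of_real t))))"
  proof (rule integral_continuous_on_param)
    have "continuous_on (U \<times> cbox (0::real) 1) (\<lambda>p. (\<lambda>(z, w). g z w) (fst p, circlepath c r (snd p)))"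
      by (rule continuous_on_compose2[OF assms(1)])
        (use assms(2) in \<open>auto simp: circlepath dist_norm norm_mult intro!: continuous_intros\<close>)
    hence "continuous_on (U \<times> cbox (0::real) 1) (\<lambda>p. g (fst p) (circlepath c r (snd p)) *
      (2 * pi * \<i> * r * exp (2 * pi * \<i> * complex_of_real (snd p))))"
      unfolding case_prod_conv by (rule continuous_on_mult) (intro continuous_intros)
    thus "continuous_on (U \<times> cbox 0 1) (\<lambda>(z, t). g z (circlepath c r t) *
      (2 * pi * \<i> * r * exp (2 * pi * \<i> * complex_of_real t)))"
      by (simp only: case_prod_unfold)
  qed
  thus ?thesis by (simp add: contour_integral_circlepath_eq_integral)
qed

text \<open>Cauchy's formula for the derivative in y writes it as a circle integral of f, which is
  continuous in both variables because f is.\<close>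

lemma continuous_on_partial_y:
  assumes "open U" "continuous_on U f"
    and hol: "\<And>x y. (x, y) \<in> U \<Longrightarrow> (\<lambda>s. f (x, s)) field_differentiable (at y)"
  shows "continuous_on U (partial_y f)"
  unfolding continuous_on_eq_continuous_at[OF assms(1)]
proof
  fix z assume "z \<in> U"
  obtain a b where z: "z = (a, b)" by (cases z)
  obtain r where r: "r > 0" "cball a r \<times> cball b r \<subseteq> U"
    using open_contains_polydisc \<open>z \<in> U\<close> assms(1) z by blast
  let ?F = "\<lambda>p :: complex \<times> complex. 1 / (2 * complex_of_real pi * \<i>) * contour_integral (circlepath b r) (\<lambda>w. f (fst p, w) / (w - snd p)^2)"
  have eq: "partial_y f p = ?F p" if "p \<in> ball a r \<times> ball b r" for p
  proof -
    have h: "(\<lambda>s. f (fst p, s)) holomorphic_on cball b r"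
      unfolding holomorphic_on_def
    proof
      fix s assume "s \<in> cball b r"
      hence "(fst p, s) \<in> U" using that by (intro subsetD[OF r(2)]) auto
      thus "(\<lambda>s. f (fst p, s)) field_differentiable (at s within cball b r)"
        by (rule field_differentiable_at_within[OF hol])
    qed
    have "((\<lambda>s. f (fst p, s)) has_field_derivative ?F p) (at (snd p))"
      by (rule Cauchy_derivative_integral_circlepath[OF holomorphic_on_imp_continuous_on[OF h]
            holomorphic_on_subset[OF h ball_subset_cball]]) (use that in auto)
    thus ?thesis by (simp add: partial_y_def case_prod_beta DERIV_imp_deriv)
  qed
  have "continuous_on (ball a r \<times> ball b r) ?F"
  proof (intro continuous_on_mult continuous_on_const continuous_on_circle_integral \<open>r > 0\<close>)
    have "continuous_on ((ball a r \<times> ball b r) \<times> sphere b r) (\<lambda>q. f (fst (fst q), snd q))"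
      by (rule continuous_on_compose2[OF assms(2)], intro continuous_intros, rule subset_trans[OF _ r(2)]) auto
    moreover have "snd q - snd (fst q) \<noteq> 0" if "q \<in> (ball a r \<times> ball b r) \<times> sphere b r" for q
      using that by auto
    ultimately show "continuous_on ((ball a r \<times> ball b r) \<times> sphere b r)
        (\<lambda>(p, w). f (fst p, w) / (w - snd p)\<^sup>2)"
      unfolding case_prod_beta by (intro continuous_intros) auto
  qed
  hence "continuous_on (ball a r \<times> ball b r) (partial_y f)"
    by (subst continuous_on_cong[OF refl eq])
  moreover have "open (ball a r \<times> ball b r)" "z \<in> ball a r \<times> ball b r"
    using r z by (auto intro: open_Times)
  ultimately show "isCont (partial_y f) z" using continuous_on_eq_continuous_at by blast
qed

text \<open>Osgood's lemma. Total differentiability follows from separate differentiability as soon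
  as one partial derivative is continuous, and \<open>continuous_on_partial_y\<close> provides that
  for the second variable.\<close>

lemma holomorphic2_onI:
  assumes U: "open U" and cont: "continuous_on U f"
    and hx: "\<And>x y. (x, y) \<in> U \<Longrightarrow> (\<lambda>s. f (s, y)) field_differentiable (at x)"
    and hy: "\<And>x y. (x, y) \<in> U \<Longrightarrow> (\<lambda>s. f (x, s)) field_differentiable (at y)"
  shows "holomorphic2_on f U"
  unfolding holomorphic2_on_def
proof
  fix z assume "z \<in> U"
  obtain a b where z: "z = (a, b)" by (cases z)
  obtain r where r: "r > 0" "cball a r \<times> cball b r \<subseteq> U"
    using open_contains_polydisc \<open>z \<in> U\<close> U z by blast
  let ?B = "ball a r \<times> ball b r"
  have B: "open ?B" "(a, b) \<in> ?B" "?B \<subseteq> U" using r by (auto intro: open_Times)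
  have contp: "continuous_on ?B (partial_y f)"
    using continuous_on_partial_y[OF U cont hy] B(3) continuous_on_subset by blast
  have "((\<lambda>(x, y). f (x, y)) has_derivative (\<lambda>(tx, ty). partial_x f (a, b) * tx
      + blinfun_apply (blinfun_mult_right (partial_y f (a, b))) ty)) (at (a, b) within ball a r \<times> ball b r)"
  proof (rule has_derivative_partialsI[where fy = "\<lambda>x y. blinfun_mult_right (partial_y f (x, y))"])
    have "((\<lambda>s. f (s, b)) has_field_derivative partial_x f (a, b)) (at a)"
      using hx[of a b] \<open>z \<in> U\<close> z by (simp add: partial_x_def field_differentiable_derivI)
    thus "((\<lambda>x. f (x, b)) has_derivative (*) (partial_x f (a, b))) (at a within ball a r)"
      using has_field_derivative_def has_derivative_at_withinI by blast
    fix x y assume "x \<in> ball a r" "y \<in> ball b r"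
    hence "(x, y) \<in> U" using B by auto
    hence "((\<lambda>s. f (x, s)) has_field_derivative partial_y f (x, y)) (at y)"
      using hy by (simp add: partial_y_def field_differentiable_derivI)
    thus "((\<lambda>s. f (x, s)) has_derivative blinfun_apply (blinfun_mult_right (partial_y f (x, y)))) (at y within ball b r)"
      unfolding blinfun_mult_right.rep_eq
      by (auto simp: has_field_derivative_def has_derivative_at_withinI)
  next
    have "continuous_on ?B (\<lambda>p. blinfun_mult_right (partial_y f p))"
      by (intro bounded_linear.continuous_on[OF bounded_linear_blinfun_mult_right] contp)
    thus "continuous (at (a, b) within ball a r \<times> ball b r) (\<lambda>(x, y). blinfun_mult_right (partial_y f (x, y)))"
      unfolding continuous_on_eq_continuous_within case_prod_beta prod.collapse using B(2) by blast
  qed (use r in auto)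
  hence "(f has_derivative (\<lambda>(h, k). partial_x f z * h + partial_y f z * k)) (at z)"
    using B(1,2) by (simp add: z at_within_open[of _ ?B])
  thus "\<exists>a b. (f has_derivative (\<lambda>(h, k). a * h + b * k)) (at z)" by blast
qed

text \<open>The swap carries results on \<open>partial_y\<close> over to \<open>partial_x\<close>,
  and later results on the first chart over to the second.\<close>

lemma holomorphic2_on_swap:
  assumes "holomorphic2_on f U"
  shows "holomorphic2_on (f \<circ> prod.swap) (prod.swap ` U)"
  unfolding holomorphic2_on_def
proof
  fix z assume "z \<in> prod.swap ` U"
  hence "prod.swap z \<in> U" by auto
  then obtain a b where ab: "(f has_derivative (\<lambda>(h, k). a * h + b * k)) (at (prod.swap z))"
    using assms unfolding holomorphic2_on_def by blast
  have sw: "(prod.swap has_derivative prod.swap) (at z)" for z :: "complex \<times> complex"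
  proof -
    have "((\<lambda>z. (snd z, fst z)) has_derivative (\<lambda>z. (snd z, fst z))) (at z)"
      by (auto intro!: derivative_eq_intros)
    thus ?thesis by (simp add: prod.swap_def[abs_def])
  qed
  have "((f \<circ> prod.swap) has_derivative ((\<lambda>(h, k). a * h + b * k) \<circ> prod.swap)) (at z)"
    by (rule diff_chain_at[OF sw ab])
  moreover have "(\<lambda>(h, k). a * h + b * k) \<circ> prod.swap = (\<lambda>(h, k). b * h + a * k)"
    by (auto simp: fun_eq_iff add.commute)
  ultimately show "\<exists>a b. ((f \<circ> prod.swap) has_derivative (\<lambda>(h, k). a * h + b * k)) (at z)" by metis
qed

lemma partial_swap:
  "partial_x (f \<circ> prod.swap) = partial_y f \<circ> prod.swap"
  "partial_y (f \<circ> prod.swap) = partial_x f \<circ> prod.swap"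
  by (auto simp: partial_x_def partial_y_def)

lemma swap_image_eq_vimage: "prod.swap ` U = prod.swap -` U"
  by (auto simp: image_iff) (metis swap_simp)

lemma open_swap: "open U \<Longrightarrow> open (prod.swap ` U)" for U :: "(complex \<times> complex) set"
  unfolding swap_image_eq_vimage by (intro continuous_open_vimage continuous_intros)
    (auto intro: isCont_swap simp: prod.swap_def intro!: continuous_intros)

lemma continuous_on_partials:
  assumes "open U" "holomorphic2_on f U"
  shows "continuous_on U (partial_x f)" "continuous_on U (partial_y f)"
proof -
  have 1: "continuous_on U (partial_y f)" if "open U" "holomorphic2_on f U" for f U
    by (rule continuous_on_partial_y[OF that(1) holomorphic2_on_imp_continuous_on[OF that(2)]])
      (use holomorphic2_on_partials(3)[OF that(2)] in \<open>force simp: field_differentiable_def\<close>)+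
  show "continuous_on U (partial_y f)" by (rule 1[OF assms])
  show "continuous_on U (partial_x f)"
  proof -
    have "continuous_on (prod.swap ` U) (partial_y (f \<circ> prod.swap))"
      by (intro 1 open_swap assms holomorphic2_on_swap)
    hence "continuous_on U (\<lambda>z. partial_y (f \<circ> prod.swap) (prod.swap z))"
      by (rule continuous_on_compose2) (auto simp: prod.swap_def intro!: continuous_intros)
    thus ?thesis by (simp add: partial_swap)
  qed
qed

lemma holomorphic2_on_circle_integral:
  fixes c :: complex and r :: real
  assumes A: "open A" and r: "r > 0" and W: "open W" "A \<times> sphere c r \<subseteq> W"
    and G: "holomorphic2_on G W"
  shows "holomorphic2_on (\<lambda>(x, y). contour_integral (circlepath c r) (\<lambda>w. G (x, w) / (w - y) ^ k))
           (A \<times> ball c r)" (is "holomorphic2_on ?F _")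
proof (rule holomorphic2_onI)
  show "open (A \<times> ball c r)" using A by (simp add: open_Times)
  have contG: "continuous_on W G" by (rule holomorphic2_on_imp_continuous_on[OF G])
  have cont: "continuous_on ((A \<times> ball c r) \<times> sphere c r) (\<lambda>q. H (fst (fst q), snd q) / (snd q - snd (fst q)) ^ k)"
    if "continuous_on W H" for H :: cfun2 and k
  proof -
    have "continuous_on ((A \<times> ball c r) \<times> sphere c r) (\<lambda>q. H (fst (fst q), snd q))"
      by (rule continuous_on_compose2[OF that], intro continuous_intros, rule subset_trans[OF _ W(2)]) auto
    moreover have "snd q - snd (fst q) \<noteq> 0" if "q \<in> (A \<times> ball c r) \<times> sphere c r" for q
      using that by auto
    ultimately show ?thesis by (intro continuous_intros) auto
  qed
  show "continuous_on (A \<times> ball c r) ?F"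
    unfolding case_prod_beta
    by (rule continuous_on_circle_integral[OF _ r]) (use cont[OF contG] in \<open>simp add: case_prod_beta\<close>)
  fix x y assume xy: "(x, y) \<in> A \<times> ball c r"
  have ci: "continuous_on (sphere c r) (\<lambda>w. G (x, w))"
    by (rule continuous_on_compose2[OF contG], intro continuous_intros, rule subset_trans[OF _ W(2)])
      (use xy in auto)
  show "(\<lambda>s. ?F (x, s)) field_differentiable at y"
  proof (cases "k = 0")
    case True thus ?thesis by (simp add: field_differentiable_const)
  next
    case False
    have "((\<lambda>s. contour_integral (circlepath c r) (\<lambda>w. G (x, w) / (w - s) ^ k)) has_field_derivative
       (k * contour_integral (circlepath c r) (\<lambda>w. G (x, w) / (w - y) ^ Suc k))) (at y)"
    proof (rule Cauchy_next_derivative_circlepath(2))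
      show "continuous_on (path_image (circlepath c r)) (\<lambda>w. G (x, w))" using ci r by simp
      fix s assume "s \<in> ball c r"
      hence "continuous_on (path_image (circlepath c r)) (\<lambda>w. G (x, w) / (w - s) ^ k)"
        using ci r by (auto intro!: continuous_intros)
      thus "((\<lambda>u. G (x, u) / (u - s) ^ k) has_contour_integral
        contour_integral (circlepath c r) (\<lambda>w. G (x, w) / (w - s) ^ k)) (circlepath c r)"
        by (intro has_contour_integral_integral contour_integrable_continuous_circlepath)
    qed (use False xy in auto)
    thus ?thesis by (auto simp: field_differentiable_def)
  qed
  obtain e where e: "e > 0" "ball x e \<subseteq> A" using A xy open_contains_ball by (metis SigmaD1)
  let ?g = "circlepath c r"
  have sph: "?g t \<in> sphere c r" if "t \<in> {0..1}" for t
    using path_image_circlepath[of c r] that r unfolding path_image_def by auto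
  have contg: "continuous_on (ball x e \<times> {0..1}) (\<lambda>p::complex \<times> real. H (fst p, ?g (snd p)) / (?g (snd p) - y) ^ k * (2 * pi * \<i> * r * exp (2 * pi * \<i> * complex_of_real (snd p))))"
    if "continuous_on W H" for H :: cfun2
  proof -
    have "continuous_on (ball x e \<times> {0..1}) (\<lambda>p::complex \<times> real. (\<lambda>q. H (fst (fst q), snd q) / (snd q - snd (fst q)) ^ k) ((fst p, y), ?g (snd p)))"
      by (rule continuous_on_compose2[OF cont[OF that]])
        (use e xy sph in \<open>auto simp: circlepath intro!: continuous_intros\<close>)
    thus ?thesis unfolding fst_conv snd_conv by (rule continuous_on_mult) (intro continuous_intros)
  qed
  have "(\<lambda>s. integral (cbox 0 1) (\<lambda>t. G (s, ?g t) / (?g t - y) ^ k * (2 * pi * \<i> * r * exp (2 * pi * \<i> * complex_of_real t))))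
      holomorphic_on ball x e"
  proof (rule leibniz_rule_holomorphic)
    fix s t assume st: "s \<in> ball x e" "t \<in> cbox (0::real) 1"
    hence "(s, ?g t) \<in> W" using e sph[of t] by (intro subsetD[OF W(2)]) auto
    from holomorphic2_on_partials(2)[OF G this]
    have "((\<lambda>s. G (s, ?g t)) has_field_derivative partial_x G (s, ?g t)) (at s within ball x e)"
      using has_field_derivative_at_within by auto
    thus "((\<lambda>s. G (s, ?g t) / (?g t - y) ^ k * (2 * pi * \<i> * r * exp (2 * pi * \<i> * complex_of_real t))) has_field_derivative
        partial_x G (s, ?g t) / (?g t - y) ^ k * (2 * pi * \<i> * r * exp (2 * pi * \<i> * complex_of_real t))) (at s within ball x e)"
      by (intro DERIV_cmult_right DERIV_cdivide)
  next
    fix s assume "s \<in> ball x e"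
    hence "continuous_on {0..1} (\<lambda>t::real. (\<lambda>p. G (fst p, ?g (snd p)) / (?g (snd p) - y) ^ k * (2 * pi * \<i> * r * exp (2 * pi * \<i> * complex_of_real (snd p)))) (s, t))"
      by (intro continuous_on_compose2[OF contg[OF contG]] continuous_intros) auto
    thus "(\<lambda>t. G (s, ?g t) / (?g t - y) ^ k * (2 * pi * \<i> * r * exp (2 * pi * \<i> * complex_of_real t))) integrable_on cbox 0 1"
      by (auto intro!: integrable_continuous_real)
  next
    show "continuous_on (ball x e \<times> cbox 0 1) (\<lambda>(s, t). partial_x G (s, ?g t) / (?g t - y) ^ k * (2 * pi * \<i> * r * exp (2 * pi * \<i> * complex_of_real t)))"
      using contg[OF continuous_on_partials(1)[OF W(1) G]] by (simp add: case_prod_unfold)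
  qed simp
  hence "(\<lambda>s. ?F (s, y)) holomorphic_on ball x e"
    by (simp add: contour_integral_circlepath_eq_integral)
  thus "(\<lambda>s. ?F (s, y)) field_differentiable at x"
    using e by (auto intro: holomorphic_on_imp_differentiable_at)
qed

section \<open>The ring of germs in two variables\<close>

lemma hol_germs_polydisc:
  assumes "f \<in> hol_germs (a, b)"
  obtains r where "r > 0" "holomorphic2_on f (ball a r \<times> ball b r)"
proof -
  from assms obtain U where U: "open U" "(a, b) \<in> U" "holomorphic2_on f U"
    unfolding hol_germs_def by blast
  obtain r where r: "r > 0" "cball a r \<times> cball b r \<subseteq> U" by (rule open_contains_polydisc[OF U(1,2)])
  have "ball a r \<times> ball b r \<subseteq> U" by (rule subset_trans[OF _ r(2)]) auto
  with U(3) r(1) show ?thesis using that holomorphic2_on_subset by blast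
qed

lemma hol_germsI_polydisc:
  assumes "r > 0" "holomorphic2_on f (ball a r \<times> ball b r)" shows "f \<in> hol_germs (a, b)"
  unfolding hol_germs_def using assms
  by (intro CollectI exI[of _ "ball a r \<times> ball b r"]) (simp add: open_Times)

lemma hol_germs_eventually:
  assumes "f \<in> hol_germs p"
  shows "\<forall>\<^sub>F z in nhds p. (f has_derivative (\<lambda>(h, k). partial_x f z * h + partial_y f z * k)) (at z)"
    "\<forall>\<^sub>F z in nhds p. isCont f z"
proof -
  from assms obtain U where U: "open U" "p \<in> U" "holomorphic2_on f U"
    unfolding hol_germs_def by blast
  show "\<forall>\<^sub>F z in nhds p. (f has_derivative (\<lambda>(h, k). partial_x f z * h + partial_y f z * k)) (at z)"
    using U holomorphic2_on_partials(1)[OF U(3)] by (auto simp: eventually_nhds)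
  thus "\<forall>\<^sub>F z in nhds p. isCont f z" by eventually_elim (rule has_derivative_continuous)
qed

lemma hol_germs_cong:
  assumes "f \<in> hol_germs p" "\<forall>\<^sub>F z in nhds p. g z = f z" shows "g \<in> hol_germs p"
proof -
  from assms obtain U where U: "open U" "p \<in> U" "holomorphic2_on f U"
    unfolding hol_germs_def by blast
  from assms(2) obtain V where V: "open V" "p \<in> V" "\<And>z. z \<in> V \<Longrightarrow> g z = f z"
    unfolding eventually_nhds by blast
  have "holomorphic2_on g (U \<inter> V)" unfolding holomorphic2_on_def
  proof
    fix z assume z: "z \<in> U \<inter> V"
    then obtain a b where "(f has_derivative (\<lambda>(h, k). a * h + b * k)) (at z)"
      using U unfolding holomorphic2_on_def by blast
    hence "(g has_derivative (\<lambda>(h, k). a * h + b * k)) (at z)"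
      by (rule has_derivative_transform_within_open[OF _ V(1)]) (use z V in auto)
    thus "\<exists>a b. (g has_derivative (\<lambda>(h, k). a * h + b * k)) (at z)" by blast
  qed
  thus ?thesis using U V unfolding hol_germs_def by (intro CollectI exI[of _ "U \<inter> V"]) auto
qed

lemma hol_germs_compose:
  assumes f: "f \<in> hol_germs (F1 p, F2 p)" and F: "F1 \<in> hol_germs p" "F2 \<in> hol_germs p"
  shows "(\<lambda>z. f (F1 z, F2 z)) \<in> hol_germs p"
proof -
  from f obtain U where U: "open U" "(F1 p, F2 p) \<in> U" "holomorphic2_on f U"
    unfolding hol_germs_def by blast
  from F obtain V1 V2 where V: "open V1" "p \<in> V1" "holomorphic2_on F1 V1"
    "open V2" "p \<in> V2" "holomorphic2_on F2 V2" unfolding hol_germs_def by blast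
  let ?F = "\<lambda>z. (F1 z, F2 z)"
  define W where "W = (V1 \<inter> V2) \<inter> ?F -` U"
  have "continuous_on (V1 \<inter> V2) ?F"
    using V by (intro continuous_on_Pair) (auto intro: continuous_on_subset holomorphic2_on_imp_continuous_on)
  hence "open W" unfolding W_def using V U by (intro continuous_open_preimage) auto
  moreover have "p \<in> W" using U V by (auto simp: W_def)
  moreover have "holomorphic2_on (\<lambda>z. f (?F z)) W" unfolding holomorphic2_on_def
  proof
    fix z assume "z \<in> W"
    hence "?F z \<in> U" "z \<in> V1" "z \<in> V2" by (auto simp: W_def)
    with U(3) V(3,6) obtain a b a1 b1 a2 b2 where
      d: "(f has_derivative (\<lambda>(h, k). a * h + b * k)) (at (?F z))"
      "(F1 has_derivative (\<lambda>(h, k). a1 * h + b1 * k)) (at z)"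
      "(F2 has_derivative (\<lambda>(h, k). a2 * h + b2 * k)) (at z)"
      unfolding holomorphic2_on_def by metis
    have "((f \<circ> ?F) has_derivative ((\<lambda>(h, k). a * h + b * k) \<circ>
        (\<lambda>w. ((\<lambda>(h, k). a1 * h + b1 * k) w, (\<lambda>(h, k). a2 * h + b2 * k) w)))) (at z)"
      by (rule diff_chain_at[OF has_derivative_Pair[OF d(2,3)] d(1)])
    moreover have "((\<lambda>(h, k). a * h + b * k) \<circ>
        (\<lambda>w. ((\<lambda>(h, k). a1 * h + b1 * k) w, (\<lambda>(h, k). a2 * h + b2 * k) w))) =
        (\<lambda>(h, k). (a * a1 + b * a2) * h + (a * b1 + b * b2) * k)"
      by (auto simp: fun_eq_iff algebra_simps)
    ultimately have "((\<lambda>z. f (?F z)) has_derivative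
        (\<lambda>(h, k). (a * a1 + b * a2) * h + (a * b1 + b * b2) * k)) (at z)" by (simp add: o_def)
    thus "\<exists>a b. ((\<lambda>z. f (?F z)) has_derivative (\<lambda>(h, k). a * h + b * k)) (at z)" by blast
  qed
  ultimately show ?thesis unfolding hol_germs_def by blast
qed

text \<open>Sums and products of germs are compositions with these two functions, so
  \<open>hol_germs_compose\<close> covers both.\<close>

lemma hol_germs_add_basic: "(\<lambda>z. fst z + snd z) \<in> hol_germs p"
  and hol_germs_mult_basic: "(\<lambda>z. fst z * snd z) \<in> hol_germs p"
proof -
  have "holomorphic2_on (\<lambda>z. fst z + snd z) UNIV" "holomorphic2_on (\<lambda>z. fst z * snd z) UNIV"
    by (rule holomorphic2_onI; (intro continuous_intros open_UNIV)?; simp add: field_differentiable_add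
       field_differentiable_mult field_differentiable_const field_differentiable_ident)+
  thus "(\<lambda>z. fst z + snd z) \<in> hol_germs p" "(\<lambda>z. fst z * snd z) \<in> hol_germs p"
    by (auto simp: hol_germs_def)
qed

lemma hol_germs_add: "f \<in> hol_germs p \<Longrightarrow> g \<in> hol_germs p \<Longrightarrow> (\<lambda>z. f z + g z) \<in> hol_germs p"
  using hol_germs_compose[OF hol_germs_add_basic, of f p g] by simp

lemma hol_germs_mult: "f \<in> hol_germs p \<Longrightarrow> g \<in> hol_germs p \<Longrightarrow> (\<lambda>z. f z * g z) \<in> hol_germs p"
  using hol_germs_compose[OF hol_germs_mult_basic, of f p g] by simp

lemma hol_germs_analytic_fst:
  assumes "c analytic_on {fst p}" shows "(\<lambda>z. c (fst z)) \<in> hol_germs p"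
proof -
  from assms obtain e where e: "e > 0" "c holomorphic_on ball (fst p) e"
    by (auto simp: analytic_on_def)
  have d: "c field_differentiable at x" if "x \<in> ball (fst p) e" for x
    using e that holomorphic_on_imp_differentiable_at by blast
  have "holomorphic2_on (\<lambda>z. c (fst z)) (ball (fst p) e \<times> UNIV)"
  proof (rule holomorphic2_onI)
    show "continuous_on (ball (fst p) e \<times> UNIV) (\<lambda>z. c (fst z))"
      by (rule continuous_on_compose2[OF holomorphic_on_imp_continuous_on[OF e(2)]])
        (auto intro!: continuous_intros)
  qed (use d in \<open>auto simp: open_Times field_differentiable_const\<close>)
  thus ?thesis using e unfolding hol_germs_def
    by (intro CollectI exI[of _ "ball (fst p) e \<times> UNIV"]) (cases p, auto simp: open_Times)
qed

lemma hol_germs_swap: "f \<in> hol_germs p \<Longrightarrow> f \<circ> prod.swap \<in> hol_germs (prod.swap p)"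
  unfolding hol_germs_def using holomorphic2_on_swap open_swap by blast

lemma hol_germs_analytic_snd:
  assumes "c analytic_on {snd p}" shows "(\<lambda>z. c (snd z)) \<in> hol_germs p"
  using hol_germs_swap[OF hol_germs_analytic_fst[of c "prod.swap p"]] assms by (simp add: o_def)

lemma hol_germs_const: "(\<lambda>_. c) \<in> hol_germs p"
  using hol_germs_analytic_fst[of "\<lambda>_. c"] by simp

lemma hol_germs_fst: "fst \<in> hol_germs p" and hol_germs_snd: "snd \<in> hol_germs p"
  using hol_germs_analytic_fst[of "\<lambda>x. x" p] hol_germs_analytic_snd[of "\<lambda>x. x" p] by simp_all

lemma hol_germs_uminus: "f \<in> hol_germs p \<Longrightarrow> (\<lambda>z. - f z) \<in> hol_germs p"
  using hol_germs_mult[OF hol_germs_const[of "-1"]] by fastforce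

lemma hol_germs_diff: "f \<in> hol_germs p \<Longrightarrow> g \<in> hol_germs p \<Longrightarrow> (\<lambda>z. f z - g z) \<in> hol_germs p"
  using hol_germs_add[of f p "\<lambda>z. - g z"] hol_germs_uminus[of g p] by simp

lemma hol_germs_power: "f \<in> hol_germs p \<Longrightarrow> (\<lambda>z. f z ^ n) \<in> hol_germs p"
  by (induction n) (auto intro: hol_germs_const hol_germs_mult)

lemma hol_germs_sum: "(\<And>i. i \<in> I \<Longrightarrow> f i \<in> hol_germs p) \<Longrightarrow> (\<lambda>z. \<Sum>i\<in>I. f i z) \<in> hol_germs p"
  by (induction I rule: infinite_finite_induct) (auto intro: hol_germs_const hol_germs_add)

lemma hol_germs_inverse:
  assumes "f \<in> hol_germs p" "f p \<noteq> 0" shows "(\<lambda>z. inverse (f z)) \<in> hol_germs p"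
proof -
  have "inverse analytic_on {f p}" using assms(2) by (intro analytic_intros) auto
  hence "(\<lambda>z. inverse (fst z)) \<in> hol_germs (f p, f p)" by (intro hol_germs_analytic_fst) simp
  from hol_germs_compose[OF this assms(1,1)] show ?thesis by simp
qed

lemmas hol_germs_intros = hol_germs_add hol_germs_mult hol_germs_const hol_germs_fst hol_germs_snd
  hol_germs_uminus hol_germs_diff hol_germs_power hol_germs_sum

text \<open>Near p the derivative is a circle integral with kernel 1/(w - y)^2, hence holomorphic in
  both variables.\<close>

lemma hol_germs_partial_y:
  assumes "f \<in> hol_germs p" shows "partial_y f \<in> hol_germs p"
proof -
  obtain a b where p: "p = (a, b)" by (cases p)
  obtain r where r: "r > 0" "holomorphic2_on f (ball a r \<times> ball b r)"
    using assms hol_germs_polydisc unfolding p by blast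
  let ?s = "r / 2"
  let ?F = "\<lambda>(x, y). contour_integral (circlepath b ?s) (\<lambda>w. f (x, w) / (w - y) ^ 2)"
  have F: "holomorphic2_on ?F (ball a r \<times> ball b ?s)"
    by (rule holomorphic2_on_circle_integral[OF _ _ _ _ r(2)]) (use r in \<open>auto simp: open_Times\<close>)
  have eq: "partial_y f (x, y) = 1 / (2 * of_real pi * \<i>) * ?F (x, y)" if "x \<in> ball a r" "y \<in> ball b ?s" for x y
  proof -
    have h: "(\<lambda>s. f (x, s)) holomorphic_on ball b r"
      unfolding holomorphic_on_def
    proof
      fix s assume "s \<in> ball b r"
      hence "(x, s) \<in> ball a r \<times> ball b r" using that by auto
      from holomorphic2_on_partials(3)[OF r(2) this]
      show "(\<lambda>s. f (x, s)) field_differentiable at s within ball b r"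
        by (auto simp: field_differentiable_def intro: has_field_derivative_at_within)
    qed
    have "(\<lambda>s. f (x, s)) holomorphic_on cball b ?s"
      by (rule holomorphic_on_subset[OF h]) (use r in auto)
    from Cauchy_derivative_integral_circlepath(2)[OF holomorphic_on_imp_continuous_on[OF this]
      holomorphic_on_subset[OF this ball_subset_cball] that(2)]
    show ?thesis by (simp add: partial_y_def DERIV_imp_deriv)
  qed
  have "?F \<in> hol_germs p"
    unfolding p by (rule hol_germsI_polydisc[of ?s]) (use r in \<open>auto intro!: holomorphic2_on_subset[OF F]\<close>)
  hence "(\<lambda>z. 1 / (2 * of_real pi * \<i>) * ?F z) \<in> hol_germs p" by (intro hol_germs_intros)
  moreover have "\<forall>\<^sub>F z in nhds p. partial_y f z = 1 / (2 * of_real pi * \<i>) * ?F z"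
    unfolding eventually_nhds p
    by (rule exI[of _ "ball a r \<times> ball b ?s"]) (use r eq in \<open>auto simp: open_Times\<close>)
  ultimately show ?thesis by (rule hol_germs_cong)
qed

lemma hol_germs_partial_x:
  assumes "f \<in> hol_germs p" shows "partial_x f \<in> hol_germs p"
proof -
  have "partial_y (f \<circ> prod.swap) \<circ> prod.swap \<in> hol_germs (prod.swap (prod.swap p))"
    by (intro hol_germs_swap hol_germs_partial_y assms)
  thus ?thesis by (simp only: partial_swap comp_assoc swap_comp_swap comp_id swap_swap)
qed

text \<open>With u = w - b and d = y - b this splits the Cauchy kernel 1/(w - y) into Taylor terms
  and a remainder that carries the factor (y - b)^N.\<close>

lemma truncated_geometric_kernel:
  fixes u d :: complex
  assumes "u \<noteq> 0" "u \<noteq> d"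
  shows "1 / (u - d) = (\<Sum>j<N. d ^ j / u ^ Suc j) + d ^ N / (u ^ N * (u - d))"
proof (induction N)
  case (Suc N)
  have "d ^ N / (u ^ N * (u - d)) = d ^ N / u ^ Suc N + d ^ Suc N / (u ^ Suc N * (u - d))"
    using assms by (simp add: field_simps)
  thus ?case using Suc by simp
qed simp

text \<open>The split Cauchy kernel is integrated against f(x, w). The cofactor of (y - b)^N is
  again a Cauchy integral, now of f/(w - b)^N, and this makes it a germ in both variables.\<close>

lemma hol_germs_taylor_y:
  assumes "f \<in> hol_germs (a, b)"
  obtains c g where "\<And>j. c j analytic_on {a}" "g \<in> hol_germs (a, b)"
    "\<forall>\<^sub>F z in nhds (a, b). f z = (\<Sum>j<N. c j (fst z) * (snd z - b) ^ j) + (snd z - b) ^ N * g z"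
    "\<And>j. \<forall>\<^sub>F x in nhds a. c j x = (deriv ^^ j) (\<lambda>s. f (x, s)) b / fact j"
proof -
  obtain r where r: "r > 0" "holomorphic2_on f (ball a r \<times> ball b r)"
    using assms hol_germs_polydisc by blast
  define s where "s = r / 2"
  have s: "s > 0" "s < r" using r by (auto simp: s_def)
  let ?k = "1 / (2 * complex_of_real pi * \<i>)"
  let ?C = "\<lambda>f. ?k * contour_integral (circlepath b s) f"
  define c where "c j x = ?C (\<lambda>w. f (x, w) / (w - b) ^ Suc j)" for j x
  \<comment> \<open>The pole along y = b lies inside the circle of integration; only values near the
    circle enter g.\<close>
  define G where "G z = f z / (snd z - b) ^ N" for z
  define g where "g = (\<lambda>(x, y). ?C (\<lambda>w. G (x, w) / (w - y) ^ 1))"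
  have hs: "(\<lambda>w. f (x, w)) holomorphic_on ball b r" if "x \<in> ball a r" for x
    unfolding holomorphic_on_def
  proof
    fix t assume "t \<in> ball b r"
    hence "(x, t) \<in> ball a r \<times> ball b r" using that by auto
    from holomorphic2_on_partials(3)[OF r(2) this]
    show "(\<lambda>s. f (x, s)) field_differentiable at t within ball b r"
      by (auto simp: field_differentiable_def intro: has_field_derivative_at_within)
  qed
  have hc: "(\<lambda>w. f (x, w)) holomorphic_on cball b s" if "x \<in> ball a r" for x
    by (rule holomorphic_on_subset[OF hs[OF that]]) (use s in auto)
  have sph: "continuous_on (sphere b s) (\<lambda>w. f (x, w))" if "x \<in> ball a r" for x
    using holomorphic_on_imp_continuous_on[OF hc[OF that]] by (rule continuous_on_subset) auto
  have an: "c j analytic_on {a}" for j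
  proof -
    have H: "holomorphic2_on (\<lambda>(x, y). contour_integral (circlepath b s) (\<lambda>w. f (x, w) / (w - y) ^ Suc j)) (ball a r \<times> ball b s)"
      by (rule holomorphic2_on_circle_integral[OF _ _ _ _ r(2)]) (use s in \<open>auto simp: open_Times\<close>)
    have "(\<lambda>x. contour_integral (circlepath b s) (\<lambda>w. f (x, w) / (w - b) ^ Suc j)) holomorphic_on ball a r"
      unfolding holomorphic_on_def
    proof
      fix x assume "x \<in> ball a r"
      hence "(x, b) \<in> ball a r \<times> ball b s" using s by auto
      from holomorphic2_on_partials(2)[OF H this]
      show "(\<lambda>x. contour_integral (circlepath b s) (\<lambda>w. f (x, w) / (w - b) ^ Suc j)) field_differentiable at x within ball a r"
        by (auto simp: field_differentiable_def intro: has_field_derivative_at_within)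
    qed
    hence "c j holomorphic_on ball a r" unfolding c_def by (intro holomorphic_intros)
    thus ?thesis using r(1) by (auto simp: analytic_on_def)
  qed
  have gg: "g \<in> hol_germs (a, b)"
  proof -
    have "holomorphic2_on G (ball a r \<times> (ball b r - {b}))"
    proof (rule holomorphic2_onI)
      show "continuous_on (ball a r \<times> (ball b r - {b})) G" unfolding G_def
        by (intro continuous_intros continuous_on_subset[OF holomorphic2_on_imp_continuous_on[OF r(2)]]) auto
      fix x y assume "(x, y) \<in> ball a r \<times> (ball b r - {b})"
      hence xy: "(x, y) \<in> ball a r \<times> ball b r" "y \<noteq> b" by auto
      note d = holomorphic2_on_partials(2,3)[OF r(2) xy(1)]
      have "(\<lambda>s. f (s, y)) field_differentiable at x" using d(1) by (auto simp: field_differentiable_def)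
      thus "(\<lambda>s. G (s, y)) field_differentiable at x"
        unfolding G_def snd_conv using xy(2) by (intro field_differentiable_divide field_differentiable_const) auto
      have "(\<lambda>s. f (x, s)) field_differentiable at y" using d(2) by (auto simp: field_differentiable_def)
      thus "(\<lambda>s. G (x, s)) field_differentiable at y"
        unfolding G_def snd_conv using xy(2)
        by (intro field_differentiable_divide field_differentiable_power field_differentiable_diff
            field_differentiable_const field_differentiable_ident) auto
    qed (auto simp: open_Times open_Diff)
    hence "holomorphic2_on (\<lambda>(x, y). contour_integral (circlepath b s) (\<lambda>w. G (x, w) / (w - y) ^ 1)) (ball a r \<times> ball b s)"
      by (intro holomorphic2_on_circle_integral[where W = "ball a r \<times> (ball b r - {b})"])
        (use s in \<open>auto simp: open_Times open_Diff\<close>)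
    hence "(\<lambda>(x, y). contour_integral (circlepath b s) (\<lambda>w. G (x, w) / (w - y) ^ 1)) \<in> hol_germs (a, b)"
      by (intro hol_germsI_polydisc[OF s(1)], elim holomorphic2_on_subset) (use s in auto)
    from hol_germs_mult[OF hol_germs_const[of ?k] this] show ?thesis
      by (simp add: g_def case_prod_unfold)
  qed
  have eq: "f (x, y) = (\<Sum>j<N. c j x * (y - b) ^ j) + (y - b) ^ N * g (x, y)"
    if x: "x \<in> ball a r" and y: "y \<in> ball b s" for x y
  proof -
    let ?P = "circlepath b s"
    have pi: "path_image ?P = sphere b s" using s by simp
    have i1: "((\<lambda>w. f (x, w) / (w - b) ^ Suc j) has_contour_integral (c j x / ?k)) ?P" for j
    proof -
      have "continuous_on (path_image ?P) (\<lambda>w. f (x, w) / (w - b) ^ Suc j)"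
        unfolding pi using s by (intro continuous_intros sph x) auto
      from has_contour_integral_integral[OF contour_integrable_continuous_circlepath[OF this]]
      show ?thesis by (simp add: c_def)
    qed
    have i2: "((\<lambda>w. G (x, w) / (w - y) ^ 1) has_contour_integral (g (x, y) / ?k)) ?P"
    proof -
      have "continuous_on (path_image ?P) (\<lambda>w. G (x, w) / (w - y) ^ 1)"
        unfolding pi G_def fst_conv snd_conv using s y by (intro continuous_intros sph x) auto
      from has_contour_integral_integral[OF contour_integrable_continuous_circlepath[OF this]]
      show ?thesis by (simp add: g_def)
    qed
    have I: "((\<lambda>w. (\<Sum>j<N. (y - b) ^ j * (f (x, w) / (w - b) ^ Suc j)) + (y - b) ^ N * (G (x, w) / (w - y) ^ 1))
       has_contour_integral ((\<Sum>j<N. (y - b) ^ j * (c j x / ?k)) + (y - b) ^ N * (g (x, y) / ?k))) ?P"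
      by (intro has_contour_integral_add has_contour_integral_sum has_contour_integral_lmul i1 i2) auto
    have E: "(\<Sum>j<N. (y - b) ^ j * (f (x, w) / (w - b) ^ Suc j)) + (y - b) ^ N * (G (x, w) / (w - y) ^ 1)
        = f (x, w) / (w - y)" if "w \<in> sphere b s" for w
    proof -
      have "w - b \<noteq> 0" "w - b \<noteq> y - b" using that s y by auto
      from truncated_geometric_kernel[OF this, of N]
      have "f (x, w) * (1 / (w - y)) = f (x, w) * ((\<Sum>j<N. (y - b) ^ j / (w - b) ^ Suc j) + (y - b) ^ N / ((w - b) ^ N * (w - y)))"
        by simp
      thus ?thesis by (simp add: G_def sum_distrib_left distrib_left mult_ac)
    qed
    have "((\<lambda>w. f (x, w) / (w - y)) has_contour_integral
        ((\<Sum>j<N. (y - b) ^ j * (c j x / ?k)) + (y - b) ^ N * (g (x, y) / ?k))) ?P"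
      by (rule has_contour_integral_eq[OF I], rule E) (simp only: pi)
    moreover have "((\<lambda>w. f (x, w) / (w - y)) has_contour_integral (2 * of_real pi * \<i> * f (x, y))) ?P"
      by (rule Cauchy_integral_circlepath[OF holomorphic_on_imp_continuous_on[OF hc[OF x]]
            holomorphic_on_subset[OF hc[OF x] ball_subset_cball]]) (use y in \<open>simp add: dist_norm norm_minus_commute\<close>)
    ultimately have "2 * of_real pi * \<i> * f (x, y) = (\<Sum>j<N. (y - b) ^ j * (c j x / ?k)) + (y - b) ^ N * (g (x, y) / ?k)"
      using has_contour_integral_unique by blast
    also have "\<dots> = 2 * of_real pi * \<i> * ((\<Sum>j<N. c j x * (y - b) ^ j) + (y - b) ^ N * g (x, y))"
      by (simp add: distrib_left sum_distrib_left mult_ac)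
    finally show ?thesis by simp
  qed
  have ev: "\<forall>\<^sub>F z in nhds (a, b). f z = (\<Sum>j<N. c j (fst z) * (snd z - b) ^ j) + (snd z - b) ^ N * g z"
    unfolding eventually_nhds
    by (rule exI[of _ "ball a r \<times> ball b s"]) (use r s eq in \<open>auto simp: open_Times\<close>)
  have d: "\<forall>\<^sub>F x in nhds a. c j x = (deriv ^^ j) (\<lambda>s. f (x, s)) b / fact j" for j
    unfolding eventually_nhds
  proof (intro exI conjI ballI)
    fix x assume x: "x \<in> ball a r"
    have "((\<lambda>u. f (x, u) / (u - b) ^ Suc j) has_contour_integral (2 * pi * \<i>) / fact j * (deriv ^^ j) (\<lambda>s. f (x, s)) b) (circlepath b s)"
      by (rule Cauchy_has_contour_integral_higher_derivative_circlepath[OF holomorphic_on_imp_continuous_on[OF hc[OF x]]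
            holomorphic_on_subset[OF hc[OF x] ball_subset_cball]]) (use s in simp)
    from contour_integral_unique[OF this] show "c j x = (deriv ^^ j) (\<lambda>s. f (x, s)) b / fact j"
      by (simp add: c_def)
  qed (use r in auto)
  show ?thesis by (rule that[OF an gg ev d])
qed

text \<open>This is the expansion in two variables of a function of the second variable alone,
  restricted to a line.\<close>

lemma analytic_taylor:
  fixes c :: "complex \<Rightarrow> complex"
  assumes "c analytic_on {b}"
  obtains d where "d analytic_on {b}"
    "\<forall>\<^sub>F y in nhds b. c y = (\<Sum>j<N. (deriv ^^ j) c b / fact j * (y - b) ^ j) + (y - b) ^ N * d y"
proof -
  have "(\<lambda>z. c (snd z)) \<in> hol_germs (b, b)" by (rule hol_germs_analytic_snd) (use assms in simp)
  then obtain e g where e: "\<And>j. e j analytic_on {b}" and g: "g \<in> hol_germs (b, b)"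
    and eq: "\<forall>\<^sub>F z in nhds (b, b). c (snd z) = (\<Sum>j<N. e j (fst z) * (snd z - b) ^ j) + (snd z - b) ^ N * g z"
    and ej: "\<And>j. \<forall>\<^sub>F x in nhds b. e j x = (deriv ^^ j) (\<lambda>s. c (snd (x, s))) b / fact j"
    by (rule hol_germs_taylor_y[where N = N]) blast
  have ej': "e j b = (deriv ^^ j) c b / fact j" for j
    using eventually_nhds_x_imp_x[OF ej[of j]] by simp
  obtain r where r: "r > 0" "holomorphic2_on g (ball b r \<times> ball b r)" using g hol_germs_polydisc by blast
  have "(\<lambda>y. g (b, y)) holomorphic_on ball b r"
    unfolding holomorphic_on_def
  proof
    fix t assume "t \<in> ball b r"
    hence "(b, t) \<in> ball b r \<times> ball b r" using r by auto
    from holomorphic2_on_partials(3)[OF r(2) this]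
    show "(\<lambda>s. g (b, s)) field_differentiable at t within ball b r"
      by (auto simp: field_differentiable_def intro: has_field_derivative_at_within)
  qed
  hence "(\<lambda>y. g (b, y)) analytic_on {b}" using r by (auto simp: analytic_on_def)
  moreover have "filterlim (\<lambda>y. (b, y)) (nhds (b, b)) (nhds b)"
    by (intro tendsto_intros filterlim_ident)
  from eventually_compose_filterlim[OF eq this]
  have "\<forall>\<^sub>F y in nhds b. c y = (\<Sum>j<N. (deriv ^^ j) c b / fact j * (y - b) ^ j) + (y - b) ^ N * g (b, y)"
    by (simp add: ej')
  ultimately show ?thesis by (rule that)
qed

section \<open>Germs in one variable\<close>

definition germ_eq :: "(complex \<Rightarrow> complex) \<Rightarrow> (complex \<Rightarrow> complex) \<Rightarrow> bool" where
  "germ_eq f g \<longleftrightarrow> (\<forall>\<^sub>F t in nhds 0. f t = g t)"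

lemma germ_eq_refl [simp]: "germ_eq f f"
  by (simp add: germ_eq_def)

lemma germ_eq_sym: "germ_eq f g \<Longrightarrow> germ_eq g f"
  by (simp add: germ_eq_def eq_commute)

lemma germ_eq_trans: "germ_eq f g \<Longrightarrow> germ_eq g h \<Longrightarrow> germ_eq f h"
  unfolding germ_eq_def by (erule (1) eventually_elim2) simp

lemma germ_eq_add: "germ_eq f g \<Longrightarrow> germ_eq f' g' \<Longrightarrow> germ_eq (\<lambda>t. f t + f' t) (\<lambda>t. g t + g' t)"
  unfolding germ_eq_def by (erule (1) eventually_elim2) simp

lemma germ_eq_mult: "germ_eq f g \<Longrightarrow> germ_eq f' g' \<Longrightarrow> germ_eq (\<lambda>t. f t * f' t) (\<lambda>t. g t * g' t)"
  unfolding germ_eq_def by (erule (1) eventually_elim2) simp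

lemma germ_eq_analytic: "germ_eq f g \<Longrightarrow> f analytic_on {0} \<longleftrightarrow> g analytic_on {0}"
  unfolding germ_eq_def by (intro analytic_at_cong refl)

lemma germ_eq_at: "germ_eq f g \<Longrightarrow> f 0 = g 0"
  unfolding germ_eq_def by (drule eventually_nhds_x_imp_x) simp

lemma germ_eq_punctured:
  assumes "f analytic_on {0}" "g analytic_on {0}" "\<forall>\<^sub>F t in at 0. f t = g t"
  shows "germ_eq f g"
proof -
  have "isCont f 0" "isCont g 0" using assms(1,2) analytic_at_imp_isCont by auto
  hence "(f \<longlongrightarrow> f 0) (at 0)" "(g \<longlongrightarrow> g 0) (at 0)" by (auto simp: isCont_def)
  moreover have "(g \<longlongrightarrow> f 0) (at 0)"
    using calculation(1) assms(3) by (rule Lim_transform_eventually)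
  ultimately have "f 0 = g 0" using tendsto_unique[of "at (0::complex)" g] by simp
  moreover have "\<forall>\<^sub>F t in nhds 0. t \<noteq> 0 \<longrightarrow> f t = g t"
    using assms(3) by (simp add: eventually_at_filter)
  ultimately show ?thesis unfolding germ_eq_def by (elim eventually_mono) metis
qed

text \<open>Splitting off a unit, instead of counting derivatives, makes orders of products add at
  once; the zero germ has no order.\<close>

definition has_order :: "(complex \<Rightarrow> complex) \<Rightarrow> nat \<Rightarrow> bool" where
  "has_order f n \<longleftrightarrow> (\<exists>u. u analytic_on {0} \<and> u 0 \<noteq> 0 \<and> germ_eq f (\<lambda>t. t ^ n * u t))"

lemma analytic_nonzero_near:
  assumes "u analytic_on {0::complex}" "u 0 \<noteq> (0::complex)" shows "\<forall>\<^sub>F t in nhds 0. u t \<noteq> 0"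
proof -
  have "isCont u 0" using assms(1) analytic_at_imp_isCont by auto
  hence "(u \<longlongrightarrow> u 0) (nhds 0)" by (simp add: continuous_at tendsto_at_iff_tendsto_nhds)
  thus ?thesis using assms(2) tendsto_imp_eventually_ne by blast
qed

lemma has_order_imp_nonzero:
  assumes "has_order f n" shows "\<forall>\<^sub>F t in at 0. f t \<noteq> 0"
proof -
  from assms obtain u where u: "u analytic_on {0}" "u 0 \<noteq> 0" "\<forall>\<^sub>F t in nhds 0. f t = t ^ n * u t"
    unfolding has_order_def germ_eq_def by blast
  from u(3) analytic_nonzero_near[OF u(1,2)] have "\<forall>\<^sub>F t in nhds 0. t \<noteq> 0 \<longrightarrow> f t \<noteq> 0"
    by eventually_elim auto
  thus ?thesis by (simp add: eventually_at_filter)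
qed

lemma has_order_imp_analytic:
  assumes "has_order f n" shows "f analytic_on {0}"
proof -
  from assms obtain u where u: "u analytic_on {0}" "germ_eq f (\<lambda>t. t ^ n * u t)"
    unfolding has_order_def by blast
  have "(\<lambda>t. t ^ n * u t) analytic_on {0}" by (intro analytic_intros u)
  thus ?thesis using germ_eq_analytic[OF u(2)] by blast
qed

lemma has_order_not_zero: "has_order f n \<Longrightarrow> \<not> germ_eq f (\<lambda>_. 0)"
proof
  assume "has_order f n" "germ_eq f (\<lambda>_. 0)"
  hence "\<forall>\<^sub>F t in at 0. f t \<noteq> 0" "\<forall>\<^sub>F t in at 0. f t = 0"
    using has_order_imp_nonzero by (auto simp: germ_eq_def eventually_nhds_conv_at)
  hence "\<forall>\<^sub>F t in at (0::complex). False" by eventually_elim auto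
  thus False by simp
qed

lemma analytic_has_order:
  assumes f: "f analytic_on {0}" and nz: "\<not> germ_eq f (\<lambda>_. 0)"
  obtains n where "has_order f n"
proof -
  from f obtain e where e: "e > 0" "f holomorphic_on ball 0 e" by (auto simp: analytic_on_def)
  have "\<exists>w\<in>ball 0 e. f w \<noteq> 0"
  proof (rule ccontr)
    assume "\<not> ?thesis"
    hence "germ_eq f (\<lambda>_. 0)" unfolding germ_eq_def eventually_nhds
      using e(1) by (intro exI[of _ "ball 0 e"]) auto
    thus False using nz by contradiction
  qed
  from zorder_exist_zero[OF e(2) open_ball connected_ball _ this, of 0] e(1)
  have "\<exists>r>0. zor_poly f 0 holomorphic_on cball 0 r \<and>
      (\<forall>w\<in>cball 0 r. f w = zor_poly f 0 w * (w - 0) ^ nat (zorder f 0) \<and> zor_poly f 0 w \<noteq> 0)"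
    by fastforce
  then obtain r
    where r: "r > 0" "zor_poly f 0 holomorphic_on cball 0 r"
      "\<forall>w\<in>cball 0 r. f w = zor_poly f 0 w * (w - 0) ^ nat (zorder f 0) \<and> zor_poly f 0 w \<noteq> 0"
    by blast
  have "zor_poly f 0 holomorphic_on ball 0 r" using r(2) holomorphic_on_subset ball_subset_cball by blast
  hence "zor_poly f 0 analytic_on {0}" using r(1) by (auto simp: analytic_on_def)
  moreover have "zor_poly f 0 0 \<noteq> 0" using r by auto
  moreover have "germ_eq f (\<lambda>t. t ^ nat (zorder f 0) * zor_poly f 0 t)"
    unfolding germ_eq_def eventually_nhds using r by (intro exI[of _ "ball 0 r"]) (auto simp: mult.commute)
  ultimately show ?thesis using that unfolding has_order_def by blast
qed

text \<open>A nonzero h has no zeros in a punctured neighbourhood, so f and g agree there, and by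
  continuity also at the centre.\<close>

lemma germ_eq_cancel:
  assumes "f analytic_on {0}" "g analytic_on {0}" "h analytic_on {0}" "\<not> germ_eq h (\<lambda>_. 0)"
    and "germ_eq (\<lambda>t. h t * f t) (\<lambda>t. h t * g t)"
  shows "germ_eq f g"
proof -
  obtain n where "has_order h n" using analytic_has_order[OF assms(3,4)] by blast
  from has_order_imp_nonzero[OF this] have "\<forall>\<^sub>F t in at 0. h t \<noteq> 0" .
  moreover have "\<forall>\<^sub>F t in at 0. h t * f t = h t * g t"
    using assms(5) by (auto simp: germ_eq_def eventually_nhds_conv_at)
  ultimately have "\<forall>\<^sub>F t in at 0. f t = g t" by eventually_elim auto
  with germ_eq_punctured assms show ?thesis by blast
qed

lemma has_order_cong: "germ_eq f g \<Longrightarrow> has_order f n \<longleftrightarrow> has_order g n"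
  unfolding has_order_def using germ_eq_trans germ_eq_sym by blast

lemma has_order_mult:
  assumes "has_order f n" "has_order g k" shows "has_order (\<lambda>t. f t * g t) (n + k)"
proof -
  from assms obtain u v where "u analytic_on {0}" "u 0 \<noteq> 0" "germ_eq f (\<lambda>t. t ^ n * u t)"
    and "v analytic_on {0}" "v 0 \<noteq> 0" "germ_eq g (\<lambda>t. t ^ k * v t)"
    unfolding has_order_def by blast
  thus ?thesis unfolding has_order_def
    by (intro exI[of _ "\<lambda>t. u t * v t"] conjI analytic_intros)
      (auto simp: power_add mult_ac dest: germ_eq_mult)
qed

lemma has_order_power:
  assumes "has_order f n" shows "has_order (\<lambda>t. f t ^ k) (n * k)"
proof (induction k)
  case 0
  show ?case unfolding has_order_def by (intro exI[of _ "\<lambda>_. 1"]) auto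
next
  case (Suc k)
  from has_order_mult[OF assms Suc] show ?case by simp
qed

text \<open>Comparison of the power series of f with the shifted one of u.\<close>

lemma higher_deriv_0_has_order:
  assumes "u analytic_on {0}" "germ_eq f (\<lambda>t. t ^ n * u t)"
  shows "(deriv ^^ i) f 0 = (if i < n then 0 else fact i / fact (i - n) * (deriv ^^ (i - n)) u 0)"
proof -
  have "f analytic_on {0}" using germ_eq_analytic[OF assms(2)] assms(1) by (auto intro!: analytic_intros)
  hence F: "f has_fps_expansion fps_expansion f 0" and U: "u has_fps_expansion fps_expansion u 0"
    using assms(1) analytic_at_imp_has_fps_expansion_0 by auto
  have "(\<lambda>t. t ^ n * u t) has_fps_expansion (fps_X ^ n * fps_expansion u 0)"
    by (intro fps_expansion_intros U)
  moreover have ev: "\<forall>\<^sub>F t in nhds 0. f t = t ^ n * u t" using assms(2) by (simp add: germ_eq_def)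
  ultimately have "f has_fps_expansion (fps_X ^ n * fps_expansion u 0)"
    by (simp only: has_fps_expansion_cong[OF ev refl])
  hence "fps_expansion f 0 = fps_X ^ n * fps_expansion u 0"
    using F fps_expansion_unique_complex by blast
  hence "fps_nth (fps_expansion f 0) i = fps_nth (fps_X ^ n * fps_expansion u 0) i" by simp
  thus ?thesis by (simp add: fps_expansion_def fps_X_power_mult_nth field_simps split: if_splits)
qed

lemma has_order_imp_vanishing_order1:
  assumes "has_order f n" shows "vanishing_order1 f 0 = enat n"
proof -
  from assms obtain u where u: "u analytic_on {0}" "u 0 \<noteq> 0" "germ_eq f (\<lambda>t. t ^ n * u t)"
    unfolding has_order_def by blast
  note d = higher_deriv_0_has_order[OF u(1,3)]
  show ?thesis unfolding vanishing_order1_def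
  proof (rule antisym)
    have "(deriv ^^ n) f 0 \<noteq> 0" using u(2) by (simp add: d)
    thus "Inf {enat n |n. (deriv ^^ n) f 0 \<noteq> 0} \<le> enat n" by (intro Inf_lower) blast
    show "enat n \<le> Inf {enat n |n. (deriv ^^ n) f 0 \<noteq> 0}"
      by (rule Inf_greatest) (auto simp: d split: if_splits)
  qed
qed

text \<open>Here u may vanish at 0. This serves for the coordinate x v of the blown-down branch, of
  which only a lower bound on the order is known.\<close>

lemma vanishing_order1_ge:
  assumes "u analytic_on {0}" "germ_eq f (\<lambda>t. t ^ n * u t)" shows "enat n \<le> vanishing_order1 f 0"
  unfolding vanishing_order1_def
  by (rule Inf_greatest) (auto simp: higher_deriv_0_has_order[OF assms] split: if_splits)

text \<open>Evaluation at 0 kills the constant coefficient; then one factor t cancels on both sides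
  and n drops by one.\<close>

lemma poly_germ_divisible:
  assumes "w analytic_on {0}" "germ_eq (\<lambda>t. \<Sum>i<n. c i * t ^ i) (\<lambda>t. t ^ n * w t)" "i < n"
  shows "c i = 0"
  using assms(2,3)
proof (induction n arbitrary: c i)
  case (Suc n)
  have eq: "(\<Sum>i<Suc n. c i * t ^ i) = c 0 + t * (\<Sum>i<n. c (Suc i) * t ^ i)" for t
    by (simp add: sum.lessThan_Suc_shift sum_distrib_left mult_ac del: sum.lessThan_Suc)
  have c0: "c 0 = 0" using germ_eq_at[OF Suc.prems(1)] by (simp add: eq del: sum.lessThan_Suc)
  have "germ_eq (\<lambda>t. t * (\<Sum>i<n. c (Suc i) * t ^ i)) (\<lambda>t. t * (t ^ n * w t))"
    using Suc.prems(1) c0 by (simp add: eq mult.assoc del: sum.lessThan_Suc)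
  moreover have "\<not> germ_eq (\<lambda>t. t) (\<lambda>_. 0)"
    by (rule has_order_not_zero[of _ 1], unfold has_order_def, rule exI[of _ "\<lambda>_. 1"]) auto
  moreover have "(\<lambda>t. \<Sum>i<n. c (Suc i) * t ^ i) analytic_on {0}" "(\<lambda>t. t ^ n * w t) analytic_on {0}"
    by (intro analytic_intros assms(1))+
  ultimately have "germ_eq (\<lambda>t. \<Sum>i<n. c (Suc i) * t ^ i) (\<lambda>t. t ^ n * w t)"
    using germ_eq_cancel[of _ _ "\<lambda>t. t"] analytic_on_ident by blast
  from Suc.IH[OF this] have "c (Suc j) = 0" if "j < n" for j using that by auto
  thus ?case using c0 Suc.prems(2) by (cases i) auto
qed simp

text \<open>Closure under equality of germs makes a space of functions stand for a space of germs,
  so that its quotients are the intended ones.\<close>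

definition germ_space :: "(complex \<Rightarrow> complex) set \<Rightarrow> bool" where
  "germ_space V \<longleftrightarrow> lin_sub V \<and> (\<forall>f\<in>V. f analytic_on {0}) \<and> (\<forall>f\<in>V. \<forall>g. germ_eq f g \<longrightarrow> g \<in> V)"

definition germs1 :: "(complex \<Rightarrow> complex) set" where
  "germs1 = {f. f analytic_on {0}}"

text \<open>The products are closed up under equality of germs, since the plain image of V under
  multiplication by h need not be.\<close>

definition germ_mul :: "(complex \<Rightarrow> complex) \<Rightarrow> (complex \<Rightarrow> complex) set \<Rightarrow> (complex \<Rightarrow> complex) set" where
  "germ_mul h V = {g. \<exists>v\<in>V. germ_eq g (\<lambda>t. h t * v t)}"

lemma germ_space_lin: "germ_space V \<Longrightarrow> lin_sub V"
  and germ_space_analytic: "germ_space V \<Longrightarrow> f \<in> V \<Longrightarrow> f analytic_on {0}"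
  and germ_space_cong: "germ_space V \<Longrightarrow> f \<in> V \<Longrightarrow> germ_eq f g \<Longrightarrow> g \<in> V"
  by (auto simp: germ_space_def)

lemma germ_space_subset: "germ_space V \<Longrightarrow> V \<subseteq> germs1"
  by (auto simp: germ_space_def germs1_def)

lemma germ_space_germs1: "germ_space germs1"
  unfolding germ_space_def germs1_def
  by (auto intro!: lin_subI analytic_intros dest: germ_eq_analytic)

lemma germ_mulI: "v \<in> V \<Longrightarrow> germ_eq g (\<lambda>t. h t * v t) \<Longrightarrow> g \<in> germ_mul h V"
  by (auto simp: germ_mul_def)

lemma germ_space_mul:
  assumes "germ_space V" "h analytic_on {0}" shows "germ_space (germ_mul h V)"
  unfolding germ_space_def
proof (intro conjI ballI allI impI)
  note V = germ_space_lin[OF assms(1)]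
  show "lin_sub (germ_mul h V)"
  proof (rule lin_subI)
    show "(\<lambda>_. 0) \<in> germ_mul h V" unfolding germ_mul_def using lin_sub_zero[OF V] by (auto intro!: bexI[of _ "\<lambda>_. 0"])
  next
    fix u v assume "u \<in> germ_mul h V" "v \<in> germ_mul h V"
    then obtain u' v' where *: "u' \<in> V" "germ_eq u (\<lambda>t. h t * u' t)" "v' \<in> V" "germ_eq v (\<lambda>t. h t * v' t)"
      unfolding germ_mul_def by blast
    have "germ_eq (\<lambda>t. u t + v t) (\<lambda>t. h t * (u' t + v' t))"
      using germ_eq_add[OF *(2,4)] by (simp add: distrib_left)
    thus "(\<lambda>t. u t + v t) \<in> germ_mul h V"
      by (rule germ_mulI[OF lin_sub_add[OF V *(1,3)]])
  next
    fix c u assume "u \<in> germ_mul h V"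
    then obtain u' where *: "u' \<in> V" "germ_eq u (\<lambda>t. h t * u' t)"
      unfolding germ_mul_def by blast
    have "germ_eq (\<lambda>t. c * u t) (\<lambda>t. h t * (c * u' t))"
      using germ_eq_mult[OF germ_eq_refl[of "\<lambda>_. c"] *(2)] by (simp add: mult_ac)
    thus "(\<lambda>t. c * u t) \<in> germ_mul h V"
      by (rule germ_mulI[OF lin_sub_scale[OF V *(1)]])
  qed
  show "f analytic_on {0}" if "f \<in> germ_mul h V" for f
  proof -
    from that obtain v where v: "v \<in> V" "germ_eq f (\<lambda>t. h t * v t)" unfolding germ_mul_def by blast
    have "(\<lambda>t. h t * v t) analytic_on {0}"
      by (intro analytic_intros assms(2) germ_space_analytic[OF assms(1) v(1)])
    thus ?thesis using germ_eq_analytic[OF v(2)] by blast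
  qed
  show "g \<in> germ_mul h V" if "f \<in> germ_mul h V" "germ_eq f g" for f g
    using that germ_eq_trans[OF germ_eq_sym[OF that(2)]] unfolding germ_mul_def by blast
qed

lemma lin_map_mult: "lin_map (\<lambda>v t. h t * v t)"
  by (auto simp: lin_map_def algebra_simps)

text \<open>Germs form an integral domain, so multiplication by a nonzero h induces an isomorphism
  of the two quotients.\<close>

lemma qdim_germ_mul:
  assumes "germ_space V" "germ_space W" "h analytic_on {0}" "\<not> germ_eq h (\<lambda>_. 0)"
  shows "qdim V W n \<longleftrightarrow> qdim (germ_mul h V) (germ_mul h W) n"
proof (rule qdim_transport[OF lin_map_mult])
  show "lin_sub (germ_mul h W)" "lin_sub V"
    using assms germ_space_mul germ_space_lin by blast+
  show "(\<lambda>t. h t * v t) \<in> germ_mul h V" if "v \<in> V" for v by (rule germ_mulI[OF that germ_eq_refl])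
  show "\<exists>v\<in>V. (\<lambda>z. v' z - h z * v z) \<in> germ_mul h W" if v': "v' \<in> germ_mul h V" for v'
  proof -
    from v' obtain v where v: "v \<in> V" "germ_eq v' (\<lambda>t. h t * v t)" unfolding germ_mul_def by blast
    hence "germ_eq (\<lambda>z. v' z - h z * v z) (\<lambda>t. h t * 0)" unfolding germ_eq_def by simp
    hence "(\<lambda>z. v' z - h z * v z) \<in> germ_mul h W"
      by (intro germ_mulI[where v = "\<lambda>_. 0"] lin_sub_zero germ_space_lin assms)
    thus ?thesis using v by blast
  qed
  show "(\<lambda>t. h t * v t) \<in> germ_mul h W \<longleftrightarrow> v \<in> W" if v: "v \<in> V" for v
  proof
    assume "(\<lambda>t. h t * v t) \<in> germ_mul h W"
    then obtain w where w: "w \<in> W" "germ_eq (\<lambda>t. h t * v t) (\<lambda>t. h t * w t)" unfolding germ_mul_def by blast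
    have "germ_eq v w"
      by (rule germ_eq_cancel[OF _ _ assms(3,4) w(2)]) (use germ_space_analytic assms v w in auto)
    thus "v \<in> W" using germ_space_cong[OF assms(2) w(1) germ_eq_sym] by blast
  next
    assume "v \<in> W" thus "(\<lambda>t. h t * v t) \<in> germ_mul h W" by (rule germ_mulI[OF _ germ_eq_refl])
  qed
qed

text \<open>Taylor polynomials of degree below n represent the classes; the unit in h is absorbed
  into the cofactor of t^n.\<close>

lemma qdim_has_order:
  assumes "has_order h n" shows "qdim germs1 (germ_mul h germs1) n"
proof -
  from assms obtain u where u: "u analytic_on {0}" "u 0 \<noteq> 0" "germ_eq h (\<lambda>t. t ^ n * u t)"
    unfolding has_order_def by blast
  have "basis_mod germs1 (germ_mul h germs1) {..<n} (\<lambda>i t. t ^ i)"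
    unfolding basis_mod_def
  proof (intro conjI)
    show "(\<lambda>i t. t ^ i) ` {..<n} \<subseteq> germs1" by (auto simp: germs1_def intro!: analytic_intros)
    show "span_mod germs1 (germ_mul h germs1) {..<n} (\<lambda>i t. t ^ i)" unfolding span_mod_def
    proof
      fix f assume "f \<in> germs1"
      hence "f analytic_on {0}" by (simp add: germs1_def)
      from analytic_taylor[OF this, of n] obtain d where d: "d analytic_on {0}"
        "\<forall>\<^sub>F y in nhds 0. f y = (\<Sum>j<n. (deriv ^^ j) f 0 / fact j * (y - 0) ^ j) + (y - 0) ^ n * d y" .
      have "germ_eq (\<lambda>t. f t - (\<Sum>j<n. (deriv ^^ j) f 0 / fact j * t ^ j)) (\<lambda>t. h t * (d t / u t))"
        using d(2) analytic_nonzero_near[OF u(1,2)] u(3) unfolding germ_eq_def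
        by eventually_elim simp
      moreover have "(\<lambda>t. d t / u t) \<in> germs1" using d(1) u by (auto simp: germs1_def intro!: analytic_intros)
      ultimately have "(\<lambda>t. f t - (\<Sum>j<n. (deriv ^^ j) f 0 / fact j * t ^ j)) \<in> germ_mul h germs1"
        by (rule germ_mulI[rotated])
      thus "\<exists>c. (\<lambda>t. f t - (\<Sum>j<n. c j * t ^ j)) \<in> germ_mul h germs1" by (rule exI[of _ "\<lambda>j. (deriv ^^ j) f 0 / fact j"])
    qed
    show "indep_mod (germ_mul h germs1) {..<n} (\<lambda>i t. t ^ i)" unfolding indep_mod_def
    proof (intro allI impI ballI)
      fix c i assume "(\<lambda>t. \<Sum>i<n. c i * t ^ i) \<in> germ_mul h germs1" and i: "i \<in> {..<n}"
      then obtain v where v: "v analytic_on {0}" "germ_eq (\<lambda>t. \<Sum>i<n. c i * t ^ i) (\<lambda>t. h t * v t)"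
        unfolding germ_mul_def germs1_def by blast
      have "germ_eq (\<lambda>t. \<Sum>i<n. c i * t ^ i) (\<lambda>t. t ^ n * (u t * v t))"
        using v(2) u(3) unfolding germ_eq_def by eventually_elim (simp add: mult_ac)
      thus "c i = 0" using i by (intro poly_germ_divisible[where w = "\<lambda>t. u t * v t" and n = n]) (auto intro!: analytic_intros u v)
    qed
  qed simp
  from basis_mod_imp_qdim[OF this] show ?thesis by simp
qed

text \<open>
  With \<open>I = {r \<in> R. r \<beta> \<in> \<alpha> R}\<close>, multiplication by \<open>\<beta>\<close> identifies \<open>R / I\<close> with
  \<open>(R \<alpha> + R \<beta>) / R \<alpha>\<close>, while \<open>\<alpha> J = h I\<close>.  No duality theory is needed because the module of
  forms on the branch has two generators.
\<close>

lemma two_generator_duality: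
  assumes R: "germ_space R" and Rmult: "\<And>f g. f \<in> R \<Longrightarrow> g \<in> R \<Longrightarrow> (\<lambda>t. f t * g t) \<in> R"
    and an: "\<alpha> analytic_on {0}" "\<beta> analytic_on {0}" and ab: "a \<in> R" "b \<in> R"
    and nz: "\<not> germ_eq \<alpha> (\<lambda>_. 0)" and ord: "has_order (\<lambda>t. a t * \<alpha> t + b t * \<beta> t) n"
    and dim: "qdim germs1 R \<delta>"
  defines "M \<equiv> {g. \<exists>r\<in>R. \<exists>s\<in>R. germ_eq g (\<lambda>t. r t * \<alpha> t + s t * \<beta> t)}"
    and "J \<equiv> {g. \<exists>P\<in>R. \<exists>Q\<in>R. germ_eq (\<lambda>t. P t * \<beta> t) (\<lambda>t. Q t * \<alpha> t) \<and> germ_eq g (\<lambda>t. a t * P t + b t * Q t)}"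
  shows "germ_space M" "germ_space J" "\<exists>\<mu> d. qdim R J \<mu> \<and> qdim germs1 M d \<and> \<mu> + d = n + \<delta>"
proof -
  note Ran = germ_space_analytic[OF R] and Rlin = germ_space_lin[OF R]
  note radd = lin_sub_add[OF Rlin] and rsc = lin_sub_scale[OF Rlin] and r0 = lin_sub_zero[OF Rlin]
  have M_I: "g \<in> M" if "r \<in> R" "s \<in> R" "germ_eq g (\<lambda>t. r t * \<alpha> t + s t * \<beta> t)" for g r s
    using that by (auto simp: M_def)
  have J_I: "g \<in> J" if "r \<in> R" "s \<in> R" "germ_eq (\<lambda>t. r t * \<beta> t) (\<lambda>t. s t * \<alpha> t)"
    "germ_eq g (\<lambda>t. a t * r t + b t * s t)" for g r s
    using that by (auto simp: J_def)
  define h where "h = (\<lambda>t. a t * \<alpha> t + b t * \<beta> t)"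
  have han: "h analytic_on {0}" unfolding h_def by (intro analytic_intros an Ran ab)
  have hnz: "\<not> germ_eq h (\<lambda>_. 0)" using has_order_not_zero[OF ord] by (simp add: h_def)
  show M: "germ_space M" unfolding germ_space_def
  proof (intro conjI ballI allI impI)
    show "lin_sub M"
    proof (rule lin_subI)
      have "germ_eq (\<lambda>_. 0) (\<lambda>t. 0 * \<alpha> t + 0 * \<beta> t)" by simp
      thus "(\<lambda>_. 0) \<in> M" by (rule M_I[OF r0 r0])
    next
      fix u v assume "u \<in> M" "v \<in> M"
      then obtain r s r' s' where *: "r \<in> R" "s \<in> R" "r' \<in> R" "s' \<in> R"
        "germ_eq u (\<lambda>t. r t * \<alpha> t + s t * \<beta> t)" "germ_eq v (\<lambda>t. r' t * \<alpha> t + s' t * \<beta> t)"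
        unfolding M_def by blast
      have "germ_eq (\<lambda>t. u t + v t) (\<lambda>t. (r t + r' t) * \<alpha> t + (s t + s' t) * \<beta> t)"
        using germ_eq_add[OF *(5,6)] by (simp add: algebra_simps)
      thus "(\<lambda>t. u t + v t) \<in> M" by (rule M_I[OF radd[OF *(1,3)] radd[OF *(2,4)]])
    next
      fix c u assume "u \<in> M"
      then obtain r s where *: "r \<in> R" "s \<in> R" "germ_eq u (\<lambda>t. r t * \<alpha> t + s t * \<beta> t)"
        unfolding M_def by blast
      have "germ_eq (\<lambda>t. c * u t) (\<lambda>t. (c * r t) * \<alpha> t + (c * s t) * \<beta> t)"
        using germ_eq_mult[OF germ_eq_refl[of "\<lambda>_. c"] *(3)] by (simp add: algebra_simps)
      thus "(\<lambda>t. c * u t) \<in> M" by (rule M_I[OF rsc[OF *(1)] rsc[OF *(2)]])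
    qed
    show "f analytic_on {0}" if "f \<in> M" for f
    proof -
      from that obtain r s where *: "r \<in> R" "s \<in> R" "germ_eq f (\<lambda>t. r t * \<alpha> t + s t * \<beta> t)"
        unfolding M_def by blast
      have "(\<lambda>t. r t * \<alpha> t + s t * \<beta> t) analytic_on {0}" by (intro analytic_intros an Ran *)
      thus ?thesis using germ_eq_analytic[OF *(3)] by blast
    qed
    show "g \<in> M" if "f \<in> M" "germ_eq f g" for f g
      using that germ_eq_trans[OF germ_eq_sym[OF that(2)]] unfolding M_def by blast
  qed
  show J: "germ_space J" unfolding germ_space_def
  proof (intro conjI ballI allI impI)
    show "lin_sub J"
    proof (rule lin_subI)
      have "germ_eq (\<lambda>t. 0 * \<beta> t) (\<lambda>t. 0 * \<alpha> t)" "germ_eq (\<lambda>_. 0) (\<lambda>t. a t * 0 + b t * 0)" by simp_all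
      thus "(\<lambda>_. 0) \<in> J" by (rule J_I[OF r0 r0])
    next
      fix u v assume "u \<in> J" "v \<in> J"
      then obtain r s r' s' where *: "r \<in> R" "s \<in> R" "r' \<in> R" "s' \<in> R"
        "germ_eq (\<lambda>t. r t * \<beta> t) (\<lambda>t. s t * \<alpha> t)" "germ_eq (\<lambda>t. r' t * \<beta> t) (\<lambda>t. s' t * \<alpha> t)"
        "germ_eq u (\<lambda>t. a t * r t + b t * s t)" "germ_eq v (\<lambda>t. a t * r' t + b t * s' t)"
        unfolding J_def by blast
      have 1: "germ_eq (\<lambda>t. u t + v t) (\<lambda>t. a t * (r t + r' t) + b t * (s t + s' t))"
        using germ_eq_add[OF *(7,8)] by (simp add: algebra_simps)
      have 2: "germ_eq (\<lambda>t. (r t + r' t) * \<beta> t) (\<lambda>t. (s t + s' t) * \<alpha> t)"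
        using germ_eq_add[OF *(5,6)] by (simp add: algebra_simps)
      show "(\<lambda>t. u t + v t) \<in> J" by (rule J_I[OF radd[OF *(1,3)] radd[OF *(2,4)] 2 1])
    next
      fix c u assume "u \<in> J"
      then obtain r s where *: "r \<in> R" "s \<in> R" "germ_eq (\<lambda>t. r t * \<beta> t) (\<lambda>t. s t * \<alpha> t)"
        "germ_eq u (\<lambda>t. a t * r t + b t * s t)"
        unfolding J_def by blast
      have 1: "germ_eq (\<lambda>t. c * u t) (\<lambda>t. a t * (c * r t) + b t * (c * s t))"
        using germ_eq_mult[OF germ_eq_refl[of "\<lambda>_. c"] *(4)] by (simp add: algebra_simps)
      have 2: "germ_eq (\<lambda>t. (c * r t) * \<beta> t) (\<lambda>t. (c * s t) * \<alpha> t)"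
        using germ_eq_mult[OF germ_eq_refl[of "\<lambda>_. c"] *(3)] by (simp add: algebra_simps)
      show "(\<lambda>t. c * u t) \<in> J" by (rule J_I[OF rsc[OF *(1)] rsc[OF *(2)] 2 1])
    qed
    show "f analytic_on {0}" if "f \<in> J" for f
    proof -
      from that obtain r s where *: "r \<in> R" "s \<in> R" "germ_eq f (\<lambda>t. a t * r t + b t * s t)"
        unfolding J_def by blast
      have "(\<lambda>t. a t * r t + b t * s t) analytic_on {0}" by (intro analytic_intros Ran ab *)
      thus ?thesis using germ_eq_analytic[OF *(3)] by blast
    qed
    show "g \<in> J" if "f \<in> J" "germ_eq f g" for f g
      using that germ_eq_trans[OF germ_eq_sym[OF that(2)]] unfolding J_def by blast
  qed
  define I where "I = {r \<in> R. \<exists>s\<in>R. germ_eq (\<lambda>t. r t * \<beta> t) (\<lambda>t. s t * \<alpha> t)}"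
  have I_I: "r \<in> I" if "r \<in> R" "s \<in> R" "germ_eq (\<lambda>t. r t * \<beta> t) (\<lambda>t. s t * \<alpha> t)" for r s
    using that by (auto simp: I_def)
  have I: "germ_space I" unfolding germ_space_def
  proof (intro conjI ballI allI impI)
    show "lin_sub I"
    proof (rule lin_subI)
      have "germ_eq (\<lambda>t. 0 * \<beta> t) (\<lambda>t. 0 * \<alpha> t)" by simp
      thus "(\<lambda>_. 0) \<in> I" by (rule I_I[OF r0 r0])
    next
      fix u v assume "u \<in> I" "v \<in> I"
      then obtain s s' where *: "u \<in> R" "s \<in> R" "v \<in> R" "s' \<in> R"
        "germ_eq (\<lambda>t. u t * \<beta> t) (\<lambda>t. s t * \<alpha> t)" "germ_eq (\<lambda>t. v t * \<beta> t) (\<lambda>t. s' t * \<alpha> t)"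
        unfolding I_def by blast
      have "germ_eq (\<lambda>t. (u t + v t) * \<beta> t) (\<lambda>t. (s t + s' t) * \<alpha> t)"
        using germ_eq_add[OF *(5,6)] by (simp add: algebra_simps)
      thus "(\<lambda>t. u t + v t) \<in> I" by (rule I_I[OF radd[OF *(1,3)] radd[OF *(2,4)]])
    next
      fix c u assume "u \<in> I"
      then obtain s where *: "u \<in> R" "s \<in> R" "germ_eq (\<lambda>t. u t * \<beta> t) (\<lambda>t. s t * \<alpha> t)"
        unfolding I_def by blast
      have "germ_eq (\<lambda>t. (c * u t) * \<beta> t) (\<lambda>t. (c * s t) * \<alpha> t)"
        using germ_eq_mult[OF germ_eq_refl[of "\<lambda>_. c"] *(3)] by (simp add: algebra_simps)
      thus "(\<lambda>t. c * u t) \<in> I" by (rule I_I[OF rsc[OF *(1)] rsc[OF *(2)]])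
    qed
    show "f analytic_on {0}" if "f \<in> I" for f using that Ran by (auto simp: I_def)
    show "g \<in> I" if "f \<in> I" "germ_eq f g" for f g
    proof -
      from that(1) obtain s where *: "f \<in> R" "s \<in> R" "germ_eq (\<lambda>t. f t * \<beta> t) (\<lambda>t. s t * \<alpha> t)"
        unfolding I_def by blast
      have "germ_eq (\<lambda>t. g t * \<beta> t) (\<lambda>t. s t * \<alpha> t)"
        using germ_eq_trans[OF germ_eq_mult[OF germ_eq_sym[OF that(2)] germ_eq_refl] *(3)] .
      thus ?thesis by (rule I_I[OF germ_space_cong[OF R *(1) that(2)] *(2)])
    qed
  qed
  note G1 = germ_space_germs1
  note aR = germ_space_mul[OF R an(1)] and hI = germ_space_mul[OF I han]
    and aS = germ_space_mul[OF G1 an(1)] and hS = germ_space_mul[OF G1 han]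
  have mono: "germ_mul f V \<subseteq> germ_mul f W" if "V \<subseteq> W" for f V W using that by (auto simp: germ_mul_def)
  obtain ka where ka: "has_order \<alpha> ka" using analytic_has_order[OF an(1) nz] by blast
  \<comment> \<open>The chain \<open>germ_mul \<alpha> R\<close> inside
    \<open>germ_mul \<alpha> germs1\<close> inside \<open>germs1\<close>: the upper quotient has
    dimension ord \<alpha>, the lower one is isomorphic to \<open>germs1\<close> modulo R.\<close>
  have d1: "qdim germs1 (germ_mul \<alpha> R) (ka + \<delta>)"
    by (rule qdim_trans[OF germ_space_lin[OF aS] germ_space_lin[OF aR] mono[OF germ_space_subset[OF R]]
          germ_space_subset[OF aS] qdim_has_order[OF ka]])
       (use qdim_germ_mul[OF G1 R an(1) nz] dim in blast)
  have sub: "germ_mul \<alpha> R \<subseteq> M"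
  proof
    fix g assume "g \<in> germ_mul \<alpha> R"
    then obtain r where r: "r \<in> R" "germ_eq g (\<lambda>t. \<alpha> t * r t)" unfolding germ_mul_def by blast
    hence "germ_eq g (\<lambda>t. r t * \<alpha> t + 0 * \<beta> t)" by (simp add: mult.commute)
    thus "g \<in> M" by (rule M_I[OF r(1) r0])
  qed
  from qdim_intermediate[OF germ_space_lin[OF aR] germ_space_lin[OF M] sub germ_space_subset[OF M] d1]
  obtain d e where d: "qdim germs1 M d" and e: "qdim M (germ_mul \<alpha> R) e" .
  \<comment> \<open>The same codimension, now counted through M.\<close>
  have de: "d + e = ka + \<delta>"
    by (rule qdim_unique[OF germ_space_lin[OF aR] qdim_trans[OF germ_space_lin[OF M] germ_space_lin[OF aR] sub
          germ_space_subset[OF M] d e] d1])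
  have "qdim R I e \<longleftrightarrow> qdim M (germ_mul \<alpha> R) e"
  proof (rule qdim_transport[where T = "\<lambda>v t. \<beta> t * v t", OF lin_map_mult germ_space_lin[OF aR] _ _ Rlin])
    show "(\<lambda>t. \<beta> t * v t) \<in> M" if "v \<in> R" for v
    proof -
      have "germ_eq (\<lambda>t. \<beta> t * v t) (\<lambda>t. 0 * \<alpha> t + v t * \<beta> t)" by (simp add: mult.commute)
      thus ?thesis by (rule M_I[OF r0 that])
    qed
    show "\<exists>v\<in>R. (\<lambda>z. v' z - \<beta> z * v z) \<in> germ_mul \<alpha> R" if "v' \<in> M" for v'
    proof -
      from that obtain r s where *: "r \<in> R" "s \<in> R" "germ_eq v' (\<lambda>t. r t * \<alpha> t + s t * \<beta> t)"
        unfolding M_def by blast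
      have "germ_eq (\<lambda>z. v' z - \<beta> z * s z) (\<lambda>t. \<alpha> t * r t)"
        using *(3) unfolding germ_eq_def by eventually_elim simp
      hence "(\<lambda>z. v' z - \<beta> z * s z) \<in> germ_mul \<alpha> R" by (rule germ_mulI[OF *(1)])
      thus ?thesis using *(2) by blast
    qed
    show "(\<lambda>t. \<beta> t * v t) \<in> germ_mul \<alpha> R \<longleftrightarrow> v \<in> I" if "v \<in> R" for v
      using that by (auto simp: germ_mul_def I_def mult.commute)
  qed
  hence "qdim R I e" using e by blast
  have "I \<subseteq> R" by (auto simp: I_def)
  from qdim_trans[OF Rlin germ_space_lin[OF I] this germ_space_subset[OF R] dim \<open>qdim R I e\<close>]
  have "qdim germs1 I (\<delta> + e)" .
  hence "qdim (germ_mul h germs1) (germ_mul h I) (\<delta> + e)" using qdim_germ_mul[OF G1 I han hnz] by blast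
  \<comment> \<open>The same kind of chain for h and I: n from \<open>germs1\<close> down to its
    multiple by h, then the codimension of I in \<open>germs1\<close>.\<close>
  from qdim_trans[OF germ_space_lin[OF hS] germ_space_lin[OF hI] mono[OF germ_space_subset[OF I]]
      germ_space_subset[OF hS] qdim_has_order this] ord
  have d2: "qdim germs1 (germ_mul h I) (n + (\<delta> + e))" by (simp add: h_def)
  \<comment> \<open>If P \<beta> = Q \<alpha>, then \<alpha> (a P + b Q) = (a \<alpha> + b \<beta>)
    P = h P.\<close>
  have eqJ: "germ_mul h I = germ_mul \<alpha> J"
  proof (intro equalityI subsetI)
    fix g assume "g \<in> germ_mul h I"
    then obtain r s where *: "r \<in> R" "s \<in> R" "germ_eq (\<lambda>t. r t * \<beta> t) (\<lambda>t. s t * \<alpha> t)" "germ_eq g (\<lambda>t. h t * r t)"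
      unfolding germ_mul_def I_def by blast
    have "germ_eq g (\<lambda>t. \<alpha> t * (a t * r t + b t * s t))"
      using *(3,4) unfolding germ_eq_def h_def by eventually_elim (simp add: algebra_simps)
    moreover have "(\<lambda>t. a t * r t + b t * s t) \<in> J" by (rule J_I[OF *(1,2,3) germ_eq_refl])
    ultimately show "g \<in> germ_mul \<alpha> J" by (rule germ_mulI[rotated])
  next
    fix g assume "g \<in> germ_mul \<alpha> J"
    then obtain v P Q where *: "P \<in> R" "Q \<in> R" "germ_eq (\<lambda>t. P t * \<beta> t) (\<lambda>t. Q t * \<alpha> t)"
      "germ_eq v (\<lambda>t. a t * P t + b t * Q t)" "germ_eq g (\<lambda>t. \<alpha> t * v t)"
      unfolding germ_mul_def J_def by blast
    have "germ_eq g (\<lambda>t. h t * P t)"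
      using *(3,4,5) unfolding germ_eq_def h_def by eventually_elim (simp add: algebra_simps)
    moreover have "P \<in> I" by (rule I_I[OF *(1,2,3)])
    ultimately show "g \<in> germ_mul h I" by (rule germ_mulI[rotated])
  qed
  have "J \<subseteq> R"
  proof
    fix g assume "g \<in> J"
    then obtain P Q where *: "P \<in> R" "Q \<in> R" "germ_eq g (\<lambda>t. a t * P t + b t * Q t)" unfolding J_def by blast
    have "(\<lambda>t. a t * P t + b t * Q t) \<in> R" by (intro radd Rmult ab *)
    thus "g \<in> R" using germ_space_cong[OF R _ germ_eq_sym[OF *(3)]] by blast
  qed
  hence sub2: "germ_mul h I \<subseteq> germ_mul \<alpha> R" unfolding eqJ by (rule mono)
  from qdim_intermediate[OF germ_space_lin[OF hI] germ_space_lin[OF aR] sub2 germ_space_subset[OF aR] d2]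
  obtain k \<mu> where k: "qdim germs1 (germ_mul \<alpha> R) k" and \<mu>: "qdim (germ_mul \<alpha> R) (germ_mul h I) \<mu>" .
  \<comment> \<open>Both sides are the codimension of h I = \<alpha> J, counted through \<alpha> R
    on the left and through the multiples of h on the right. Together with \<open>de\<close> the
    unknowns \<open>e\<close> and \<open>ka\<close> drop out.\<close>
  have "(ka + \<delta>) + \<mu> = n + (\<delta> + e)"
    by (rule qdim_unique[OF germ_space_lin[OF hI] qdim_trans[OF germ_space_lin[OF aR] germ_space_lin[OF hI] sub2
          germ_space_subset[OF aR] d1 \<mu>] d2])
  moreover have "qdim R J \<mu>" using \<mu> qdim_germ_mul[OF R J an(1) nz] unfolding eqJ by blast
  ultimately show "\<exists>\<mu> d. qdim R J \<mu> \<and> qdim germs1 M d \<and> \<mu> + d = n + \<delta>"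
    using d de by (intro exI[of _ \<mu>] exI[of _ d]) auto
qed

section \<open>Restriction to a branch\<close>

definition curve_germ :: "complex \<times> complex \<Rightarrow> (complex \<Rightarrow> complex \<times> complex) \<Rightarrow> bool" where
  "curve_germ p \<gamma> \<longleftrightarrow> \<gamma> 0 = p \<and> (fst \<circ> \<gamma>) analytic_on {0} \<and> (snd \<circ> \<gamma>) analytic_on {0}"

definition branch_ring :: "complex \<times> complex \<Rightarrow> (complex \<Rightarrow> complex \<times> complex) \<Rightarrow> (complex \<Rightarrow> complex) set" where
  "branch_ring p \<gamma> = {g. \<exists>f\<in>hol_germs p. germ_eq g (\<lambda>t. f (\<gamma> t))}"

text \<open>This is the algebraic content of a reduced equation: \<phi> generates the ideal of germs
  vanishing on the branch, and its gradient is not identically zero along it.\<close>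

definition branch_of :: "complex \<times> complex \<Rightarrow> cfun2 \<Rightarrow> (complex \<Rightarrow> complex \<times> complex) \<Rightarrow> bool" where
  "branch_of p \<phi> \<gamma> \<longleftrightarrow> curve_germ p \<gamma> \<and> \<phi> \<in> hol_germs p \<and> germ_eq (\<lambda>t. \<phi> (\<gamma> t)) (\<lambda>_. 0) \<and>
     (\<forall>f\<in>hol_germs p. germ_eq (\<lambda>t. f (\<gamma> t)) (\<lambda>_. 0) \<longrightarrow> germ_dvd p \<phi> f) \<and>
     \<not> (germ_eq (\<lambda>t. partial_x \<phi> (\<gamma> t)) (\<lambda>_. 0) \<and> germ_eq (\<lambda>t. partial_y \<phi> (\<gamma> t)) (\<lambda>_. 0))"

lemma curve_germ_filterlim:
  assumes "curve_germ p \<gamma>" shows "filterlim \<gamma> (nhds p) (nhds 0)"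
proof -
  have "isCont (fst \<circ> \<gamma>) 0" "isCont (snd \<circ> \<gamma>) 0"
    using assms analytic_at_imp_isCont by (auto simp: curve_germ_def)
  hence "isCont (\<lambda>t. ((fst \<circ> \<gamma>) t, (snd \<circ> \<gamma>) t)) 0" by (rule isCont_Pair)
  hence "isCont \<gamma> 0" by simp
  hence "(\<gamma> \<longlongrightarrow> \<gamma> 0) (nhds 0)" by (simp add: continuous_at tendsto_at_iff_tendsto_nhds)
  thus ?thesis using assms by (simp add: curve_germ_def)
qed

lemma curve_germ_eventually:
  "curve_germ p \<gamma> \<Longrightarrow> \<forall>\<^sub>F z in nhds p. P z \<Longrightarrow> \<forall>\<^sub>F t in nhds 0. P (\<gamma> t)"
  using curve_germ_filterlim eventually_compose_filterlim by blast

lemma eventually_differentiable_imp_analytic: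
  assumes "\<forall>\<^sub>F t in nhds (0::complex). f field_differentiable at t" shows "f analytic_on {0}"
proof -
  from assms obtain S where "open S" "0 \<in> S" "\<And>t. t \<in> S \<Longrightarrow> f field_differentiable at t"
    unfolding eventually_nhds by blast
  thus ?thesis unfolding analytic_at holomorphic_on_def using field_differentiable_at_within by blast
qed

lemma analytic_eventually_differentiable:
  assumes "f analytic_on {0::complex}"
  shows "\<forall>\<^sub>F t in nhds 0. (f has_field_derivative deriv f t) (at t)"
proof -
  from assms obtain S where S: "open S" "0 \<in> S" "f holomorphic_on S" unfolding analytic_at by blast
  thus ?thesis unfolding eventually_nhds using holomorphic_derivI by blast
qed

lemma curve_germ_chain:
  assumes \<gamma>: "curve_germ p \<gamma>" and f: "f \<in> hol_germs p"
  shows "\<forall>\<^sub>F t in nhds 0. ((\<lambda>t. f (\<gamma> t)) has_field_derivative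
    partial_x f (\<gamma> t) * deriv (fst \<circ> \<gamma>) t + partial_y f (\<gamma> t) * deriv (snd \<circ> \<gamma>) t) (at t)"
proof -
  have "(fst \<circ> \<gamma>) analytic_on {0}" "(snd \<circ> \<gamma>) analytic_on {0}" using \<gamma> by (auto simp: curve_germ_def)
  note d = this[THEN analytic_eventually_differentiable]
  from curve_germ_eventually[OF \<gamma> hol_germs_eventually(1)[OF f]] d(1) d(2)
  show ?thesis
  proof eventually_elim
    case (elim t)
    have "((\<lambda>t. ((fst \<circ> \<gamma>) t, (snd \<circ> \<gamma>) t)) has_derivative
      (\<lambda>h. (deriv (fst \<circ> \<gamma>) t * h, deriv (snd \<circ> \<gamma>) t * h))) (at t)"
      using elim(2,3) unfolding has_field_derivative_def by (rule has_derivative_Pair)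
    hence "(\<gamma> has_derivative (\<lambda>h. (deriv (fst \<circ> \<gamma>) t * h, deriv (snd \<circ> \<gamma>) t * h))) (at t)" by simp
    note D = diff_chain_at[OF this elim(1)]
    have eq: "(\<lambda>(h, k). partial_x f (\<gamma> t) * h + partial_y f (\<gamma> t) * k) \<circ>
        (\<lambda>h. (deriv (fst \<circ> \<gamma>) t * h, deriv (snd \<circ> \<gamma>) t * h)) =
      (*) (partial_x f (\<gamma> t) * deriv (fst \<circ> \<gamma>) t + partial_y f (\<gamma> t) * deriv (snd \<circ> \<gamma>) t)"
      by (rule ext) (simp add: algebra_simps)
    show ?case using D unfolding eq has_field_derivative_def comp_def[of f \<gamma>] .
  qed
qed

lemma curve_germ_compose_analytic:
  assumes "curve_germ p \<gamma>" "f \<in> hol_germs p" shows "(\<lambda>t. f (\<gamma> t)) analytic_on {0}"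
  using curve_germ_chain[OF assms]
  by (intro eventually_differentiable_imp_analytic) (auto simp: field_differentiable_def elim: eventually_mono)

lemma curve_germ_deriv_zero:
  assumes \<gamma>: "curve_germ p \<gamma>" and f: "f \<in> hol_germs p" and z: "germ_eq (\<lambda>t. f (\<gamma> t)) (\<lambda>_. 0)"
  shows "germ_eq (\<lambda>t. partial_x f (\<gamma> t) * deriv (fst \<circ> \<gamma>) t + partial_y f (\<gamma> t) * deriv (snd \<circ> \<gamma>) t) (\<lambda>_. 0)"
proof -
  from z obtain S where S: "open S" "0 \<in> S" "\<And>t. t \<in> S \<Longrightarrow> f (\<gamma> t) = 0"
    unfolding germ_eq_def eventually_nhds by blast
  have "\<forall>\<^sub>F t in nhds 0. t \<in> S" using S eventually_nhds_in_open by blast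
  with curve_germ_chain[OF \<gamma> f] show ?thesis unfolding germ_eq_def
  proof eventually_elim
    case (elim t)
    have "((\<lambda>t. f (\<gamma> t)) has_field_derivative 0) (at t)"
      by (rule has_field_derivative_transform_within_open[OF DERIV_const S(1)]) (use elim(2) S(3) in simp_all)
    from DERIV_unique[OF elim(1) this] show ?case .
  qed
qed

lemma lin_sub_hol_germs: "lin_sub (hol_germs p)"
  by (rule lin_subI) (auto intro: hol_germs_intros)

lemma branch_ringI: "f \<in> hol_germs p \<Longrightarrow> germ_eq g (\<lambda>t. f (\<gamma> t)) \<Longrightarrow> g \<in> branch_ring p \<gamma>"
  by (auto simp: branch_ring_def)

lemma branch_ring_mult:
  assumes "f \<in> branch_ring p \<gamma>" "g \<in> branch_ring p \<gamma>" shows "(\<lambda>t. f t * g t) \<in> branch_ring p \<gamma>"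
proof -
  from assms obtain f' g' where *: "f' \<in> hol_germs p" "germ_eq f (\<lambda>t. f' (\<gamma> t))" "g' \<in> hol_germs p" "germ_eq g (\<lambda>t. g' (\<gamma> t))"
    unfolding branch_ring_def by blast
  show ?thesis by (rule branch_ringI[OF hol_germs_mult[OF *(1,3)] germ_eq_mult[OF *(2,4)]])
qed

lemma germ_space_branch_ring:
  assumes "curve_germ p \<gamma>" shows "germ_space (branch_ring p \<gamma>)"
  unfolding germ_space_def
proof (intro conjI ballI allI impI)
  show "lin_sub (branch_ring p \<gamma>)"
  proof (rule lin_subI)
    show "(\<lambda>_. 0) \<in> branch_ring p \<gamma>" by (rule branch_ringI[OF hol_germs_const germ_eq_refl])
    show "(\<lambda>t. u t + v t) \<in> branch_ring p \<gamma>" if "u \<in> branch_ring p \<gamma>" "v \<in> branch_ring p \<gamma>" for u v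
    proof -
      from that obtain f' g' where *: "f' \<in> hol_germs p" "germ_eq u (\<lambda>t. f' (\<gamma> t))" "g' \<in> hol_germs p" "germ_eq v (\<lambda>t. g' (\<gamma> t))"
        unfolding branch_ring_def by blast
      show ?thesis by (rule branch_ringI[OF hol_germs_add[OF *(1,3)] germ_eq_add[OF *(2,4)]])
    qed
    show "(\<lambda>t. c * u t) \<in> branch_ring p \<gamma>" if "u \<in> branch_ring p \<gamma>" for c u
      by (rule branch_ring_mult[OF branch_ringI[OF hol_germs_const germ_eq_refl] that])
  qed
  show "f analytic_on {0}" if "f \<in> branch_ring p \<gamma>" for f
    using that curve_germ_compose_analytic[OF assms] germ_eq_analytic unfolding branch_ring_def by blast
  show "g \<in> branch_ring p \<gamma>" if "f \<in> branch_ring p \<gamma>" "germ_eq f g" for f g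
    using that germ_eq_trans[OF germ_eq_sym[OF that(2)]] unfolding branch_ring_def by blast
qed

text \<open>This identifies the forms with the module on two generators to which the duality
  applies.\<close>

lemma pulled_back_forms_eq:
  "pulled_back_forms p \<gamma> = {g. \<exists>r\<in>branch_ring p \<gamma>. \<exists>s\<in>branch_ring p \<gamma>.
     germ_eq g (\<lambda>t. r t * deriv (fst \<circ> \<gamma>) t + s t * deriv (snd \<circ> \<gamma>) t)}" (is "?L = ?R")
proof (intro equalityI subsetI)
  fix g assume "g \<in> ?L"
  then obtain a b where *: "a \<in> hol_germs p" "b \<in> hol_germs p"
    "germ_eq g (\<lambda>t. a (\<gamma> t) * deriv (fst \<circ> \<gamma>) t + b (\<gamma> t) * deriv (snd \<circ> \<gamma>) t)"
    unfolding pulled_back_forms_def germ_eq_def by blast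
  show "g \<in> ?R"
    by (intro CollectI bexI, rule *(3)) (rule branch_ringI[OF *(2) germ_eq_refl] branch_ringI[OF *(1) germ_eq_refl])+
next
  fix g assume "g \<in> ?R"
  then obtain r s a b where *: "a \<in> hol_germs p" "b \<in> hol_germs p" "germ_eq r (\<lambda>t. a (\<gamma> t))" "germ_eq s (\<lambda>t. b (\<gamma> t))"
    "germ_eq g (\<lambda>t. r t * deriv (fst \<circ> \<gamma>) t + s t * deriv (snd \<circ> \<gamma>) t)"
    unfolding branch_ring_def by blast
  have "\<forall>\<^sub>F t in nhds 0. g t = a (\<gamma> t) * deriv (fst \<circ> \<gamma>) t + b (\<gamma> t) * deriv (snd \<circ> \<gamma>) t"
    using *(3,4,5) unfolding germ_eq_def by eventually_elim simp
  thus "g \<in> ?L" unfolding pulled_back_forms_def using *(1,2) by blast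
qed

text \<open>\<open>two_generator_duality\<close> cancels \<alpha>, which is the zero germ when the
  branch lies on a line x = const. In that case \<alpha> and \<beta> exchange roles; M and J are
  symmetric under the exchange.\<close>

lemma two_generator_duality_branch:
  assumes R: "germ_space R" and Rmult: "\<And>f g. f \<in> R \<Longrightarrow> g \<in> R \<Longrightarrow> (\<lambda>t. f t * g t) \<in> R"
    and an: "\<alpha> analytic_on {0}" "\<beta> analytic_on {0}" and ab: "a \<in> R" "b \<in> R"
    and nz: "\<not> (germ_eq \<alpha> (\<lambda>_. 0) \<and> germ_eq \<beta> (\<lambda>_. 0))"
    and ord: "has_order (\<lambda>t. a t * \<alpha> t + b t * \<beta> t) n"
    and dim: "qdim germs1 R \<delta>"
  defines "M \<equiv> {g. \<exists>r\<in>R. \<exists>s\<in>R. germ_eq g (\<lambda>t. r t * \<alpha> t + s t * \<beta> t)}"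
    and "J \<equiv> {g. \<exists>P\<in>R. \<exists>Q\<in>R. germ_eq (\<lambda>t. P t * \<beta> t) (\<lambda>t. Q t * \<alpha> t) \<and> germ_eq g (\<lambda>t. a t * P t + b t * Q t)}"
  shows "germ_space M \<and> germ_space J \<and> (\<exists>\<mu> d. qdim R J \<mu> \<and> qdim germs1 M d \<and> \<mu> + d = n + \<delta>)"
proof (cases "germ_eq \<alpha> (\<lambda>_. 0)")
  case False
  show ?thesis unfolding M_def J_def
    using two_generator_duality[OF R Rmult an ab False ord dim] by blast
next
  case True
  hence nz': "\<not> germ_eq \<beta> (\<lambda>_. 0)" using nz by blast
  have ord': "has_order (\<lambda>t. b t * \<beta> t + a t * \<alpha> t) n" using ord by (simp add: add.commute)
  have eM: "{g. \<exists>r\<in>R. \<exists>s\<in>R. germ_eq g (\<lambda>t. r t * \<beta> t + s t * \<alpha> t)} = M"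
    unfolding M_def by (subst add.commute) blast
  have eJ: "{g. \<exists>P\<in>R. \<exists>Q\<in>R. germ_eq (\<lambda>t. P t * \<alpha> t) (\<lambda>t. Q t * \<beta> t) \<and> germ_eq g (\<lambda>t. b t * P t + a t * Q t)} = J"
    unfolding J_def using germ_eq_sym by (subst add.commute) blast
  note D = two_generator_duality[OF R Rmult an(2,1) ab(2,1) nz' ord' dim, unfolded eM eJ]
  show ?thesis by (intro conjI D)
qed

text \<open>Restriction to the branch maps the germs onto R with kernel generated by \<phi>. A field
  is logarithmic exactly when its restriction is proportional to the velocity of the branch, so the
  Bruce-Roberts ideal is the full preimage of J, and the duality gives its codimension.\<close>

lemma mu_BR_rel_formula:
  assumes br: "branch_of p \<phi> \<gamma>" and \<omega>: "fst \<omega> \<in> hol_germs p" "snd \<omega> \<in> hol_germs p"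
    and nz: "\<not> (germ_eq (deriv (fst \<circ> \<gamma>)) (\<lambda>_. 0) \<and> germ_eq (deriv (snd \<circ> \<gamma>)) (\<lambda>_. 0))"
    and ord: "has_order (\<lambda>t. fst \<omega> (\<gamma> t) * deriv (fst \<circ> \<gamma>) t + snd \<omega> (\<gamma> t) * deriv (snd \<circ> \<gamma>) t) n"
    and dim: "qdim germs1 (branch_ring p \<gamma>) \<delta>"
  shows "germ_space (pulled_back_forms p \<gamma>)"
    "\<exists>\<mu> d. mu_BR_rel p \<omega> \<phi> = enat \<mu> \<and> qdim germs1 (pulled_back_forms p \<gamma>) d \<and> \<mu> + d = n + \<delta>"
proof -
  from br have \<gamma>: "curve_germ p \<gamma>" and \<phi>: "\<phi> \<in> hol_germs p" and \<phi>0: "germ_eq (\<lambda>t. \<phi> (\<gamma> t)) (\<lambda>_. 0)"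
    and ker: "\<And>f. f \<in> hol_germs p \<Longrightarrow> germ_eq (\<lambda>t. f (\<gamma> t)) (\<lambda>_. 0) \<Longrightarrow> germ_dvd p \<phi> f"
    and grad: "\<not> (germ_eq (\<lambda>t. partial_x \<phi> (\<gamma> t)) (\<lambda>_. 0) \<and> germ_eq (\<lambda>t. partial_y \<phi> (\<gamma> t)) (\<lambda>_. 0))"
    by (auto simp: branch_of_def)
  define R where "R = branch_ring p \<gamma>"
  have R: "germ_space R" unfolding R_def by (rule germ_space_branch_ring[OF \<gamma>])
  let ?\<alpha> = "deriv (fst \<circ> \<gamma>)" and ?\<beta> = "deriv (snd \<circ> \<gamma>)"
  let ?A = "fst \<omega>" and ?B = "snd \<omega>" and ?X = "partial_x \<phi>" and ?Y = "partial_y \<phi>"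
  have an: "?\<alpha> analytic_on {0}" "?\<beta> analytic_on {0}"
    using \<gamma> by (auto simp: curve_germ_def intro: analytic_deriv)
  have comp: "(\<lambda>t. f (\<gamma> t)) analytic_on {0}" if "f \<in> hol_germs p" for f
    by (rule curve_germ_compose_analytic[OF \<gamma> that])
  have RI: "(\<lambda>t. f (\<gamma> t)) \<in> R" if "f \<in> hol_germs p" for f
    unfolding R_def by (rule branch_ringI[OF that germ_eq_refl])
  define J where "J = {g. \<exists>P\<in>R. \<exists>Q\<in>R. germ_eq (\<lambda>t. P t * ?\<beta> t) (\<lambda>t. Q t * ?\<alpha> t) \<and>
    germ_eq g (\<lambda>t. ?A (\<gamma> t) * P t + ?B (\<gamma> t) * Q t)}"
  have dual: "germ_space {g. \<exists>r\<in>R. \<exists>s\<in>R. germ_eq g (\<lambda>t. r t * ?\<alpha> t + s t * ?\<beta> t)} \<and> germ_space J \<and>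
     (\<exists>\<mu> d. qdim R J \<mu> \<and> qdim germs1 {g. \<exists>r\<in>R. \<exists>s\<in>R. germ_eq g (\<lambda>t. r t * ?\<alpha> t + s t * ?\<beta> t)} d \<and> \<mu> + d = n + \<delta>)"
    unfolding J_def
    by (rule two_generator_duality_branch[OF R _ an RI[OF \<omega>(1)] RI[OF \<omega>(2)] nz ord])
      (use dim branch_ring_mult in \<open>auto simp: R_def\<close>)
  have M: "{g. \<exists>r\<in>R. \<exists>s\<in>R. germ_eq g (\<lambda>t. r t * ?\<alpha> t + s t * ?\<beta> t)} = pulled_back_forms p \<gamma>"
    unfolding pulled_back_forms_eq R_def ..
  show "germ_space (pulled_back_forms p \<gamma>)" using dual M by simp
  have J: "germ_space J" using dual by blast
  have tangent: "germ_eq (\<lambda>t. ?X (\<gamma> t) * ?\<alpha> t + ?Y (\<gamma> t) * ?\<beta> t) (\<lambda>_. 0)"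
    by (rule curve_germ_deriv_zero[OF \<gamma> \<phi> \<phi>0])
  have X: "?X \<in> hol_germs p" and Y: "?Y \<in> hol_germs p"
    by (intro hol_germs_partial_x hol_germs_partial_y \<phi>)+
  have char: "f \<in> bruce_roberts_ideal p \<omega> \<phi> \<longleftrightarrow> f \<in> hol_germs p \<and> (\<lambda>t. f (\<gamma> t)) \<in> J" for f
  proof (intro iffI conjI)
    assume "f \<in> bruce_roberts_ideal p \<omega> \<phi>"
    then obtain P Q g where f: "f \<in> hol_germs p" and PQ: "(P, Q) \<in> log_fields p \<phi>" and g: "g \<in> hol_germs p"
      and eq: "\<forall>\<^sub>F z in nhds p. f z = (?A z * P z + ?B z * Q z) + g z * \<phi> z"
      unfolding bruce_roberts_ideal_def by auto
    from PQ obtain k where P: "P \<in> hol_germs p" and Q: "Q \<in> hol_germs p"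
      and k: "\<forall>\<^sub>F z in nhds p. P z * ?X z + Q z * ?Y z = k z * \<phi> z"
      unfolding log_fields_def germ_dvd_def by auto
    show "f \<in> hol_germs p" by fact
    have log: "germ_eq (\<lambda>t. P (\<gamma> t) * ?X (\<gamma> t) + Q (\<gamma> t) * ?Y (\<gamma> t)) (\<lambda>_. 0)"
      using curve_germ_eventually[OF \<gamma> k] \<phi>0 unfolding germ_eq_def by eventually_elim simp
    have "germ_eq (\<lambda>t. P (\<gamma> t) * ?\<beta> t) (\<lambda>t. Q (\<gamma> t) * ?\<alpha> t)"
    proof -
      have "(\<lambda>t. P (\<gamma> t) * ?\<beta> t) analytic_on {0}" "(\<lambda>t. Q (\<gamma> t) * ?\<alpha> t) analytic_on {0}"
        by (intro analytic_on_mult comp P Q an)+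
      note cancel = germ_eq_cancel[OF this]
      \<comment> \<open>The gradient annihilates both (P, Q) and the velocity. Hence the determinant
        of these two vectors is killed by each component of the gradient, and one component is a
        nonzero germ.\<close>
      have "germ_eq (\<lambda>t. ?X (\<gamma> t) * (P (\<gamma> t) * ?\<beta> t)) (\<lambda>t. ?X (\<gamma> t) * (Q (\<gamma> t) * ?\<alpha> t))"
        using log tangent unfolding germ_eq_def by eventually_elim algebra
      moreover have "germ_eq (\<lambda>t. ?Y (\<gamma> t) * (P (\<gamma> t) * ?\<beta> t)) (\<lambda>t. ?Y (\<gamma> t) * (Q (\<gamma> t) * ?\<alpha> t))"
        using log tangent unfolding germ_eq_def by eventually_elim algebra
      ultimately show ?thesis using grad cancel[OF comp[OF X]] cancel[OF comp[OF Y]] by blast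
    qed
    moreover have "germ_eq (\<lambda>t. f (\<gamma> t)) (\<lambda>t. ?A (\<gamma> t) * P (\<gamma> t) + ?B (\<gamma> t) * Q (\<gamma> t))"
      using curve_germ_eventually[OF \<gamma> eq] \<phi>0 unfolding germ_eq_def by eventually_elim simp
    ultimately show "(\<lambda>t. f (\<gamma> t)) \<in> J"
      unfolding J_def by (intro CollectI bexI[OF _ RI[OF P]] bexI[OF _ RI[OF Q]] conjI)
  next
    assume "f \<in> hol_germs p \<and> (\<lambda>t. f (\<gamma> t)) \<in> J"
    then obtain P' Q' where f: "f \<in> hol_germs p" and "P' \<in> R" "Q' \<in> R"
      and t': "germ_eq (\<lambda>t. P' t * ?\<beta> t) (\<lambda>t. Q' t * ?\<alpha> t)"
      and f': "germ_eq (\<lambda>t. f (\<gamma> t)) (\<lambda>t. ?A (\<gamma> t) * P' t + ?B (\<gamma> t) * Q' t)"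
      unfolding J_def by blast
    then obtain P Q where P: "P \<in> hol_germs p" "germ_eq P' (\<lambda>t. P (\<gamma> t))"
      and Q: "Q \<in> hol_germs p" "germ_eq Q' (\<lambda>t. Q (\<gamma> t))" unfolding R_def branch_ring_def by blast
    define K where "K z = P z * ?X z + Q z * ?Y z" for z
    have K: "K \<in> hol_germs p" unfolding K_def by (intro hol_germs_add hol_germs_mult P Q X Y)
    have "germ_eq (\<lambda>t. K (\<gamma> t)) (\<lambda>_. 0)"
    proof -
      note cancel = germ_eq_cancel[OF comp[OF K] analytic_on_const]
      \<comment> \<open>Conversely, since (P, Q) is proportional to the velocity, \<alpha> K = P (X
        \<alpha> + Y \<beta>), which vanishes by tangency; likewise for \<beta>.\<close>
      have "germ_eq (\<lambda>t. ?\<alpha> t * K (\<gamma> t)) (\<lambda>t. ?\<alpha> t * 0)"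
        using t' P(2) Q(2) tangent unfolding germ_eq_def K_def by eventually_elim algebra
      moreover have "germ_eq (\<lambda>t. ?\<beta> t * K (\<gamma> t)) (\<lambda>t. ?\<beta> t * 0)"
        using t' P(2) Q(2) tangent unfolding germ_eq_def K_def by eventually_elim algebra
      ultimately show ?thesis using nz cancel[OF an(1)] cancel[OF an(2)] by blast
    qed
    from ker[OF K this] have log: "(P, Q) \<in> log_fields p \<phi>"
      using P Q by (simp add: log_fields_def K_def[abs_def])
    \<comment> \<open>The part of f that is not explained by the field vanishes on the branch, so it
      is a multiple of \<phi>.\<close>
    define F where "F z = f z - (?A z * P z + ?B z * Q z)" for z
    have F: "F \<in> hol_germs p" unfolding F_def by (intro hol_germs_diff hol_germs_add hol_germs_mult P Q \<omega> f)
    have "germ_eq (\<lambda>t. F (\<gamma> t)) (\<lambda>_. 0)"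
      using f' P(2) Q(2) unfolding germ_eq_def F_def by eventually_elim simp
    from ker[OF F this] obtain g where g: "g \<in> hol_germs p" "\<forall>\<^sub>F z in nhds p. F z = g z * \<phi> z"
      unfolding germ_dvd_def by blast
    have "\<forall>\<^sub>F z in nhds p. f z = (?A z * P z + ?B z * Q z) + g z * \<phi> z"
      using g(2) unfolding F_def by eventually_elim (simp add: algebra_simps)
    thus "f \<in> bruce_roberts_ideal p \<omega> \<phi>" unfolding bruce_roberts_ideal_def
      using f g(1) log by (intro CollectI conjI bexI[of _ "(P, Q)"]) auto
  qed
  have lmap: "lin_map (\<lambda>f t. f (\<gamma> t))" by (auto simp: lin_map_def)
  have tr: "qdim (hol_germs p) (bruce_roberts_ideal p \<omega> \<phi>) k \<longleftrightarrow> qdim R J k" for k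
  proof (rule qdim_transport[OF lmap germ_space_lin[OF J] RI _ lin_sub_hol_germs])
    fix g assume "g \<in> R"
    then obtain f where f: "f \<in> hol_germs p" "germ_eq g (\<lambda>t. f (\<gamma> t))" unfolding R_def branch_ring_def by blast
    have "germ_eq (\<lambda>_. 0) (\<lambda>z. g z - f (\<gamma> z))" using f(2) unfolding germ_eq_def by eventually_elim simp
    from germ_space_cong[OF J lin_sub_zero[OF germ_space_lin[OF J]] this]
    show "\<exists>f\<in>hol_germs p. (\<lambda>z. g z - f (\<gamma> z)) \<in> J" using f(1) by blast
  qed (use char in auto)
  have lin: "lin_sub (bruce_roberts_ideal p \<omega> \<phi>)"
    by (rule lin_subI, unfold char)
      (use lin_sub_hol_germs[of p] germ_space_lin[OF J] in \<open>simp_all add: lin_sub_def\<close>)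
  from dual obtain \<mu> d where "qdim R J \<mu>" "qdim germs1 (pulled_back_forms p \<gamma>) d" "\<mu> + d = n + \<delta>"
    unfolding M by blast
  moreover from this have "mu_BR_rel p \<omega> \<phi> = enat \<mu>"
    unfolding mu_BR_rel_def using tr qdim_imp_quot_dim[OF lin] by blast
  ultimately show "\<exists>\<mu> d. mu_BR_rel p \<omega> \<phi> = enat \<mu> \<and> qdim germs1 (pulled_back_forms p \<gamma>) d \<and> \<mu> + d = n + \<delta>"
    by blast
qed

section \<open>Fibres of a branch over its first coordinate\<close>

definition unity_roots :: "nat \<Rightarrow> complex set" where
  "unity_roots m = {e. e ^ m = 1}"

lemma unity_roots_one [simp]: "1 \<in> unity_roots m"
  by (simp add: unity_roots_def)

lemma unity_roots_mult: "c \<in> unity_roots m \<Longrightarrow> e \<in> unity_roots m \<Longrightarrow> c * e \<in> unity_roots m"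
  by (simp add: unity_roots_def power_mult_distrib)

context
  fixes m :: nat
  assumes m: "m > 0"
begin

lemma finite_unity_roots [simp]: "finite (unity_roots m)"
  using m by (simp add: unity_roots_def finite_roots_unity)

lemma card_unity_roots [simp]: "card (unity_roots m) = m"
  using m by (simp add: unity_roots_def card_roots_unity_eq)

lemma unity_roots_nonzero: "e \<in> unity_roots m \<Longrightarrow> e \<noteq> 0"
  using m by (auto simp: unity_roots_def power_0_left)

lemma norm_unity_roots [simp]: "e \<in> unity_roots m \<Longrightarrow> norm e = 1"
proof -
  assume "e \<in> unity_roots m"
  hence "norm e ^ m = 1 ^ m" by (simp add: unity_roots_def flip: norm_power)
  thus "norm e = 1" using m power_eq_imp_eq_base[of "norm e" m 1] by simp
qed

lemma unity_roots_ball: "e \<in> unity_roots m \<Longrightarrow> s \<in> ball 0 r \<Longrightarrow> e * s \<in> ball 0 r"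
  by (simp add: norm_mult)

lemma bij_betw_unity_roots:
  assumes c: "c \<in> unity_roots m"
  shows "bij_betw ((*) c) (unity_roots m) (unity_roots m)"
proof -
  have inj: "inj_on ((*) c) (unity_roots m)" using unity_roots_nonzero[OF c] by (auto simp: inj_on_def)
  moreover have "(*) c ` unity_roots m = unity_roots m"
    by (rule card_subset_eq) (use unity_roots_mult[OF c] card_image[OF inj] in auto)
  ultimately show ?thesis by (simp add: bij_betw_def)
qed

text \<open>This reindexes products over a fibre with one point left out, as they occur in Lagrange
  polynomials.\<close>

lemma bij_betw_unity_roots_Diff:
  assumes c: "c \<in> unity_roots m" and e: "e \<in> unity_roots m"
  shows "bij_betw ((*) c) (unity_roots m - {e}) (unity_roots m - {c * e})"
  using bij_betw_DiffI[OF bij_betw_unity_roots[OF c], of "{e}" "{c * e}"] e unity_roots_mult[OF c e]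
  by (simp add: bij_betw_def)

lemma power_surj_ball:
  assumes "x \<in> ball (0::complex) (r ^ m)" "r > 0"
  obtains s where "s \<in> ball 0 r" "s ^ m = x"
proof -
  obtain s where s: "s ^ m = x"
  proof (cases "x = 0")
    case True thus ?thesis using m that[of 0] by simp
  next
    case False
    hence "{s. s ^ m = x} \<noteq> {}" using card_nth_roots[OF False m] m by (metis card.empty less_irrefl)
    thus ?thesis using that by blast
  qed
  hence "norm s ^ m < r ^ m" using assms(1) by (simp flip: norm_power)
  hence "norm s < r" using assms(2) power_less_imp_less_base by (metis less_imp_le)
  thus ?thesis using that s by simp
qed

text \<open>Only exponents divisible by \<open>m\<close> survive in the power series of an invariant function.\<close>

lemma invariant_descends:
  assumes f: "f holomorphic_on ball 0 r" and r: "r > 0"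
    and inv: "\<And>s e. s \<in> ball 0 r \<Longrightarrow> e \<in> unity_roots m \<Longrightarrow> f (e * s) = f s"
  obtains c where "c holomorphic_on ball 0 (r ^ m)" "\<And>s. s \<in> ball 0 r \<Longrightarrow> f s = c (s ^ m)"
proof -
  define a where "a n = (deriv ^^ n) f 0 / fact n" for n
  \<comment> \<open>A primitive m-th root of unity. Comparing n-th derivatives of f(e w) = f(w) at 0
    gives (e^n - 1) a n = 0, and the factor vanishes only when m divides n.\<close>
  define e where "e = exp (2 * of_real pi * \<i> * of_nat 1 / of_nat m)"
  have pow: "e ^ n = 1 \<longleftrightarrow> m dvd n" for n
  proof -
    have "e ^ n = exp (2 * of_real pi * \<i> * of_nat n / of_nat m)"
      by (simp add: e_def exp_of_nat_mult[symmetric] mult_ac)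
    thus ?thesis using complex_root_unity_eq_1[of m n] m by simp
  qed
  hence e: "e \<in> unity_roots m" by (simp add: unity_roots_def)
  have a0: "a n = 0" if "\<not> m dvd n" for n
  proof -
    have im: "e * w \<in> ball 0 r" if "w \<in> ball 0 r" for w by (rule unity_roots_ball[OF e that])
    have "(\<lambda>w. f (e * w)) holomorphic_on ball 0 r"
      using holomorphic_on_compose_gen[of "\<lambda>w. e * w" "ball 0 r" f "ball 0 r"] f im
      by (force simp: o_def intro!: holomorphic_intros)
    from higher_deriv_transform_within_open[OF this f open_ball _ inv[OF _ e]] r
    have "(deriv ^^ n) (\<lambda>w. f (e * w)) 0 = (deriv ^^ n) f 0" by simp
    moreover have "(deriv ^^ n) (\<lambda>w. f (e * w)) 0 = e ^ n * (deriv ^^ n) f (e * 0)"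
      by (rule higher_deriv_compose_linear[OF f open_ball[of 0 r] open_ball _ im]) (use r in auto)
    ultimately have "(e ^ n - 1) * (deriv ^^ n) f 0 = 0" by (simp add: algebra_simps)
    thus ?thesis using pow that by (simp add: a_def)
  qed
  define c where "c x = (\<Sum>k. a (m * k) * x ^ k)" for x
  have sums: "(\<lambda>k. a (m * k) * (s ^ m) ^ k) sums f s" if "s \<in> ball 0 r" for s
  proof -
    have "(\<lambda>n. a n * s ^ n) sums f s"
      using holomorphic_power_series[OF f that] by (simp add: a_def)
    moreover have "strict_mono (\<lambda>k. m * k)" using m by (auto simp: strict_mono_def)
    moreover have "a n * s ^ n = 0" if "n \<notin> range (\<lambda>k. m * k)" for n
      using a0[of n] that by (auto elim!: dvdE)
    ultimately have "(\<lambda>k. a (m * k) * s ^ (m * k)) sums f s"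
      using sums_mono_reindex[of "\<lambda>k. m * k" "\<lambda>n. a n * s ^ n"] by blast
    thus ?thesis by (simp add: power_mult)
  qed
  have cs: "f s = c (s ^ m)" if "s \<in> ball 0 r" for s
    using sums_unique[OF sums[OF that]] by (simp add: c_def)
  have "c holomorphic_on ball 0 (r ^ m)"
  proof (rule power_series_holomorphic)
    fix x :: complex assume "x \<in> ball 0 (r ^ m)"
    then obtain s where s: "s \<in> ball 0 r" "s ^ m = x" using power_surj_ball r by blast
    show "(\<lambda>n. a (m * n) * (x - 0) ^ n) sums c x"
      using sums[OF s(1)] cs[OF s(1)] s(2) by simp
  qed
  thus ?thesis using cs that by blast
qed

end

section \<open>Polynomials with holomorphic coefficients\<close>

definition coeffs_holomorphic :: "(complex \<Rightarrow> complex poly) \<Rightarrow> complex set \<Rightarrow> bool" where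
  "coeffs_holomorphic p A \<longleftrightarrow> (\<forall>i. (\<lambda>s. coeff (p s) i) holomorphic_on A)"

lemma coeffs_holomorphic_linear:
  assumes "f holomorphic_on A" shows "coeffs_holomorphic (\<lambda>s. [:- f s, 1:]) A"
  unfolding coeffs_holomorphic_def
proof
  fix i
  have "coeff [:- f s, 1:] i = (if i = 0 then - f s else if i = 1 then 1 else 0)" for s
    by (cases i; cases "i - 1") auto
  thus "(\<lambda>s. coeff [:- f s, 1:] i) holomorphic_on A"
    using assms by (cases "i = 0"; cases "i = 1") (auto intro!: holomorphic_intros)
qed

lemma coeffs_holomorphic_mult:
  "coeffs_holomorphic p A \<Longrightarrow> coeffs_holomorphic q A \<Longrightarrow> coeffs_holomorphic (\<lambda>s. p s * q s) A"
  unfolding coeffs_holomorphic_def coeff_mult by (intro allI holomorphic_intros) auto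

lemma coeffs_holomorphic_prod:
  assumes "\<And>e. e \<in> I \<Longrightarrow> coeffs_holomorphic (p e) A"
  shows "coeffs_holomorphic (\<lambda>s. \<Prod>e\<in>I. p e s) A"
  using assms
proof (induction I rule: infinite_finite_induct)
  case (insert e I)
  thus ?case by (simp add: coeffs_holomorphic_mult)
qed (auto simp: coeffs_holomorphic_def)

lemma coeffs_holomorphic_smult:
  "f holomorphic_on A \<Longrightarrow> coeffs_holomorphic p A \<Longrightarrow> coeffs_holomorphic (\<lambda>s. smult (f s) (p s)) A"
  unfolding coeffs_holomorphic_def by (auto intro!: holomorphic_intros)

lemma coeffs_holomorphic_sum:
  "(\<And>e. e \<in> I \<Longrightarrow> coeffs_holomorphic (p e) A) \<Longrightarrow> coeffs_holomorphic (\<lambda>s. \<Sum>e\<in>I. p e s) A"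
  unfolding coeffs_holomorphic_def coeff_sum by (auto intro!: holomorphic_intros)

lemma invariant_poly_descends:
  assumes "m > 0" "r > 0" and p: "coeffs_holomorphic p (ball 0 r)"
    and inv: "\<And>s e. s \<in> ball 0 r \<Longrightarrow> e \<in> unity_roots m \<Longrightarrow> p (e * s) = p s"
  obtains a where "\<And>i. a i holomorphic_on ball 0 (r ^ m)"
    "\<And>i s. s \<in> ball 0 r \<Longrightarrow> coeff (p s) i = a i (s ^ m)"
proof -
  have "\<forall>i. \<exists>c. c holomorphic_on ball 0 (r ^ m) \<and> (\<forall>s\<in>ball 0 r. coeff (p s) i = c (s ^ m))"
  proof
    fix i
    have "(\<lambda>s. coeff (p s) i) holomorphic_on ball 0 r" using p by (simp add: coeffs_holomorphic_def)
    from invariant_descends[OF assms(1) this assms(2)] inv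
    show "\<exists>c. c holomorphic_on ball 0 (r ^ m) \<and> (\<forall>s\<in>ball 0 r. coeff (p s) i = c (s ^ m))" by metis
  qed
  then obtain a where "\<forall>i. a i holomorphic_on ball 0 (r ^ m) \<and> (\<forall>s\<in>ball 0 r. coeff (p s) i = a i (s ^ m))"
    by metis
  thus ?thesis using that by blast
qed

text \<open>The branch in a parameter s with x = s^m and second coordinate w. The values w(e s), for
  roots of unity e, are its points over x; they are distinct because the parametrization is
  injective.\<close>

locale fibre_function =
  fixes m :: nat and r :: real and w :: "complex \<Rightarrow> complex"
  assumes m_pos: "m > 0" and r_pos: "r > 0" and w_hol: "w holomorphic_on ball 0 r"
    and inj: "\<And>s. s \<in> ball 0 r \<Longrightarrow> s \<noteq> 0 \<Longrightarrow> inj_on (\<lambda>e. w (e * s)) (unity_roots m)"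
begin

text \<open>The Weierstrass polynomial of the branch at x = s^m.\<close>

definition fibre_poly :: "complex \<Rightarrow> complex poly" where
  "fibre_poly s = (\<Prod>e\<in>unity_roots m. [:- w (e * s), 1:])"

lemma hol_twist: "f holomorphic_on ball 0 r \<Longrightarrow> e \<in> unity_roots m \<Longrightarrow> (\<lambda>s. f (e * s)) holomorphic_on ball 0 r"
  using holomorphic_on_compose_gen[of "\<lambda>s. e * s" "ball 0 r" f "ball 0 r"] unity_roots_ball[OF m_pos, of e _ r]
  by (force simp: o_def intro!: holomorphic_intros)

lemma fin [simp]: "finite (unity_roots m)" and card_roots [simp]: "card (unity_roots m) = m"
  using m_pos by auto

lemma degree_fibre_poly: "degree (fibre_poly s) = m" and lead_coeff_fibre_poly: "coeff (fibre_poly s) m = 1"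
proof -
  show d: "degree (fibre_poly s) = m"
    unfolding fibre_poly_def by (subst degree_prod_eq_sum_degree) auto
  have "lead_coeff (fibre_poly s) = 1" unfolding fibre_poly_def lead_coeff_prod by simp
  thus "coeff (fibre_poly s) m = 1" using d by simp
qed

lemma poly_fibre_poly: "poly (fibre_poly s) y = (\<Prod>e\<in>unity_roots m. y - w (e * s))"
  by (simp add: fibre_poly_def poly_prod)

lemma poly_fibre_poly_0: "poly (fibre_poly 0) y = (y - w 0) ^ m"
  by (simp add: poly_fibre_poly)

lemma poly_fibre_poly_root: "poly (fibre_poly s) (w s) = 0"
  unfolding poly_fibre_poly by (rule prod_zero) (auto intro!: bexI[of _ 1])

text \<open>Only the factor with e = 1 vanishes at \<open>w s\<close>, because the points of the
  fibre are distinct. The simple root later gives a gradient that is not identically zero on the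
  branch.\<close>

lemma pderiv_fibre_poly_root:
  assumes "s \<in> ball 0 r" "s \<noteq> 0" shows "poly (pderiv (fibre_poly s)) (w s) \<noteq> 0"
proof -
  let ?q = "\<Prod>e\<in>unity_roots m - {1}. [:- w (e * s), 1:]"
  have "fibre_poly s = [:- w s, 1:] * ?q"
    unfolding fibre_poly_def by (subst prod.remove[of _ 1]) auto
  hence "poly (pderiv (fibre_poly s)) (w s) = poly ?q (w s)"
    by (simp only: pderiv_mult poly_add poly_mult) (simp add: pderiv_pCons)
  also have "\<dots> = (\<Prod>e\<in>unity_roots m - {1}. w s - w (e * s))" by (simp add: poly_prod)
  also have "\<dots> \<noteq> 0"
  proof -
    have "w (1 * s) \<noteq> w (e * s)" if "e \<in> unity_roots m - {1}" for e
      using inj_onD[OF inj[OF assms], of 1 e] that by auto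
    thus ?thesis by simp
  qed
  finally show ?thesis .
qed

lemma fibre_poly_invariant:
  assumes "c \<in> unity_roots m" shows "fibre_poly (c * s) = fibre_poly s"
  unfolding fibre_poly_def
  using prod.reindex_bij_betw[OF bij_betw_unity_roots[OF m_pos assms], of "\<lambda>e. [:- w (e * s), 1:]"]
  by (simp add: mult_ac)

lemma fibre_poly_descends:
  obtains a where "\<And>i. a i holomorphic_on ball 0 (r ^ m)"
    "\<And>i s. s \<in> ball 0 r \<Longrightarrow> coeff (fibre_poly s) i = a i (s ^ m)"
proof -
  have "coeffs_holomorphic fibre_poly (ball 0 r)"
    unfolding fibre_poly_def[abs_def]
    by (intro coeffs_holomorphic_prod coeffs_holomorphic_linear hol_twist w_hol)
  from invariant_poly_descends[OF m_pos r_pos this fibre_poly_invariant] that show ?thesis by blast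
qed

text \<open>Up to sign the discriminant of \<open>fibre_poly\<close>; it is a common denominator for
  interpolation on the fibre.\<close>

definition fibre_disc :: "complex \<Rightarrow> complex" where
  "fibre_disc s = (\<Prod>e\<in>unity_roots m. \<Prod>d\<in>unity_roots m - {e}. w (e * s) - w (d * s))"

lemma fibre_disc_holomorphic: "fibre_disc holomorphic_on ball 0 r"
  unfolding fibre_disc_def[abs_def] by (intro holomorphic_on_prod holomorphic_on_diff hol_twist w_hol) auto

lemma fibre_disc_nonzero:
  assumes s: "s \<in> ball 0 r" "s \<noteq> 0" shows "fibre_disc s \<noteq> 0"
proof -
  have "w (e * s) \<noteq> w (d * s)" if "e \<in> unity_roots m" "d \<in> unity_roots m - {e}" for e d
    using inj_onD[OF inj[OF s], of e d] that by auto
  thus ?thesis by (simp add: fibre_disc_def)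
qed

text \<open>Lagrange interpolation on the fibres, with the denominators cleared.\<close>

lemma interpolation:
  assumes f: "f holomorphic_on ball 0 r"
  obtains c where "\<And>i. c i holomorphic_on ball 0 (r ^ m)"
    "\<And>s. s \<in> ball 0 r \<Longrightarrow> fibre_disc s * f s = (\<Sum>i<m. c i (s ^ m) * w s ^ i)"
proof -
  let ?Z = "unity_roots m"
  \<comment> \<open>\<open>G e\<close> is the Lagrange denominator at the node w(e s),
    \<open>H e\<close> the product of all the other denominators, \<open>L e\<close> the Lagrange
    numerator. Thus q is the interpolation polynomial of f on the fibre multiplied by the
    discriminant.\<close>
  define G where "G e s = (\<Prod>d\<in>?Z - {e}. w (e * s) - w (d * s))" for e s
  define H where "H e s = (\<Prod>e'\<in>?Z - {e}. G e' s)" for e s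
  define L where "L e s = (\<Prod>d\<in>?Z - {e}. [:- w (d * s), 1:])" for e s
  define q where "q s = (\<Sum>e\<in>?Z. smult (f (e * s) * H e s) (L e s))" for s
  have D_def: "fibre_disc s = (\<Prod>e\<in>?Z. G e s)" for s
    by (simp add: fibre_disc_def G_def)
  have Gh: "G e holomorphic_on ball 0 r" if "e \<in> ?Z" for e
    unfolding G_def[abs_def] using that by (intro holomorphic_intros hol_twist w_hol) auto
  have Hh: "H e holomorphic_on ball 0 r" for e
    unfolding H_def[abs_def] using Gh by (intro holomorphic_intros) auto
  have qh: "coeffs_holomorphic q (ball 0 r)"
    unfolding q_def[abs_def] L_def
    by (intro coeffs_holomorphic_sum coeffs_holomorphic_smult coeffs_holomorphic_prod
        coeffs_holomorphic_linear holomorphic_on_mult hol_twist f w_hol Hh) auto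
  \<comment> \<open>Multiplying s by a root of unity permutes the nodes. So q is invariant, and its
    coefficients become functions of s^m.\<close>
  have shift: "G e (c * s) = G (c * e) s" "H e (c * s) = H (c * e) s" "L e (c * s) = L (c * e) s"
    if c: "c \<in> ?Z" and e: "e \<in> ?Z" for c e s
  proof -
    have G: "G e (c * s) = G (c * e) s" if e: "e \<in> ?Z" for e
      unfolding G_def
      using prod.reindex_bij_betw[OF bij_betw_unity_roots_Diff[OF m_pos c e], of "\<lambda>d. w (c * e * s) - w (d * s)"]
      by (simp add: mult_ac)
    show "G e (c * s) = G (c * e) s" by (rule G[OF e])
    have "H e (c * s) = (\<Prod>e'\<in>?Z - {e}. G (c * e') s)"
      unfolding H_def by (intro prod.cong refl G) auto
    also have "\<dots> = H (c * e) s"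
      unfolding H_def by (rule prod.reindex_bij_betw[OF bij_betw_unity_roots_Diff[OF m_pos c e], of "\<lambda>e'. G e' s"])
    finally show "H e (c * s) = H (c * e) s" .
    show "L e (c * s) = L (c * e) s"
      unfolding L_def
      using prod.reindex_bij_betw[OF bij_betw_unity_roots_Diff[OF m_pos c e], of "\<lambda>d. [:- w (d * s), 1:]"]
      by (simp add: mult_ac)
  qed
  have inv: "q (c * s) = q s" if c: "c \<in> ?Z" for c s
  proof -
    have "q (c * s) = (\<Sum>e\<in>?Z. smult (f ((c * e) * s) * H (c * e) s) (L (c * e) s))"
      unfolding q_def by (intro sum.cong refl) (simp add: shift[OF c] mult_ac)
    also have "\<dots> = q s" unfolding q_def
      by (rule sum.reindex_bij_betw[OF bij_betw_unity_roots[OF m_pos c], of "\<lambda>e. smult (f (e * s) * H e s) (L e s)"])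
    finally show ?thesis .
  qed
  obtain c where c: "\<And>i. c i holomorphic_on ball 0 (r ^ m)" "\<And>i s. s \<in> ball 0 r \<Longrightarrow> coeff (q s) i = c i (s ^ m)"
    by (rule invariant_poly_descends[OF m_pos r_pos qh inv]) blast+
  have deg: "degree (q s) < m" for s
  proof -
    have "degree (L e s) \<le> m - 1" if "e \<in> ?Z" for e
    proof -
      have "degree (L e s) = card (?Z - {e})" unfolding L_def by (subst degree_prod_eq_sum_degree) auto
      thus ?thesis using that by (simp add: card_Diff_singleton)
    qed
    hence "degree (q s) \<le> m - 1" unfolding q_def
      by (intro degree_sum_le) (auto intro: order_trans[OF degree_smult_le])
    thus ?thesis using m_pos by simp
  qed
  have Lw: "poly (L e s) (w s) = (if e = 1 then G 1 s else 0)" if "e \<in> ?Z" for e s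
  proof (cases "e = 1")
    case False
    have "poly (L e s) (w s) = (\<Prod>d\<in>?Z - {e}. w s - w (d * s))" by (simp add: L_def poly_prod)
    also have "\<dots> = 0" by (rule prod_zero) (use False in \<open>auto intro!: bexI[of _ 1]\<close>)
    finally show ?thesis using False by simp
  qed (simp add: L_def poly_prod G_def)
  have qw: "poly (q s) (w s) = fibre_disc s * f s" for s
  proof -
    have "poly (q s) (w s) = (\<Sum>e\<in>?Z. f (e * s) * H e s * poly (L e s) (w s))"
      by (simp add: q_def poly_sum)
    also have "\<dots> = (\<Sum>e\<in>?Z. if e = 1 then f s * H 1 s * G 1 s else 0)"
      by (intro sum.cong refl) (simp add: Lw)
    also have "\<dots> = f s * (G 1 s * H 1 s)" by simp
    also have "G 1 s * H 1 s = fibre_disc s" unfolding D_def H_def by (subst (2) prod.remove[of _ 1]) auto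
    finally show ?thesis by simp
  qed
  show ?thesis
  proof (rule that[OF c(1)])
    show "fibre_disc s * f s = (\<Sum>i<m. c i (s ^ m) * w s ^ i)" if s: "s \<in> ball 0 r" for s
    proof -
      have "fibre_disc s * f s = (\<Sum>i\<le>degree (q s). coeff (q s) i * w s ^ i)" by (simp add: poly_altdef flip: qw)
      also have "\<dots> = (\<Sum>i<m. coeff (q s) i * w s ^ i)"
        using deg[of s] by (intro sum.mono_neutral_left) (auto simp: coeff_eq_0)
      finally show ?thesis using c(2)[OF s] by simp
    qed
  qed
qed

text \<open>For fixed x the relation is a polynomial of degree below m that vanishes at the m
  distinct points of the fibre.\<close>

lemma powers_independent:
  assumes z: "\<And>s. s \<in> ball 0 r \<Longrightarrow> s \<noteq> 0 \<Longrightarrow> (\<Sum>i<m. c i (s ^ m) * w s ^ i) = 0"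
    and s: "s \<in> ball 0 r" "s \<noteq> 0" and i: "i < m"
  shows "c i (s ^ m) = 0"
proof -
  define p where "p = (\<Sum>i<m. monom (c i (s ^ m)) i)"
  have co: "coeff p j = (if j < m then c j (s ^ m) else 0)" for j
    by (simp add: p_def coeff_sum)
  have "p = 0"
  proof (rule ccontr)
    assume "p \<noteq> 0"
    have "w (e * s) \<in> {y. poly p y = 0}" if e: "e \<in> unity_roots m" for e
    proof -
      have "(e * s) ^ m = s ^ m" using e by (simp add: unity_roots_def power_mult_distrib)
      moreover have "e * s \<in> ball 0 r" "e * s \<noteq> 0"
        using unity_roots_ball[OF m_pos e s(1)] unity_roots_nonzero[OF m_pos e] s by auto
      ultimately show ?thesis using z[of "e * s"] by (simp add: p_def poly_sum poly_monom)
    qed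
    hence "card ((\<lambda>e. w (e * s)) ` unity_roots m) \<le> card {y. poly p y = 0}"
      by (intro card_mono poly_roots_finite \<open>p \<noteq> 0\<close>) auto
    also have "\<dots> \<le> degree p" by (rule card_poly_roots_bound[OF \<open>p \<noteq> 0\<close>])
    also have "degree p < m"
      using m_pos by (intro degree_lessI) (auto simp: co \<open>p \<noteq> 0\<close>)
    finally show False using card_image[OF inj[OF s]] by simp
  qed
  thus ?thesis using co[of i] i by simp
qed

end

text \<open>Roots are removed one at a time, each difference quotient having a removable
  singularity. The roots in Z are distinct, so the quotient still vanishes at the remaining
  ones.\<close>

lemma holomorphic_divide_by_roots:
  assumes "finite Z" "open S" "Z \<subseteq> S" "f holomorphic_on S" "\<And>z. z \<in> Z \<Longrightarrow> f z = (0::complex)"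
  obtains g where "g holomorphic_on S" "\<And>y. y \<in> S \<Longrightarrow> f y = (\<Prod>z\<in>Z. y - z) * g y"
proof -
  have "\<exists>g. g holomorphic_on S \<and> (\<forall>y\<in>S. f y = (\<Prod>z\<in>Z. y - z) * g y)"
    using assms(1,3,4,5)
  proof (induction Z arbitrary: f rule: finite_induct)
    case (insert a Z)
    define h where "h = (\<lambda>z. if z = a then deriv f a else (f z - f a) / (z - a))"
    have h: "h holomorphic_on S" unfolding h_def by (rule pole_lemma_open[OF insert.prems(2) assms(2)])
    have fh: "f z = (z - a) * h z" for z using insert.prems(3)[of a] by (simp add: h_def)
    have "h z = 0" if "z \<in> Z" for z using fh[of z] insert.prems(3)[of z] insert.hyps that by auto
    with insert.IH[OF _ h] insert.prems(1) obtain g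
      where g: "g holomorphic_on S" "\<forall>y\<in>S. h y = (\<Prod>z\<in>Z. y - z) * g y" by auto
    thus ?case using insert.hyps fh by (intro exI[of _ g]) (simp add: mult.assoc)
  qed auto
  thus ?thesis using that by blast
qed

section \<open>Changes of parameter and extension across a line\<close>

lemma analytic_germ_compose:
  assumes "f analytic_on {0}" "g analytic_on {0}" "f 0 = 0"
  shows "(\<lambda>t. g (f t)) analytic_on {0::complex}"
  using analytic_on_compose[of f "{0}" g] assms by (simp add: o_def)

lemma analytic_germ_filterlim:
  assumes "f analytic_on {0::complex}" "f 0 = (0::complex)" shows "filterlim f (nhds 0) (nhds 0)"
proof -
  have "isCont f 0" using assms(1) analytic_at_imp_isCont by auto
  hence "(f \<longlongrightarrow> f 0) (nhds 0)" by (simp add: continuous_at tendsto_at_iff_tendsto_nhds)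
  thus ?thesis using assms(2) by simp
qed

lemma germ_eq_compose:
  assumes "germ_eq g h" "f analytic_on {0}" "f 0 = 0" shows "germ_eq (\<lambda>t. g (f t)) (\<lambda>t. h (f t))"
  using eventually_compose_filterlim[OF assms(1)[unfolded germ_eq_def] analytic_germ_filterlim[OF assms(2,3)]]
  by (simp add: germ_eq_def)

text \<open>For fixed y, continuity in x extends the identity to x = a. It serves for identities
  known only after dividing by a power of x or only on fibres with distinct points.\<close>

lemma hol_germs_eq_off_axis:
  assumes f: "f \<in> hol_germs (a, b)" and g: "g \<in> hol_germs (a, b)"
    and eq: "\<forall>\<^sub>F z in nhds (a, b). fst z \<noteq> a \<longrightarrow> f z = g z"
  shows "\<forall>\<^sub>F z in nhds (a, b). f z = g z"
proof -
  have "(\<lambda>z. f z - g z) \<in> hol_germs (a, b)" by (intro hol_germs_diff f g)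
  then obtain r where r: "r > 0" "holomorphic2_on (\<lambda>z. f z - g z) (ball a r \<times> ball b r)"
    by (rule hol_germs_polydisc)
  from eq obtain U where U: "open U" "(a, b) \<in> U" "\<And>z. z \<in> U \<Longrightarrow> fst z \<noteq> a \<Longrightarrow> f z = g z"
    unfolding eventually_nhds by blast
  obtain r' where r': "r' > 0" "cball a r' \<times> cball b r' \<subseteq> U" by (rule open_contains_polydisc[OF U(1,2)])
  define e where "e = min r r'"
  have e: "e > 0" using r r' by (simp add: e_def)
  have "f (x, y) = g (x, y)" if x: "x \<in> ball a e" and y: "y \<in> ball b e" for x y
  proof (cases "x = a")
    case False
    have "(x, y) \<in> U" by (rule subsetD[OF r'(2)]) (use x y in \<open>auto simp: e_def\<close>)
    thus ?thesis using U(3) False by simp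
  next
    case True
    have "(a, y) \<in> ball a r \<times> ball b r" using y e by (auto simp: e_def)
    from holomorphic2_on_partials(2)[OF r(2) this]
    have "isCont (\<lambda>s. f (s, y) - g (s, y)) a" by (simp add: DERIV_isCont)
    hence l1: "((\<lambda>s. f (s, y) - g (s, y)) \<longlongrightarrow> f (a, y) - g (a, y)) (at a)" by (simp add: isCont_def)
    have "\<forall>\<^sub>F s in at a. f (s, y) - g (s, y) = 0"
      unfolding eventually_at
    proof (intro exI conjI ballI impI)
      fix s assume s: "s \<noteq> a \<and> dist s a < e"
      hence "(s, y) \<in> U" using y by (intro subsetD[OF r'(2)]) (auto simp: e_def dist_commute)
      thus "f (s, y) - g (s, y) = 0" using U(3) s by simp
    qed (use e in auto)
    hence l2: "((\<lambda>s. f (s, y) - g (s, y)) \<longlongrightarrow> 0) (at a)" by (rule tendsto_eventually)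
    have "f (a, y) - g (a, y) = 0" by (rule tendsto_unique[OF _ l1 l2]) simp
    thus ?thesis using True by simp
  qed
  thus ?thesis unfolding eventually_nhds
    by (intro exI[of _ "ball a e \<times> ball b e"]) (use e in \<open>auto simp: open_Times\<close>)
qed

lemma hol_germs_cancel_fst_power:
  assumes f: "f \<in> hol_germs (0, b)" and g: "g \<in> hol_germs (0, b)" and "k \<le> n"
    and eq: "\<forall>\<^sub>F z in nhds (0, b). fst z ^ k * f z = fst z ^ n * g z"
  shows "\<forall>\<^sub>F z in nhds (0, b). f z = fst z ^ (n - k) * g z"
proof (rule hol_germs_eq_off_axis[OF f])
  show "(\<lambda>z. fst z ^ (n - k) * g z) \<in> hol_germs (0, b)" by (intro hol_germs_intros g)
  show "\<forall>\<^sub>F z in nhds (0, b). fst z \<noteq> 0 \<longrightarrow> f z = fst z ^ (n - k) * g z"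
    using eq
  proof eventually_elim
    case (elim z)
    have "fst z ^ n = fst z ^ k * fst z ^ (n - k)" using \<open>k \<le> n\<close> by (simp flip: power_add)
    with elim show ?case by auto
  qed
qed

lemma holomorphic2_on_divide:
  assumes W: "open W" and f: "holomorphic2_on f W" and g: "holomorphic2_on g W" and nz: "\<And>z. z \<in> W \<Longrightarrow> g z \<noteq> 0"
  shows "holomorphic2_on (\<lambda>z. f z / g z) W"
proof (rule holomorphic2_onI[OF W])
  show "continuous_on W (\<lambda>z. f z / g z)"
    by (intro continuous_on_divide holomorphic2_on_imp_continuous_on f g) (use nz in auto)
  fix x y assume xy: "(x, y) \<in> W"
  note d = holomorphic2_on_partials(2,3)[OF f xy] holomorphic2_on_partials(2,3)[OF g xy]
  show "(\<lambda>s. f (s, y) / g (s, y)) field_differentiable at x"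
    using d(1,3) nz[OF xy] by (intro field_differentiable_divide) (auto simp: field_differentiable_def)
  show "(\<lambda>s. f (x, s) / g (x, s)) field_differentiable at y"
    using d(2,4) nz[OF xy] by (intro field_differentiable_divide) (auto simp: field_differentiable_def)
qed

definition monic_germ :: "nat \<Rightarrow> (nat \<Rightarrow> complex \<Rightarrow> complex) \<Rightarrow> cfun2" where
  "monic_germ m a z = (\<Sum>i<m. a i (fst z) * snd z ^ i) + snd z ^ m"

lemma monic_germ_hol:
  assumes "\<And>i. a i analytic_on {fst p}" shows "monic_germ m a \<in> hol_germs p"
  unfolding monic_germ_def[abs_def] by (intro hol_germs_intros hol_germs_analytic_fst assms)

context fibre_function
begin

lemma monic_germ_eq_fibre_poly:
  assumes "\<And>i. coeff (fibre_poly s) i = a i (s ^ m)"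
  shows "monic_germ m a (s ^ m, y) = poly (fibre_poly s) y"
proof -
  have "poly (fibre_poly s) y = (\<Sum>i\<le>m. coeff (fibre_poly s) i * y ^ i)"
    by (simp add: poly_altdef degree_fibre_poly)
  also have "\<dots> = (\<Sum>i<m. coeff (fibre_poly s) i * y ^ i) + y ^ m"
    by (simp add: lead_coeff_fibre_poly flip: lessThan_Suc_atMost)
  finally show ?thesis by (simp add: monic_germ_def assms)
qed

text \<open>
  On a fibre \<open>x \<noteq> 0\<close> the polynomial has \<open>m\<close> distinct roots, at which \<open>f\<close> vanishes; the quotient
  is given by a Cauchy integral over a circle that stays away from the roots also for \<open>x = 0\<close>.
\<close>

lemma kernel_divisible:
  assumes ah: "\<And>i. a i holomorphic_on ball 0 (r ^ m)"
    and ac: "\<And>i s. s \<in> ball 0 r \<Longrightarrow> coeff (fibre_poly s) i = a i (s ^ m)"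
    and f: "f \<in> hol_germs (0, w 0)" and z: "germ_eq (\<lambda>s. f (s ^ m, w s)) (\<lambda>_. 0)"
  shows "\<exists>u\<in>hol_germs (0, w 0). \<forall>\<^sub>F z in nhds (0, w 0). f z = u z * monic_germ m a z"
proof -
  obtain \<rho> where \<rho>: "\<rho> > 0" "holomorphic2_on f (ball 0 \<rho> \<times> ball (w 0) \<rho>)" using f hol_germs_polydisc by blast
  define R where "R = \<rho> / 2"
  have R: "R > 0" "R < \<rho>" using \<rho> by (auto simp: R_def)
  obtain d1 where d1: "d1 > 0" "\<And>s. dist s 0 < d1 \<Longrightarrow> f (s ^ m, w s) = 0"
    using z unfolding germ_eq_def eventually_nhds_metric by blast
  have "isCont w 0" using w_hol r_pos holomorphic_on_imp_differentiable_at[OF w_hol open_ball, of 0]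
    field_differentiable_imp_continuous_at by simp
  then obtain d2 where d2: "d2 > 0" "\<And>s. dist s 0 < d2 \<Longrightarrow> dist (w s) (w 0) < R"
    using R(1) unfolding continuous_at_eps_delta by blast
  \<comment> \<open>Small enough that f vanishes on the branch for these s and that the fibres stay
    within distance R of \<open>w 0\<close>. The bound 1 gives \<epsilon>^m \<le> \<epsilon>, and so
    \<epsilon>^m \<le> \<rho>.\<close>
  define \<epsilon> where "\<epsilon> = Min {r, d1, d2, 1, \<rho>}"
  have \<epsilon>: "\<epsilon> > 0" "\<epsilon> \<le> r" "\<epsilon> \<le> d1" "\<epsilon> \<le> d2" "\<epsilon> \<le> 1" "\<epsilon> \<le> \<rho>"
    using r_pos d1 d2 \<rho> by (auto simp: \<epsilon>_def)
  have em: "\<epsilon> ^ m \<le> r ^ m" "\<epsilon> ^ m \<le> \<rho>" "\<epsilon> ^ m > 0"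
  proof -
    show "\<epsilon> ^ m \<le> r ^ m" using \<epsilon> by (intro power_mono) auto
    have "\<epsilon> ^ m \<le> \<epsilon> ^ 1" using \<epsilon> m_pos by (intro power_decreasing) auto
    thus "\<epsilon> ^ m \<le> \<rho>" using \<epsilon> by simp
  qed (use \<epsilon> in simp)
  let ?A = "ball 0 (\<epsilon> ^ m) :: complex set" and ?B = "ball (w 0) \<rho>" and ?P = "monic_germ m a"
  have P: "holomorphic2_on ?P (?A \<times> ?B)"
  proof (rule holomorphic2_onI)
    have ah': "a i holomorphic_on ?A" for i by (rule holomorphic_on_subset[OF ah]) (use em in auto)
    have "continuous_on (?A \<times> ?B) (\<lambda>z. a i (fst z))" for i
      by (rule continuous_on_compose2[OF holomorphic_on_imp_continuous_on[OF ah']]) (auto intro!: continuous_intros)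
    thus "continuous_on (?A \<times> ?B) ?P" unfolding monic_germ_def[abs_def]
      by (intro continuous_intros)
    fix x y assume "(x, y) \<in> ?A \<times> ?B"
    hence "a i field_differentiable at x" for i
      using ah' holomorphic_on_imp_differentiable_at by blast
    thus "(\<lambda>s. ?P (s, y)) field_differentiable at x" unfolding monic_germ_def fst_conv snd_conv
      by (intro field_differentiable_add field_differentiable_sum field_differentiable_mult field_differentiable_const)
    show "(\<lambda>s. ?P (x, s)) field_differentiable at y" unfolding monic_germ_def fst_conv snd_conv
      by (intro field_differentiable_add field_differentiable_sum field_differentiable_mult field_differentiable_const
          field_differentiable_power field_differentiable_ident)
  qed (simp add: open_Times)
  have fib: "\<exists>s\<in>ball 0 \<epsilon>. s ^ m = x \<and> (\<forall>y. ?P (x, y) = (\<Prod>e\<in>unity_roots m. y - w (e * s))) \<and>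
      (\<forall>e\<in>unity_roots m. e * s \<in> ball 0 \<epsilon> \<and> (e * s) ^ m = x \<and> w (e * s) \<in> ball (w 0) R)" if xA: "x \<in> ?A" for x
  proof -
    obtain s where s: "s \<in> ball 0 \<epsilon>" "s ^ m = x" by (rule power_surj_ball[OF m_pos xA \<epsilon>(1)])
    have "s \<in> ball 0 r" using s \<epsilon> by auto
    from monic_germ_eq_fibre_poly[of s a, OF ac[OF this]] have "?P (x, y) = (\<Prod>e\<in>unity_roots m. y - w (e * s))" for y
      by (simp add: s poly_fibre_poly)
    moreover have "e * s \<in> ball 0 \<epsilon>" if "e \<in> unity_roots m" for e by (rule unity_roots_ball[OF m_pos that s(1)])
    moreover have "(e * s) ^ m = x" if "e \<in> unity_roots m" for e
      using that s by (simp add: unity_roots_def power_mult_distrib)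
    moreover have "w (e * s) \<in> ball (w 0) R" if "e \<in> unity_roots m" for e
      using unity_roots_ball[OF m_pos that s(1)] d2(2)[of "e * s"] \<epsilon> by (auto simp: dist_commute)
    ultimately show ?thesis using s by blast
  qed
  define W where "W = {z \<in> ?A \<times> ?B. ?P z \<noteq> 0}"
  have openW: "open W"
  proof -
    have "W = (?A \<times> ?B) \<inter> ?P -` (- {0})" by (auto simp: W_def)
    moreover have "open ((?A \<times> ?B) \<inter> ?P -` (- {0}))"
      by (rule continuous_open_preimage[OF holomorphic2_on_imp_continuous_on[OF P]]) (auto intro: open_Times)
    ultimately show ?thesis by simp
  qed
  \<comment> \<open>All zeros of the polynomial over x lie strictly inside the circle of radius R,
    also for x = 0 where they coincide.\<close>
  have sphW: "?A \<times> sphere (w 0) R \<subseteq> W"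
  proof
    fix z assume "z \<in> ?A \<times> sphere (w 0) R"
    then obtain x y where xy: "z = (x, y)" "x \<in> ?A" "y \<in> sphere (w 0) R" by blast
    from fib[OF xy(2)] obtain s where s: "\<And>y. ?P (x, y) = (\<Prod>e\<in>unity_roots m. y - w (e * s))"
      "\<And>e. e \<in> unity_roots m \<Longrightarrow> w (e * s) \<in> ball (w 0) R" by blast
    have "y \<noteq> w (e * s)" if "e \<in> unity_roots m" for e using s(2)[OF that] xy by auto
    hence "?P (x, y) \<noteq> 0" by (simp add: s(1))
    moreover have "y \<in> ?B" using xy R by auto
    ultimately show "z \<in> W" using xy by (simp add: W_def)
  qed
  define G where "G = (\<lambda>z. f z / ?P z)"
  have G: "holomorphic2_on G W" unfolding G_def
  proof (rule holomorphic2_on_divide[OF openW])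
    show "holomorphic2_on f W" by (rule holomorphic2_on_subset[OF \<rho>(2)]) (use em in \<open>auto simp: W_def\<close>)
    show "holomorphic2_on ?P W" by (rule holomorphic2_on_subset[OF P]) (auto simp: W_def)
  qed (auto simp: W_def)
  let ?k = "1 / (2 * complex_of_real pi * \<i>)"
  \<comment> \<open>On a fibre with distinct points this Cauchy integral, normalised in u, returns
    the quotient of f by the polynomial; over x = 0 it defines the candidate for the
    quotient.\<close>
  define C where "C = (\<lambda>(x, y). contour_integral (circlepath (w 0) R) (\<lambda>v. G (x, v) / (v - y) ^ 1))"
  define u where "u z = ?k * C z" for z
  have C: "holomorphic2_on C (?A \<times> ball (w 0) R)" unfolding C_def
    by (rule holomorphic2_on_circle_integral[OF open_ball R(1) openW sphW G])
  define e0 where "e0 = min (\<epsilon> ^ m) R"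
  have e0: "e0 > 0" using em R by (simp add: e0_def)
  have "C \<in> hol_germs (0, w 0)"
    by (rule hol_germsI_polydisc[OF e0 holomorphic2_on_subset[OF C]]) (auto simp: e0_def)
  hence u: "u \<in> hol_germs (0, w 0)" unfolding u_def by (intro hol_germs_intros)
  have eq: "f (x, y) = u (x, y) * ?P (x, y)" if x: "x \<in> ?A" "x \<noteq> 0" and y: "y \<in> ball (w 0) R" for x y
  proof -
    from fib[OF x(1)] obtain s where s: "s \<in> ball 0 \<epsilon>" "s ^ m = x" "\<And>y. ?P (x, y) = (\<Prod>e\<in>unity_roots m. y - w (e * s))"
      "\<And>e. e \<in> unity_roots m \<Longrightarrow> e * s \<in> ball 0 \<epsilon> \<and> (e * s) ^ m = x \<and> w (e * s) \<in> ball (w 0) R" by blast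
    define Z where "Z = (\<lambda>e. w (e * s)) ` unity_roots m"
    have s0: "s \<noteq> 0" "s \<in> ball 0 r" using x s m_pos \<epsilon> by (auto simp: power_0_left)
    have PZ: "?P (x, y) = (\<Prod>z\<in>Z. y - z)" for y
      unfolding Z_def s(3) by (subst prod.reindex[OF inj[OF s0(2,1)]]) simp
    have xr: "x \<in> ball 0 \<rho>" using x em by auto
    have fx: "(\<lambda>v. f (x, v)) holomorphic_on ?B" unfolding holomorphic_on_def
    proof
      fix v assume "v \<in> ?B"
      hence "(x, v) \<in> ball 0 \<rho> \<times> ?B" using xr by auto
      from holomorphic2_on_partials(3)[OF \<rho>(2) this]
      show "(\<lambda>v. f (x, v)) field_differentiable at v within ?B"
        by (auto simp: field_differentiable_def intro: has_field_derivative_at_within)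
    qed
    have "ball (w 0) R \<subseteq> ?B" using R by auto
    hence ZB: "finite Z" "Z \<subseteq> ?B" using s(4) unfolding Z_def by (simp, blast)
    have "f (x, z) = 0" if "z \<in> Z" for z
    proof -
      from that obtain e where e: "e \<in> unity_roots m" "z = w (e * s)" by (auto simp: Z_def)
      have "dist (e * s) 0 < d1" using s(4)[OF e(1)] \<epsilon> by (auto simp: dist_commute)
      from d1(2)[OF this] show ?thesis using s(4)[OF e(1)] e by simp
    qed
    from holomorphic_divide_by_roots[OF ZB(1) open_ball ZB(2) fx this]
    obtain g where g: "g holomorphic_on ?B" "\<And>y. y \<in> ?B \<Longrightarrow> f (x, y) = (\<Prod>z\<in>Z. y - z) * g y" by blast
    have gc: "g holomorphic_on cball (w 0) R" by (rule holomorphic_on_subset[OF g(1)]) (use R in auto)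
    have "((\<lambda>v. g v / (v - y)) has_contour_integral (2 * of_real pi * \<i> * g y)) (circlepath (w 0) R)"
      by (rule Cauchy_integral_circlepath[OF holomorphic_on_imp_continuous_on[OF gc]
            holomorphic_on_subset[OF gc ball_subset_cball]]) (use y in \<open>simp add: dist_norm norm_minus_commute\<close>)
    moreover have "g v / (v - y) = G (x, v) / (v - y) ^ 1" if "v \<in> path_image (circlepath (w 0) R)" for v
    proof -
      have v: "v \<in> sphere (w 0) R" using that R by simp
      hence "(x, v) \<in> W" using x by (intro subsetD[OF sphW]) auto
      hence "?P (x, v) \<noteq> 0" by (simp add: W_def)
      moreover have "v \<in> ?B" using v R by auto
      ultimately show ?thesis using g(2)[of v] by (simp add: G_def PZ)
    qed
    ultimately have "((\<lambda>v. G (x, v) / (v - y) ^ 1) has_contour_integral (2 * of_real pi * \<i> * g y)) (circlepath (w 0) R)"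
      by (rule has_contour_integral_eq)
    from contour_integral_unique[OF this] have "u (x, y) = g y" by (simp add: u_def C_def)
    moreover have "y \<in> ?B" using y R by auto
    ultimately show ?thesis using g(2)[of y] by (simp add: PZ)
  qed
  have Pg: "?P \<in> hol_germs (0, w 0)"
    by (rule hol_germsI_polydisc[OF e0 holomorphic2_on_subset[OF P]]) (use R in \<open>auto simp: e0_def\<close>)
  have "\<forall>\<^sub>F z in nhds (0, w 0). f z = u z * ?P z"
  proof (rule hol_germs_eq_off_axis[OF f hol_germs_mult[OF u Pg]])
    show "\<forall>\<^sub>F z in nhds (0, w 0). fst z \<noteq> 0 \<longrightarrow> f z = u z * ?P z"
      unfolding eventually_nhds
      by (rule exI[of _ "?A \<times> ball (w 0) R"]) (use eq em R in \<open>auto simp: open_Times\<close>)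
  qed
  thus ?thesis using u by blast
qed

lemma fibre_function_mono: "0 < r' \<Longrightarrow> r' \<le> r \<Longrightarrow> fibre_function m r' w"
  using m_pos inj by unfold_locales (auto intro: holomorphic_on_subset[OF w_hol])

end

text \<open>The unit in x = t^m u has an analytic m-th root, and t times this root has nonzero
  derivative at 0. It is therefore a new local parameter whose m-th power is x.\<close>

lemma uniformizer:
  assumes x: "has_order x m" and m: "m > 0"
  obtains \<tau> \<rho> where "\<tau> analytic_on {0}" "\<rho> analytic_on {0}" "\<tau> 0 = 0" "\<rho> 0 = 0"
    "germ_eq x (\<lambda>t. \<tau> t ^ m)" "germ_eq (\<lambda>t. \<rho> (\<tau> t)) (\<lambda>t. t)" "germ_eq (\<lambda>s. \<tau> (\<rho> s)) (\<lambda>s. s)"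
proof -
  from x obtain u where u: "u analytic_on {0}" "u 0 \<noteq> 0" "germ_eq x (\<lambda>t. t ^ m * u t)"
    unfolding has_order_def by blast
  have "card {z. z ^ m = u 0} = m" by (rule card_nth_roots[OF u(2) m])
  hence "{z. z ^ m = u 0} \<noteq> {}" using m by force
  then obtain c where c: "c ^ m = u 0" by blast
  hence c0: "c \<noteq> 0" using u(2) m by (auto simp: power_0_left)
  \<comment> \<open>The quotient u t / u 0 is close to 1, where the logarithm is analytic; c
    restores the m-th root of u 0.\<close>
  define g where "g t = c * exp (ln (u t / u 0) / of_nat m)" for t
  define \<tau> where "\<tau> t = t * g t" for t
  have ln: "(\<lambda>t. ln (u t / u 0)) analytic_on {0}"
    by (rule analytic_on_ln) (use u in \<open>auto intro!: analytic_intros\<close>)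
  have g: "g analytic_on {0}" unfolding g_def by (intro analytic_intros ln) (use m in auto)
  have g0: "g 0 = c" using u(2) by (simp add: g_def)
  have gm: "g t ^ m = u t" if "u t \<noteq> 0" for t
  proof -
    have "exp (ln (u t / u 0) / of_nat m) ^ m = exp (of_nat m * (ln (u t / u 0) / of_nat m))"
      by (rule exp_of_nat_mult[symmetric])
    also have "\<dots> = u t / u 0" using m that u(2) by simp
    finally show ?thesis using u(2) by (simp add: g_def power_mult_distrib c)
  qed
  have \<tau>: "\<tau> analytic_on {0}" unfolding \<tau>_def by (intro analytic_intros g)
  have x\<tau>: "germ_eq x (\<lambda>t. \<tau> t ^ m)"
    using u(3) analytic_nonzero_near[OF u(1,2)] unfolding germ_eq_def
    by eventually_elim (simp add: \<tau>_def power_mult_distrib gm)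
  from \<tau> obtain S where S: "open S" "0 \<in> S" "\<tau> holomorphic_on S" unfolding analytic_at by blast
  have "deriv \<tau> 0 = c"
  proof -
    have "g field_differentiable at 0" using g analytic_on_imp_differentiable_at by blast
    hence "(g has_field_derivative deriv g 0) (at 0)" by (rule field_differentiable_derivI)
    hence "((\<lambda>t. t * g t) has_field_derivative c) (at 0)"
      by (auto intro!: derivative_eq_intros simp: g0)
    thus ?thesis unfolding \<tau>_def by (rule DERIV_imp_deriv)
  qed
  hence "deriv \<tau> 0 \<noteq> 0" using c0 by simp
  then obtain e where e: "e > 0" "ball 0 e \<subseteq> S" "open (\<tau> ` ball 0 e)" "inj_on \<tau> (ball 0 e)"
    by (rule has_complex_derivative_locally_invertible[OF S(3,2,1)])
  obtain \<rho> where \<rho>: "\<rho> holomorphic_on (\<tau> ` ball 0 e)" "\<And>z. z \<in> ball 0 e \<Longrightarrow> deriv \<tau> z * deriv \<rho> (\<tau> z) = 1"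
    "\<And>z. z \<in> ball 0 e \<Longrightarrow> \<rho> (\<tau> z) = z"
    by (rule holomorphic_has_inverse[OF holomorphic_on_subset[OF S(3) e(2)] open_ball e(4)], rule that)
  have \<tau>0: "\<tau> 0 = 0" by (simp add: \<tau>_def)
  have im: "0 \<in> \<tau> ` ball 0 e" by (rule image_eqI[of _ _ 0]) (use \<tau>0 e(1) in auto)
  have "\<rho> 0 = 0" using \<rho>(3)[of 0] \<tau>0 e(1) by simp
  moreover have "\<rho> analytic_on {0}" using im e(3) \<rho>(1) unfolding analytic_at by blast
  moreover have "germ_eq (\<lambda>t. \<rho> (\<tau> t)) (\<lambda>t. t)" unfolding germ_eq_def eventually_nhds
    by (intro exI[of _ "ball 0 e"] conjI open_ball ballI \<rho>(3)) (use e(1) in simp_all)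
  moreover have "germ_eq (\<lambda>s. \<tau> (\<rho> s)) (\<lambda>s. s)" unfolding germ_eq_def eventually_nhds
  proof (intro exI[of _ "\<tau> ` ball 0 e"] conjI e(3) im ballI)
    fix s assume "s \<in> \<tau> ` ball 0 e"
    then obtain t where "t \<in> ball 0 e" "s = \<tau> t" by blast
    thus "\<tau> (\<rho> s) = s" using \<rho>(3) by simp
  qed
  ultimately show ?thesis using that \<tau> \<tau>0 x\<tau> by blast
qed

lemma holomorphic_ball_analytic: "f holomorphic_on ball 0 r \<Longrightarrow> r > 0 \<Longrightarrow> f analytic_on {0::complex}"
  by (auto simp: analytic_on_def)

text \<open>All of this is read off from the fibres in the parameter s = \<tau> t and carried back
  to t. In the last claim N does not depend on f: the span of the powers of w contains every
  multiple of x^N.\<close>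

theorem branch_weierstrass:
  assumes x: "has_order x m" and m: "m > 0" and w: "w analytic_on {0}"
    and U: "open U" "0 \<in> U" "inj_on (\<lambda>t. (x t, w t)) U"
  obtains a where "\<And>i. a i analytic_on {0}"
    "germ_eq (\<lambda>t. monic_germ m a (x t, w t)) (\<lambda>_. 0)"
    "\<And>f. f \<in> hol_germs (0, w 0) \<Longrightarrow> germ_eq (\<lambda>t. f (x t, w t)) (\<lambda>_. 0) \<Longrightarrow> germ_dvd (0, w 0) (monic_germ m a) f"
    "\<not> germ_eq (\<lambda>t. partial_y (monic_germ m a) (x t, w t)) (\<lambda>_. 0)"
    "\<And>y. monic_germ m a (0, y) = (y - w 0) ^ m"
    "\<And>c i. \<forall>i<m. c i analytic_on {0} \<Longrightarrow> germ_eq (\<lambda>t. \<Sum>i<m. c i (x t) * w t ^ i) (\<lambda>_. 0) \<Longrightarrow>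
        i < m \<Longrightarrow> germ_eq (c i) (\<lambda>_. 0)"
    "\<exists>N. \<forall>f. f analytic_on {0} \<longrightarrow> (\<exists>c. (\<forall>i. c i analytic_on {0}) \<and>
        germ_eq (\<lambda>t. x t ^ N * f t) (\<lambda>t. \<Sum>i<m. c i (x t) * w t ^ i))"
proof -
  obtain \<tau> \<rho> where \<tau>: "\<tau> analytic_on {0}" "\<tau> 0 = 0" and \<rho>: "\<rho> analytic_on {0}" "\<rho> 0 = 0"
    and x\<tau>: "germ_eq x (\<lambda>t. \<tau> t ^ m)" and \<rho>\<tau>: "germ_eq (\<lambda>t. \<rho> (\<tau> t)) (\<lambda>t. t)" and \<tau>\<rho>: "germ_eq (\<lambda>s. \<tau> (\<rho> s)) (\<lambda>s. s)"
    by (rule uniformizer[OF x m], rule that)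
  define v where "v = (\<lambda>s. w (\<rho> s))"
  have v: "v analytic_on {0}" unfolding v_def by (rule analytic_germ_compose[OF \<rho>(1) w \<rho>(2)])
  have v0: "v 0 = w 0" by (simp add: v_def \<rho>)
  have "\<forall>\<^sub>F s in nhds 0. \<rho> s \<in> U"
    using eventually_compose_filterlim[OF eventually_nhds_in_open[OF U(1,2)] analytic_germ_filterlim[OF \<rho>]] .
  moreover have "\<forall>\<^sub>F s in nhds 0. x (\<rho> s) = \<tau> (\<rho> s) ^ m"
    using germ_eq_compose[OF x\<tau> \<rho>] by (simp add: germ_eq_def)
  moreover have "\<forall>\<^sub>F s in nhds 0. \<tau> (\<rho> s) = s" using \<tau>\<rho> by (simp add: germ_eq_def)
  ultimately have ev_s: "\<forall>\<^sub>F s in nhds 0. \<rho> s \<in> U \<and> x (\<rho> s) = s ^ m \<and> \<tau> (\<rho> s) = s"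
    by eventually_elim simp
  then obtain r1 where r1: "r1 > 0" "\<And>s. dist s 0 < r1 \<Longrightarrow> \<rho> s \<in> U \<and> x (\<rho> s) = s ^ m \<and> \<tau> (\<rho> s) = s"
    unfolding eventually_nhds_metric by blast
  from v obtain r2 where r2: "r2 > 0" "v holomorphic_on ball 0 r2" by (auto simp: analytic_on_def)
  define r where "r = min r1 r2"
  have r: "r > 0" using r1 r2 by (simp add: r_def)
  interpret F: fibre_function m r v
  proof
    show "v holomorphic_on ball 0 r" by (rule holomorphic_on_subset[OF r2(2)]) (auto simp: r_def)
    fix s :: complex assume s: "s \<in> ball 0 r" "s \<noteq> 0"
    show "inj_on (\<lambda>e. v (e * s)) (unity_roots m)"
    proof (rule inj_onI)
      fix e d assume ed: "e \<in> unity_roots m" "d \<in> unity_roots m" "v (e * s) = v (d * s)"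
      have b: "dist (c * s) 0 < r1" if "c \<in> unity_roots m" for c
        using unity_roots_ball[OF m that s(1)] by (simp add: r_def)
      have "(c * s) ^ m = s ^ m" if "c \<in> unity_roots m" for c
        using that by (simp add: unity_roots_def power_mult_distrib)
      \<comment> \<open>The points with parameters c s share their first coordinate, so injectivity
        of (x, w) separates their second coordinates.\<close>
      hence "x (\<rho> (c * s)) = s ^ m" if "c \<in> unity_roots m" for c using r1(2)[OF b[OF that]] that by simp
      hence "(x (\<rho> (e * s)), w (\<rho> (e * s))) = (x (\<rho> (d * s)), w (\<rho> (d * s)))"
        using ed by (simp add: v_def)
      hence "\<rho> (e * s) = \<rho> (d * s)"
        using inj_onD[OF U(3)] r1(2)[OF b[OF ed(1)]] r1(2)[OF b[OF ed(2)]] by blast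
      hence "e * s = d * s" using r1(2)[OF b[OF ed(1)]] r1(2)[OF b[OF ed(2)]] by metis
      thus "e = d" using s by simp
    qed
  qed (use m r in auto)
  obtain a where a: "\<And>i. a i holomorphic_on ball 0 (r ^ m)"
    "\<And>i s. s \<in> ball 0 r \<Longrightarrow> coeff (F.fibre_poly s) i = a i (s ^ m)"
    by (rule F.fibre_poly_descends) blast
  note P = F.monic_germ_eq_fibre_poly[of _ a, OF a(2)]
  have ev_t: "\<forall>\<^sub>F t in nhds 0. \<tau> t \<in> ball 0 r \<and> \<rho> (\<tau> t) = t \<and> x t = \<tau> t ^ m"
  proof -
    have "\<forall>\<^sub>F t in nhds 0. \<tau> t \<in> ball 0 r"
      by (rule eventually_compose_filterlim[OF eventually_nhds_in_open analytic_germ_filterlim[OF \<tau>]]) (use r in auto)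
    thus ?thesis using \<rho>\<tau> x\<tau> unfolding germ_eq_def by eventually_elim blast
  qed
  show ?thesis
  proof (rule that[of a])
    show "a i analytic_on {0}" for i by (rule holomorphic_ball_analytic[OF a(1)]) (use r in simp)
    show "germ_eq (\<lambda>t. monic_germ m a (x t, w t)) (\<lambda>_. 0)"
      using ev_t unfolding germ_eq_def
    proof eventually_elim
      case (elim t)
      hence "w t = v (\<tau> t)" by (simp add: v_def)
      thus ?case using P[of "\<tau> t"] F.poly_fibre_poly_root[of "\<tau> t"] elim by simp
    qed
    show "germ_dvd (0, w 0) (monic_germ m a) f"
      if f: "f \<in> hol_germs (0, w 0)" and z: "germ_eq (\<lambda>t. f (x t, w t)) (\<lambda>_. 0)" for f
    proof -
      have "germ_eq (\<lambda>s. f (s ^ m, v s)) (\<lambda>_. 0)"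
        using germ_eq_compose[OF z \<rho>] ev_s unfolding germ_eq_def v_def by eventually_elim simp
      from F.kernel_divisible[OF a(1) a(2) _ this] f show ?thesis by (simp add: germ_dvd_def v0)
    qed
    show "\<not> germ_eq (\<lambda>t. partial_y (monic_germ m a) (x t, w t)) (\<lambda>_. 0)"
    proof
      assume "germ_eq (\<lambda>t. partial_y (monic_germ m a) (x t, w t)) (\<lambda>_. 0)"
      hence "\<forall>\<^sub>F t in nhds (0::complex). t = 0" using ev_t unfolding germ_eq_def
      proof eventually_elim
        case (elim t)
        show ?case
        proof (rule ccontr)
          assume "t \<noteq> 0"
          hence s: "\<tau> t \<in> ball 0 r" "\<tau> t \<noteq> 0" using elim \<rho>(2) by auto
          have "partial_y (monic_germ m a) (x t, w t) = deriv (\<lambda>y. monic_germ m a (\<tau> t ^ m, y)) (v (\<tau> t))"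
            using elim by (simp add: partial_y_def v_def)
          also have "\<dots> = poly (pderiv (F.fibre_poly (\<tau> t))) (v (\<tau> t))"
            unfolding P[OF s(1)] by (rule DERIV_imp_deriv[OF poly_DERIV])
          finally show False using F.pderiv_fibre_poly_root[OF s] elim by simp
        qed
      qed
      hence "germ_eq (\<lambda>t. t) (\<lambda>_. 0)" by (simp add: germ_eq_def)
      moreover have "has_order (\<lambda>t. t) 1" unfolding has_order_def by (intro exI[of _ "\<lambda>_. 1"]) auto
      ultimately show False using has_order_not_zero by blast
    qed
    show "monic_germ m a (0, y) = (y - w 0) ^ m" for y
      using P[of 0 y] r m by (simp add: F.poly_fibre_poly_0 v0 power_0_left)
    show "germ_eq (c i) (\<lambda>_. 0)"
      if c: "\<forall>i<m. c i analytic_on {0}" and z: "germ_eq (\<lambda>t. \<Sum>i<m. c i (x t) * w t ^ i) (\<lambda>_. 0)"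
        and i: "i < m" for c i
    proof -
      have "\<forall>\<^sub>F s in nhds 0. (\<Sum>i<m. c i (s ^ m) * v s ^ i) = 0"
        using germ_eq_compose[OF z \<rho>] ev_s unfolding germ_eq_def v_def by eventually_elim simp
      then obtain r3 where r3: "r3 > 0" "\<And>s. dist s 0 < r3 \<Longrightarrow> (\<Sum>i<m. c i (s ^ m) * v s ^ i) = 0"
        unfolding eventually_nhds_metric by blast
      \<comment> \<open>On the smaller disc the relation holds everywhere, not merely as an identity
        of germs.\<close>
      define r' where "r' = min r r3"
      have r': "0 < r'" "r' \<le> r" using r r3 by (auto simp: r'_def)
      interpret F': fibre_function m r' v by (rule F.fibre_function_mono[OF r'])
      have "c i z = 0" if z: "z \<in> ball 0 (r' ^ m)" "z \<noteq> 0" for z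
      proof -
        obtain s where s: "s \<in> ball 0 r'" "s ^ m = z" by (rule power_surj_ball[OF m z(1) r'(1)])
        hence "s \<noteq> 0" using z(2) m by (auto simp: power_0_left)
        have "(\<Sum>i<m. c i (s ^ m) * v s ^ i) = 0" if "s \<in> ball 0 r'" for s
          using r3(2)[of s] that by (simp add: r'_def)
        from F'.powers_independent[OF this s(1) \<open>s \<noteq> 0\<close> i] show ?thesis using s(2) by simp
      qed
      hence "\<forall>\<^sub>F z in at 0. c i z = 0"
        unfolding eventually_at by (intro exI[of _ "r' ^ m"]) (use r' in auto)
      thus ?thesis using c i by (intro germ_eq_punctured) auto
    qed
    show "\<exists>N. \<forall>f. f analytic_on {0} \<longrightarrow> (\<exists>c. (\<forall>i. c i analytic_on {0}) \<and>
        germ_eq (\<lambda>t. x t ^ N * f t) (\<lambda>t. \<Sum>i<m. c i (x t) * w t ^ i))"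
    proof -
      have D: "F.fibre_disc analytic_on {0}" by (rule holomorphic_ball_analytic[OF F.fibre_disc_holomorphic r])
      have "\<not> germ_eq F.fibre_disc (\<lambda>_. 0)"
      proof
        assume "germ_eq F.fibre_disc (\<lambda>_. 0)"
        moreover have "\<forall>\<^sub>F s in nhds 0. s \<in> ball 0 r" by (rule eventually_nhds_in_open) (use r in auto)
        ultimately have "germ_eq (\<lambda>s. s) (\<lambda>_. 0)" unfolding germ_eq_def
        proof eventually_elim
          case (elim s)
          thus ?case using F.fibre_disc_nonzero[of s] by blast
        qed
        moreover have "has_order (\<lambda>t. t) 1" unfolding has_order_def by (intro exI[of _ "\<lambda>_. 1"]) auto
        ultimately show False using has_order_not_zero by blast
      qed
      then obtain n where "has_order F.fibre_disc n" using analytic_has_order[OF D] by blast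
      then obtain u where u: "u analytic_on {0}" "u 0 \<noteq> 0" "germ_eq F.fibre_disc (\<lambda>s. s ^ n * u s)"
        unfolding has_order_def by blast
      have nmn: "n \<le> m * n" using m by simp
      show ?thesis
      proof (intro exI[of _ n] allI impI)
        fix f :: "complex \<Rightarrow> complex" assume f: "f analytic_on {0}"
        \<comment> \<open>Chosen so that \<open>fibre_disc\<close> times g equals s^(m n) f, which
          is x^n f. The exponent n, the order of the discriminant in s, is enough because n \<le> m
          n.\<close>
        define g where "g s = s ^ (m * n - n) * (f (\<rho> s) / u s)" for s
        have "g analytic_on {0}" unfolding g_def
          by (intro analytic_intros u analytic_germ_compose[OF \<rho>(1) f \<rho>(2)]) (use u in auto)
        then obtain r3 where r3: "r3 > 0" "g holomorphic_on ball 0 r3" by (auto simp: analytic_on_def)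
        define r' where "r' = min r r3"
        have r': "0 < r'" "r' \<le> r" using r r3 by (auto simp: r'_def)
        interpret F': fibre_function m r' v by (rule F.fibre_function_mono[OF r'])
        have "g holomorphic_on ball 0 r'" by (rule holomorphic_on_subset[OF r3(2)]) (auto simp: r'_def)
        then obtain c where c: "\<And>i. c i holomorphic_on ball 0 (r' ^ m)"
          "\<And>s. s \<in> ball 0 r' \<Longrightarrow> F.fibre_disc s * g s = (\<Sum>i<m. c i (s ^ m) * v s ^ i)"
          by (rule F'.interpolation) blast
        have "\<forall>\<^sub>F s in nhds 0. s \<in> ball 0 r'" by (rule eventually_nhds_in_open) (use r' in auto)
        hence "germ_eq (\<lambda>s. s ^ (m * n) * f (\<rho> s)) (\<lambda>s. \<Sum>i<m. c i (s ^ m) * v s ^ i)"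
          using u(3) analytic_nonzero_near[OF u(1,2)] unfolding germ_eq_def
        proof eventually_elim
          case (elim s)
          have "s ^ (m * n) = s ^ n * s ^ (m * n - n)" using nmn by (simp flip: power_add)
          thus ?case using c(2)[OF elim(1)] elim(2,3) by (simp add: g_def mult.assoc)
        qed
        from germ_eq_compose[OF this \<tau>] ev_t
        have "germ_eq (\<lambda>t. x t ^ n * f t) (\<lambda>t. \<Sum>i<m. c i (x t) * w t ^ i)"
          unfolding germ_eq_def v_def by eventually_elim (simp add: power_mult)
        moreover have "c i analytic_on {0}" for i by (rule holomorphic_ball_analytic[OF c(1)]) (use r' in simp)
        ultimately show "\<exists>c. (\<forall>i. c i analytic_on {0}) \<and> germ_eq (\<lambda>t. x t ^ n * f t) (\<lambda>t. \<Sum>i<m. c i (x t) * w t ^ i)"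
          by blast
      qed
    qed
  qed
qed

section \<open>The ring of a branch and the ring of its blow-up\<close>

definition power_span :: "nat \<Rightarrow> (complex \<Rightarrow> complex) \<Rightarrow> (complex \<Rightarrow> complex) \<Rightarrow> (complex \<Rightarrow> complex) set" where
  "power_span m x w = {g. \<exists>c. (\<forall>i. c i analytic_on {0}) \<and> germ_eq g (\<lambda>t. \<Sum>i<m. c i (x t) * w t ^ i)}"

lemma power_spanI:
  assumes "\<And>i. c i analytic_on {0}" "germ_eq g (\<lambda>t. \<Sum>i<m. c i (x t) * w t ^ i)"
  shows "g \<in> power_span m x w"
  using assms by (auto simp: power_span_def)

lemma germ_space_power_span:
  assumes x: "x analytic_on {0}" "x 0 = 0" and w: "w analytic_on {0}"
  shows "germ_space (power_span m x w)"
  unfolding germ_space_def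
proof (intro conjI ballI allI impI)
  show "lin_sub (power_span m x w)"
  proof (rule lin_subI)
    show "(\<lambda>_. 0) \<in> power_span m x w" by (rule power_spanI[of "\<lambda>_ _. 0"]) auto
    show "(\<lambda>t. f t + g t) \<in> power_span m x w" if fg: "f \<in> power_span m x w" "g \<in> power_span m x w" for f g
    proof -
      obtain c where c: "\<And>i. c i analytic_on {0}" "germ_eq f (\<lambda>t. \<Sum>i<m. c i (x t) * w t ^ i)"
        using fg(1) unfolding power_span_def by blast
      obtain d where d: "\<And>i. d i analytic_on {0}" "germ_eq g (\<lambda>t. \<Sum>i<m. d i (x t) * w t ^ i)"
        using fg(2) unfolding power_span_def by blast
      show ?thesis
        by (rule power_spanI[of "\<lambda>i s. c i s + d i s"])
          (use germ_eq_add[OF c(2) d(2)] in \<open>auto intro!: analytic_intros c d simp: sum.distrib distrib_right\<close>)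
    qed
    show "(\<lambda>t. k * f t) \<in> power_span m x w" if f: "f \<in> power_span m x w" for k f
    proof -
      obtain c where c: "\<And>i. c i analytic_on {0}" "germ_eq f (\<lambda>t. \<Sum>i<m. c i (x t) * w t ^ i)"
        using f unfolding power_span_def by blast
      show ?thesis
        by (rule power_spanI[of "\<lambda>i s. k * c i s"])
          (use germ_eq_mult[OF germ_eq_refl[of "\<lambda>_. k"] c(2)] in \<open>auto intro!: analytic_intros c simp: sum_distrib_left mult.assoc\<close>)
    qed
  qed
  show "f analytic_on {0}" if f: "f \<in> power_span m x w" for f
  proof -
    obtain c where c: "\<And>i. c i analytic_on {0}" "germ_eq f (\<lambda>t. \<Sum>i<m. c i (x t) * w t ^ i)"
      using f unfolding power_span_def by blast
    have "(\<lambda>t. c i (x t)) analytic_on {0}" for i by (rule analytic_germ_compose[OF x(1) c(1) x(2)])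
    hence "(\<lambda>t. \<Sum>i<m. c i (x t) * w t ^ i) analytic_on {0}"
      by (intro analytic_on_sum analytic_on_mult analytic_on_power w)
    thus ?thesis using germ_eq_analytic[OF c(2)] by blast
  qed
  show "g \<in> power_span m x w" if f: "f \<in> power_span m x w" and fg: "germ_eq f g" for f g
  proof -
    obtain c where c: "\<And>i. c i analytic_on {0}" "germ_eq f (\<lambda>t. \<Sum>i<m. c i (x t) * w t ^ i)"
      using f unfolding power_span_def by blast
    show ?thesis by (rule power_spanI[OF c(1) germ_eq_trans[OF germ_eq_sym[OF fg] c(2)]])
  qed
qed

lemma power_span_scale:
  assumes "g \<in> power_span m x w" "e analytic_on {0}"
  shows "(\<lambda>t. e (x t) * g t) \<in> power_span m x w"
proof -
  obtain c where c: "\<And>i. c i analytic_on {0}" "germ_eq g (\<lambda>t. \<Sum>i<m. c i (x t) * w t ^ i)"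
    using assms(1) unfolding power_span_def by blast
  show ?thesis
    by (rule power_spanI[of "\<lambda>i s. e s * c i s"])
      (use germ_eq_mult[OF germ_eq_refl[of "\<lambda>t. e (x t)"] c(2)] in
        \<open>auto intro!: analytic_intros c assms(2) simp: sum_distrib_left mult.assoc\<close>)
qed

text \<open>The monic relation rewrites w^m through lower powers.\<close>

lemma power_span_mult_generator:
  assumes a: "\<And>i. a i analytic_on {0}" and rel: "germ_eq (\<lambda>t. monic_germ m a (x t, w t)) (\<lambda>_. 0)"
    and m: "m > 0" and g: "g \<in> power_span m x w"
  shows "(\<lambda>t. w t * g t) \<in> power_span m x w"
proof -
  obtain c where c: "\<And>i. c i analytic_on {0}" "germ_eq g (\<lambda>t. \<Sum>i<m. c i (x t) * w t ^ i)"
    using g unfolding power_span_def by blast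
  obtain k where k: "m = Suc k" using m by (cases m) auto
  \<comment> \<open>Multiplication by w shifts the coefficients up by one, leaving none at index 0;
    the overflow \<open>c k\<close> w^m is replaced by the monic relation.\<close>
  define d where "d i s = (if i = 0 then 0 else c (i - 1) s) - c k s * a i s" for i s
  have "germ_eq (\<lambda>t. w t * g t) (\<lambda>t. \<Sum>i<m. d i (x t) * w t ^ i)"
    using c(2) rel unfolding germ_eq_def
  proof eventually_elim
    case (elim t)
    let ?x = "x t" and ?w = "w t"
    have wm: "?w ^ m = - (\<Sum>i<m. a i ?x * ?w ^ i)" using elim(2) by (simp add: monic_germ_def add_eq_0_iff)
    have sh: "(\<Sum>i<m. (if i = 0 then 0 else c (i - 1) ?x) * ?w ^ i) = (\<Sum>i<k. c i ?x * ?w ^ Suc i)"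
      unfolding k by (subst sum.lessThan_Suc_shift) simp
    have "?w * g t = (\<Sum>i<m. c i ?x * ?w ^ Suc i)"
      by (simp add: elim(1) sum_distrib_left mult_ac)
    also have "\<dots> = (\<Sum>i<k. c i ?x * ?w ^ Suc i) + c k ?x * ?w ^ m" by (simp add: k)
    also have "\<dots> = (\<Sum>i<m. (if i = 0 then 0 else c (i - 1) ?x) * ?w ^ i) - (\<Sum>i<m. c k ?x * a i ?x * ?w ^ i)"
      unfolding sh wm by (simp add: sum_distrib_left mult.assoc)
    also have "\<dots> = (\<Sum>i<m. d i ?x * ?w ^ i)"
      unfolding d_def by (simp only: left_diff_distrib sum_subtractf)
    finally show ?case .
  qed
  moreover have "d i analytic_on {0}" for i
    unfolding d_def by (cases "i = 0") (auto intro!: analytic_intros a c)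
  ultimately show ?thesis by (intro power_spanI)
qed

text \<open>Expand f in powers of w - w 0 up to order m N. The polynomial part lies in the span by
  the monic relation, and the remainder is divisible by x^N along the branch, so \<open>cond\<close>
  covers it.\<close>

lemma branch_ring_eq_power_span:
  assumes x: "has_order x m" and m: "m > 0" and w: "w analytic_on {0}"
    and a: "\<And>i. a i analytic_on {0}" and rel: "germ_eq (\<lambda>t. monic_germ m a (x t, w t)) (\<lambda>_. 0)"
    and cond: "\<And>f. f analytic_on {0} \<Longrightarrow> \<exists>c. (\<forall>i. c i analytic_on {0}) \<and>
        germ_eq (\<lambda>t. x t ^ N * f t) (\<lambda>t. \<Sum>i<m. c i (x t) * w t ^ i)"
  shows "branch_ring (0, w 0) (\<lambda>t. (x t, w t)) = power_span m x w"
proof (intro equalityI subsetI)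
  fix g assume "g \<in> power_span m x w"
  then obtain c where c: "\<And>i. c i analytic_on {0}" "germ_eq g (\<lambda>t. \<Sum>i<m. c i (x t) * w t ^ i)"
    unfolding power_span_def by blast
  show "g \<in> branch_ring (0, w 0) (\<lambda>t. (x t, w t))"
    by (rule branch_ringI[of "\<lambda>z. \<Sum>i<m. c i (fst z) * snd z ^ i"])
      (use c in \<open>auto intro!: hol_germs_intros hol_germs_analytic_fst\<close>)
next
  from x obtain u where u: "u analytic_on {0}" "u 0 \<noteq> 0" "germ_eq x (\<lambda>t. t ^ m * u t)"
    unfolding has_order_def by blast
  have x0: "x 0 = 0" using germ_eq_at[OF u(3)] m by simp
  have xan: "x analytic_on {0}" by (rule has_order_imp_analytic[OF x])
  have \<gamma>: "curve_germ (0, w 0) (\<lambda>t. (x t, w t))"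
    using xan w x0 by (simp add: curve_germ_def o_def)
  have L: "lin_sub (power_span m x w)" by (rule germ_space_lin[OF germ_space_power_span[OF xan x0 w]])
  have one: "(\<lambda>_. 1) \<in> power_span m x w"
  proof (rule power_spanI[of "\<lambda>i _. if i = 0 then 1 else 0"])
    have "(\<Sum>i<m. (if i = 0 then 1 else 0) * w t ^ i) = 1" for t
    proof -
      have "(\<Sum>i<m. (if i = 0 then 1 else 0) * w t ^ i) = (\<Sum>i<m. if i = 0 then 1 else 0)"
        by (intro sum.cong) auto
      thus ?thesis using m by simp
    qed
    thus "germ_eq (\<lambda>_. 1) (\<lambda>t. \<Sum>i<m. (if i = 0 then 1 else 0) * w t ^ i)" by simp
  qed auto
  have gen: "(\<lambda>t. (w t - w 0) * g t) \<in> power_span m x w" if "g \<in> power_span m x w" for g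
    using lin_sub_diff[OF L power_span_mult_generator[OF a rel m that] lin_sub_scale[OF L that, of "w 0"]]
    by (simp add: left_diff_distrib)
  have pow: "(\<lambda>t. (w t - w 0) ^ j) \<in> power_span m x w" for j
    by (induction j) (use one gen in auto)
  fix g assume "g \<in> branch_ring (0, w 0) (\<lambda>t. (x t, w t))"
  then obtain f where f: "f \<in> hol_germs (0, w 0)" "germ_eq g (\<lambda>t. f (x t, w t))"
    unfolding branch_ring_def by blast
  \<comment> \<open>Since w - w 0 vanishes at t = 0, its power with exponent m N is divisible by
    t^(m N), that is, by x^N.\<close>
  let ?N = "m * N"
  obtain c h where c: "\<And>j. c j analytic_on {0}" and h: "h \<in> hol_germs (0, w 0)"
    and eq: "\<forall>\<^sub>F z in nhds (0, w 0). f z = (\<Sum>j<?N. c j (fst z) * (snd z - w 0) ^ j) + (snd z - w 0) ^ ?N * h z"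
    by (rule hol_germs_taylor_y[OF f(1), of ?N], rule that)
  from analytic_taylor[OF w, of 1] obtain k where k: "k analytic_on {0}"
    "\<forall>\<^sub>F t in nhds 0. w t = (\<Sum>j<1. (deriv ^^ j) w 0 / fact j * (t - 0) ^ j) + (t - 0) ^ 1 * k t" .
  define e where "e t = k t ^ ?N / u t ^ N * h (x t, w t)" for t
  have e: "e analytic_on {0}" unfolding e_def
    by (intro analytic_on_mult analytic_on_divide analytic_on_power k u curve_germ_compose_analytic[OF \<gamma> h]) (use u in auto)
  obtain c' where c': "\<And>i. c' i analytic_on {0}" "germ_eq (\<lambda>t. x t ^ N * e t) (\<lambda>t. \<Sum>i<m. c' i (x t) * w t ^ i)"
    using cond[OF e] by blast
  have "(\<lambda>t. (\<Sum>j<?N. c j (x t) * (w t - w 0) ^ j) + x t ^ N * e t) \<in> power_span m x w"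
    by (rule lin_sub_add[OF L lin_sub_sum[OF L _ power_span_scale[OF pow c]] power_spanI[OF c']]) simp
  moreover have "germ_eq (\<lambda>t. (\<Sum>j<?N. c j (x t) * (w t - w 0) ^ j) + x t ^ N * e t) g"
    using f(2) curve_germ_eventually[OF \<gamma> eq] k(2) u(3) analytic_nonzero_near[OF u(1,2)] unfolding germ_eq_def
  proof eventually_elim
    case (elim t)
    have "w t - w 0 = t * k t" using elim(3) by simp
    hence "(w t - w 0) ^ ?N * h (x t, w t) = x t ^ N * e t"
      using elim(4,5) by (simp add: e_def power_mult_distrib power_mult)
    thus ?case using elim(1,2) by simp
  qed
  ultimately show "g \<in> power_span m x w" using germ_space_cong[OF germ_space_power_span[OF xan x0 w]] by blast
qed

text \<open>The span contains all multiples of x^N, a space of codimension m N.\<close>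

lemma qdim_power_span:
  assumes x: "has_order x m" and m: "m > 0"
    and cond: "\<And>f. f analytic_on {0} \<Longrightarrow> \<exists>c. (\<forall>i. c i analytic_on {0}) \<and>
        germ_eq (\<lambda>t. x t ^ N * f t) (\<lambda>t. \<Sum>i<m. c i (x t) * w t ^ i)"
    and S: "germ_space (power_span m x w)"
  shows "\<exists>\<delta>. qdim germs1 (power_span m x w) \<delta>"
proof -
  have o: "has_order (\<lambda>t. x t ^ N) (m * N)" by (rule has_order_power[OF x])
  have G: "germ_space (germ_mul (\<lambda>t. x t ^ N) germs1)"
    by (rule germ_space_mul[OF germ_space_germs1 has_order_imp_analytic[OF o]])
  have sub: "germ_mul (\<lambda>t. x t ^ N) germs1 \<subseteq> power_span m x w"
  proof
    fix g assume "g \<in> germ_mul (\<lambda>t. x t ^ N) germs1"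
    then obtain f where f: "f analytic_on {0}" "germ_eq g (\<lambda>t. x t ^ N * f t)"
      unfolding germ_mul_def germs1_def by blast
    from cond[OF f(1)] obtain c where c: "\<And>i. c i analytic_on {0}"
      "germ_eq (\<lambda>t. x t ^ N * f t) (\<lambda>t. \<Sum>i<m. c i (x t) * w t ^ i)" by blast
    show "g \<in> power_span m x w" by (rule power_spanI[OF c(1) germ_eq_trans[OF f(2) c(2)]])
  qed
  obtain k l where "qdim germs1 (power_span m x w) k" "qdim (power_span m x w) (germ_mul (\<lambda>t. x t ^ N) germs1) l"
    by (rule qdim_intermediate[OF germ_space_lin[OF G] germ_space_lin[OF S] sub germ_space_subset[OF S] qdim_has_order[OF o]])
  thus ?thesis by blast
qed

text \<open>Since (x v)^i = x^i v^i, the coefficient of v^i is only restricted to be divisible by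
  x^i. Each i < m contributes the classes of x^k v^i with k < i, altogether 0 + 1 + ... + (m -
  1).\<close>

lemma power_span_blowup_index:
  assumes x: "x analytic_on {0}" "x 0 = 0"
    and ind: "\<And>c i. \<forall>i<m. c i analytic_on {0} \<Longrightarrow> germ_eq (\<lambda>t. \<Sum>i<m. c i (x t) * v t ^ i) (\<lambda>_. 0) \<Longrightarrow>
        i < m \<Longrightarrow> germ_eq (c i) (\<lambda>_. 0)"
  shows "qdim (power_span m x v) (power_span m x (\<lambda>t. x t * v t)) (m * (m - 1) div 2)"
proof -
  define I where "I = (SIGMA i:{..<m}. {..<i})"
  define b where "b p t = x t ^ snd p * v t ^ fst p" for p :: "nat \<times> nat" and t
  have sumI: "(\<Sum>p\<in>I. c p * b p t) = (\<Sum>i<m. (\<Sum>k<i. c (i, k) * x t ^ k) * v t ^ i)" for c t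
  proof -
    have "(\<Sum>i<m. (\<Sum>k<i. c (i, k) * x t ^ k) * v t ^ i) = (\<Sum>i<m. \<Sum>k<i. c (i, k) * b (i, k) t)"
      by (simp add: b_def sum_distrib_right mult.assoc)
    also have "\<dots> = (\<Sum>p\<in>I. c p * b p t)" unfolding I_def by (subst sum.Sigma) (auto simp: case_prod_unfold)
    finally show ?thesis by simp
  qed
  have "basis_mod (power_span m x v) (power_span m x (\<lambda>t. x t * v t)) I b"
    unfolding basis_mod_def
  proof (intro conjI)
    show "finite I" by (simp add: I_def)
    show "b ` I \<subseteq> power_span m x v"
    proof
      fix g assume "g \<in> b ` I"
      then obtain i k where ik: "i < m" "g = b (i, k)" by (auto simp: I_def)
      have "(\<Sum>j<m. (if j = i then x t ^ k else 0) * v t ^ j) = b (i, k) t" for t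
      proof -
        have "(\<Sum>j<m. (if j = i then x t ^ k else 0) * v t ^ j) = (\<Sum>j<m. if j = i then x t ^ k * v t ^ i else 0)"
          by (intro sum.cong) auto
        thus ?thesis using ik by (simp add: b_def)
      qed
      moreover have "(\<lambda>s. if j = i then s ^ k else 0) analytic_on {0}" for j
        by (cases "j = i") (auto intro!: analytic_intros)
      ultimately show "g \<in> power_span m x v"
        by (intro power_spanI[of "\<lambda>j s. if j = i then s ^ k else 0"]) (auto simp: ik)
    qed
    show "span_mod (power_span m x v) (power_span m x (\<lambda>t. x t * v t)) I b" unfolding span_mod_def
    proof
      fix g assume "g \<in> power_span m x v"
      then obtain c where c: "\<And>i. c i analytic_on {0}" "germ_eq g (\<lambda>t. \<Sum>i<m. c i (x t) * v t ^ i)"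
        unfolding power_span_def by blast
      define \<alpha> where "\<alpha> i k = (deriv ^^ k) (c i) 0 / fact k" for i k
      have "\<forall>i. \<exists>d. d analytic_on {0} \<and> germ_eq (c i) (\<lambda>s. (\<Sum>k<i. \<alpha> i k * s ^ k) + s ^ i * d s)"
      proof
        fix i
        from analytic_taylor[OF c(1)[of i], of i] obtain d where d: "d analytic_on {0}"
          "\<forall>\<^sub>F y in nhds 0. c i y = (\<Sum>j<i. (deriv ^^ j) (c i) 0 / fact j * (y - 0) ^ j) + (y - 0) ^ i * d y" .
        thus "\<exists>d. d analytic_on {0} \<and> germ_eq (c i) (\<lambda>s. (\<Sum>k<i. \<alpha> i k * s ^ k) + s ^ i * d s)"
          by (intro exI[of _ d]) (simp add: germ_eq_def \<alpha>_def)
      qed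
      then obtain d where d: "\<And>i. d i analytic_on {0}" "\<And>i. germ_eq (c i) (\<lambda>s. (\<Sum>k<i. \<alpha> i k * s ^ k) + s ^ i * d i s)"
        by metis
      have "\<forall>\<^sub>F t in nhds 0. \<forall>i\<in>{..<m}. c i (x t) = (\<Sum>k<i. \<alpha> i k * x t ^ k) + x t ^ i * d i (x t)"
        by (rule eventually_ball_finite) (use germ_eq_compose[OF d(2) x] in \<open>auto simp: germ_eq_def\<close>)
      hence "germ_eq (\<lambda>t. g t - (\<Sum>p\<in>I. (\<lambda>(i, k). \<alpha> i k) p * b p t)) (\<lambda>t. \<Sum>i<m. d i (x t) * (x t * v t) ^ i)"
        using c(2) unfolding germ_eq_def
      proof eventually_elim
        case (elim t)
        have gt: "g t = (\<Sum>i<m. ((\<Sum>k<i. \<alpha> i k * x t ^ k) + x t ^ i * d i (x t)) * v t ^ i)"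
          unfolding elim(2) using elim(1) by (intro sum.cong) auto
        show ?case unfolding sumI gt sum_subtractf[symmetric] prod.case
          by (intro sum.cong refl) (simp add: algebra_simps power_mult_distrib)
      qed
      from power_spanI[OF d(1) this] show "\<exists>c. (\<lambda>t. g t - (\<Sum>p\<in>I. c p * b p t)) \<in> power_span m x (\<lambda>t. x t * v t)"
        by (rule exI[of _ "\<lambda>(i, k). \<alpha> i k"])
    qed
    show "indep_mod (power_span m x (\<lambda>t. x t * v t)) I b" unfolding indep_mod_def
    proof (intro allI impI ballI)
      fix c p assume "(\<lambda>t. \<Sum>p\<in>I. c p * b p t) \<in> power_span m x (\<lambda>t. x t * v t)" and p: "p \<in> I"
      then obtain d where d: "\<And>i. d i analytic_on {0}"
        "germ_eq (\<lambda>t. \<Sum>p\<in>I. c p * b p t) (\<lambda>t. \<Sum>i<m. d i (x t) * (x t * v t) ^ i)"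
        unfolding power_span_def by blast
      \<comment> \<open>The coefficient of v^i in the relation. Independence over C{x} makes it
        zero, so a polynomial of degree below i is divisible by s^i.\<close>
      define e where "e i s = (\<Sum>k<i. c (i, k) * s ^ k) - s ^ i * d i s" for i s
      have Z: "germ_eq (\<lambda>t. \<Sum>i<m. e i (x t) * v t ^ i) (\<lambda>_. 0)"
        using d(2) unfolding germ_eq_def sumI
      proof eventually_elim
        case (elim t)
        thus ?case unfolding e_def left_diff_distrib sum_subtractf by (simp add: power_mult_distrib mult_ac)
      qed
      obtain i k where ik: "p = (i, k)" "i < m" "k < i" using p by (auto simp: I_def)
      have "\<forall>j<m. e j analytic_on {0}"
        unfolding e_def by (intro allI impI analytic_on_diff analytic_on_mult analytic_on_sum analytic_on_power
            analytic_on_const analytic_on_ident d)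
      from ind[OF this Z ik(2)] have "germ_eq (e i) (\<lambda>_. 0)" .
      hence "germ_eq (\<lambda>s. \<Sum>k<i. c (i, k) * s ^ k) (\<lambda>s. s ^ i * d i s)"
        unfolding germ_eq_def by eventually_elim (simp add: e_def)
      from poly_germ_divisible[OF d(1) this ik(3)] show "c p = 0" by (simp add: ik)
    qed
  qed
  moreover have "card I = m * (m - 1) div 2"
    by (simp add: I_def lessThan_atLeast0 Sum_Ico_nat)
  ultimately show ?thesis using basis_mod_imp_qdim by metis
qed

section \<open>Blowing up a curve\<close>

lemma germ_dvdI: "h \<in> hol_germs p \<Longrightarrow> \<forall>\<^sub>F z in nhds p. g z = h z * f z \<Longrightarrow> germ_dvd p f g"
  by (auto simp: germ_dvd_def)

lemma germ_dvd_trans: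
  assumes "germ_dvd p f g" "germ_dvd p g h" shows "germ_dvd p f h"
proof -
  from assms obtain a b where *: "a \<in> hol_germs p" "b \<in> hol_germs p"
    "\<forall>\<^sub>F z in nhds p. g z = a z * f z" "\<forall>\<^sub>F z in nhds p. h z = b z * g z"
    unfolding germ_dvd_def by blast
  have "\<forall>\<^sub>F z in nhds p. h z = (b z * a z) * f z"
    using *(3,4) by eventually_elim simp
  thus ?thesis by (rule germ_dvdI[OF hol_germs_mult[OF *(2,1)]])
qed

lemma partial_y_cong:
  assumes "\<forall>\<^sub>F z in nhds p. f z = g z" shows "\<forall>\<^sub>F z in nhds p. partial_y f z = partial_y g z"
proof -
  have "\<forall>\<^sub>F z in nhds p. \<forall>\<^sub>F z' in nhds z. f z' = g z'" using assms by (simp add: eventually_eventually)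
  thus ?thesis
  proof eventually_elim
    case (elim z)
    obtain a b where z: "z = (a, b)" by (cases z)
    have "filterlim (\<lambda>s. (a, s)) (nhds (a, b)) (nhds b)" by (intro tendsto_intros filterlim_ident)
    from eventually_compose_filterlim[OF elim[unfolded z] this]
    show ?case by (simp add: partial_y_def z deriv_cong_ev)
  qed
qed

lemma partial_y_mult:
  assumes "f \<in> hol_germs p" "g \<in> hol_germs p"
  shows "\<forall>\<^sub>F z in nhds p. partial_y (\<lambda>z. f z * g z) z = partial_y f z * g z + f z * partial_y g z"
proof -
  from assms obtain U V where U: "open U" "p \<in> U" "holomorphic2_on f U" "open V" "p \<in> V" "holomorphic2_on g V"
    unfolding hol_germs_def by blast
  have "partial_y (\<lambda>z. f z * g z) z = partial_y f z * g z + f z * partial_y g z" if z: "z \<in> U \<inter> V" for z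
  proof -
    have "((\<lambda>s. f (fst z, s)) has_field_derivative partial_y f z) (at (snd z))"
      "((\<lambda>s. g (fst z, s)) has_field_derivative partial_y g z) (at (snd z))"
      using holomorphic2_on_partials(3) U z by auto
    from DERIV_mult[OF this] show ?thesis
      by (simp add: partial_y_def case_prod_beta mult.commute DERIV_imp_deriv)
  qed
  thus ?thesis unfolding eventually_nhds using U by (intro exI[of _ "U \<inter> V"]) auto
qed

text \<open>A divisor \<phi> of the generator P that still vanishes on the branch generates the same
  ideal. With P = h \<phi>, the y-derivative of P along the branch is h times that of \<phi>, so the
  latter is not zero.\<close>

lemma branch_of_divisor:
  assumes \<gamma>: "curve_germ p \<gamma>" and P: "P \<in> hol_germs p"
    and ker: "\<And>f. f \<in> hol_germs p \<Longrightarrow> germ_eq (\<lambda>t. f (\<gamma> t)) (\<lambda>_. 0) \<Longrightarrow> germ_dvd p P f"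
    and grad: "\<not> germ_eq (\<lambda>t. partial_y P (\<gamma> t)) (\<lambda>_. 0)"
    and \<phi>: "\<phi> \<in> hol_germs p" and \<phi>0: "germ_eq (\<lambda>t. \<phi> (\<gamma> t)) (\<lambda>_. 0)" and dvd: "germ_dvd p \<phi> P"
  shows "branch_of p \<phi> \<gamma>"
proof -
  from dvd obtain h where h: "h \<in> hol_germs p" "\<forall>\<^sub>F z in nhds p. P z = h z * \<phi> z"
    unfolding germ_dvd_def by blast
  have "\<not> germ_eq (\<lambda>t. partial_y \<phi> (\<gamma> t)) (\<lambda>_. 0)"
  proof
    assume "germ_eq (\<lambda>t. partial_y \<phi> (\<gamma> t)) (\<lambda>_. 0)"
    hence "germ_eq (\<lambda>t. partial_y P (\<gamma> t)) (\<lambda>_. 0)"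
      using curve_germ_eventually[OF \<gamma> partial_y_cong[OF h(2)]]
        curve_germ_eventually[OF \<gamma> partial_y_mult[OF h(1) \<phi>]] \<phi>0
      unfolding germ_eq_def by eventually_elim simp
    thus False using grad by contradiction
  qed
  thus ?thesis unfolding branch_of_def using \<gamma> \<phi> \<phi>0 germ_dvd_trans[OF dvd ker] by blast
qed

section \<open>The first chart and restriction to the exceptional divisor\<close>

lemma blowdown_X: "blowdown ChartX z = (fst z, fst z * snd z)"
  by (cases z) simp

lemma hol_germs_blowdown_X:
  assumes "f \<in> hol_germs 0" "fst q = 0" shows "(\<lambda>z. f (blowdown ChartX z)) \<in> hol_germs q"
proof -
  have "f \<in> hol_germs (fst q, fst q * snd q)" using assms by (simp add: zero_prod_def)
  from hol_germs_compose[of f fst q "\<lambda>z. fst z * snd z", OF this]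
  show ?thesis unfolding blowdown_X by (simp add: hol_germs_intros)
qed

lemma blowdown_X_eventually:
  assumes "fst q = 0" "\<forall>\<^sub>F z in nhds 0. Q z" shows "\<forall>\<^sub>F z in nhds q. Q (blowdown ChartX z)"
proof -
  have "filterlim (blowdown ChartX) (nhds (fst q, fst q * snd q)) (nhds q)"
    unfolding blowdown_X[abs_def] by (intro tendsto_intros filterlim_ident)
  thus ?thesis using assms eventually_compose_filterlim by (fastforce simp: zero_prod_def)
qed

text \<open>In the Taylor expansion of f in its first variable to order 1, obtained through the
  swap, the constant term is the restriction to x = 0.\<close>

lemma dvd_fst_if_restriction_zero:
  assumes f: "f \<in> hol_germs (0, b)" and z: "\<forall>\<^sub>F y in nhds b. f (0, y) = 0"
  shows "germ_dvd (0, b) fst f"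
proof -
  have fsw: "f \<circ> prod.swap \<in> hol_germs (b, 0)" using hol_germs_swap[OF f] by simp
  obtain c g where c: "\<And>j. c j analytic_on {b}" and g: "g \<in> hol_germs (b, 0)"
    and eq: "\<forall>\<^sub>F z in nhds (b, 0). (f \<circ> prod.swap) z = (\<Sum>j<1. c j (fst z) * (snd z - 0) ^ j) + (snd z - 0) ^ 1 * g z"
    and cj: "\<And>j. \<forall>\<^sub>F x in nhds b. c j x = (deriv ^^ j) (\<lambda>s. (f \<circ> prod.swap) (x, s)) 0 / fact j"
    by (rule hol_germs_taylor_y[OF fsw, of 1], rule that)
  have sw: "filterlim prod.swap (nhds (b, 0)) (nhds (0, b))"
    unfolding prod.swap_def[abs_def]
    by (rule tendsto_eq_rhs[OF tendsto_Pair[OF tendsto_snd[OF filterlim_ident] tendsto_fst[OF filterlim_ident]]]) simp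
  have fs: "filterlim fst (nhds b) (nhds (b, 0::complex))"
    by (rule tendsto_eq_rhs[OF tendsto_fst[OF filterlim_ident]]) simp
  have "\<forall>\<^sub>F y in nhds b. c 0 y = 0" using cj[of 0] z by eventually_elim simp
  from eventually_compose_filterlim[OF this fs] eq
  have "\<forall>\<^sub>F z in nhds (b, 0). f (prod.swap z) = snd z * g z" by eventually_elim simp
  from eventually_compose_filterlim[OF this sw]
  have "\<forall>\<^sub>F z in nhds (0, b). f z = g (prod.swap z) * fst z" by eventually_elim (simp add: mult.commute)
  moreover have "g \<circ> prod.swap \<in> hol_germs (0, b)" using hol_germs_swap[OF g] by simp
  ultimately show ?thesis by (intro germ_dvdI[of "g \<circ> prod.swap"]) simp_all
qed

lemma restriction_analytic:
  assumes f: "f \<in> hol_germs (0, b)" shows "(\<lambda>s. f (0, b + s)) analytic_on {0}"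
proof -
  have "(\<lambda>s. b + s) analytic_on {0}" by (intro analytic_intros)
  thus ?thesis by (intro curve_germ_compose_analytic[OF _ f]) (simp add: curve_germ_def o_def)
qed

lemma eventually_nhds_shift:
  assumes "\<forall>\<^sub>F s in nhds 0. P (b + s)" shows "\<forall>\<^sub>F y in nhds (b::complex). P y"
proof -
  have "filterlim (\<lambda>y. y - b) (nhds 0) (nhds b)"
    by (rule tendsto_eq_rhs[OF tendsto_diff[OF filterlim_ident tendsto_const]]) simp
  from eventually_compose_filterlim[OF assms this] show ?thesis by simp
qed

text \<open>A germ not divisible by the exceptional equation restricts to a nonzero germ on the
  exceptional line, and zeros of such a germ are isolated.\<close>

lemma restriction_nonzero:
  assumes f: "f \<in> hol_germs (0, b)" and nd: "\<not> germ_dvd (0, b) fst f"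
  shows "\<forall>\<^sub>F s in at 0. f (0, b + s) \<noteq> 0"
proof -
  have "\<not> germ_eq (\<lambda>s. f (0, b + s)) (\<lambda>_. 0)"
    using dvd_fst_if_restriction_zero[OF f] nd eventually_nhds_shift[of "\<lambda>y. f (0, y) = 0" b] by (auto simp: germ_eq_def)
  with restriction_analytic[OF f] obtain n where "has_order (\<lambda>s. f (0, b + s)) n" by (rule analytic_has_order)
  thus ?thesis by (rule has_order_imp_nonzero)
qed

lemma dvd_fst_restriction:
  fixes f g :: cfun2
  assumes "\<forall>\<^sub>F z in nhds (0, b). f z = fst z * g z"
  shows "\<forall>\<^sub>F s in at (0::complex). f (0, b + s) = 0"
proof -
  have "filterlim (\<lambda>s. (0, b + s)) (nhds (0, b)) (nhds (0::complex))"
    by (rule tendsto_eq_rhs[OF tendsto_Pair[OF tendsto_const tendsto_add[OF tendsto_const filterlim_ident]]]) simp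
  from eventually_compose_filterlim[OF assms this]
  have "\<forall>\<^sub>F s in nhds (0::complex). f (0, b + s) = 0" by eventually_elim simp
  thus ?thesis by (simp add: eventually_nhds_conv_at)
qed

text \<open>Both branches get a Weierstrass polynomial of degree m over the same coordinate x, and
  the blow-down turns the lower one into x^m times the upper one. Irreducibility makes \<phi> a unit
  multiple of the lower polynomial; comparing powers of x then makes \<phi>' a unit multiple of the
  upper one.\<close>

theorem curve_blowup_X:
  assumes irr: "germ_irreducible 0 \<phi>" and st: "strict_transform_curve ChartX q \<phi> \<phi>'"
    and q: "fst q = 0" and \<gamma>q: "\<gamma> 0 = q"
    and U: "open U" "0 \<in> U" "(fst \<circ> \<gamma>) holomorphic_on U" "(snd \<circ> \<gamma>) holomorphic_on U"
    and inj: "inj_on \<gamma> U" and \<phi>'U: "\<And>t. t \<in> U \<Longrightarrow> \<phi>' (\<gamma> t) = 0"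
    and \<sigma>: "\<sigma> = blowdown ChartX \<circ> \<gamma>" and mult: "param_multiplicity \<sigma> = enat m"
  shows "has_order (fst \<circ> \<gamma>) m \<and> m > 0 \<and> branch_of 0 \<phi> \<sigma> \<and> branch_of q \<phi>' \<gamma> \<and>
    (\<exists>\<delta>. qdim germs1 (branch_ring q \<gamma>) \<delta> \<and> qdim germs1 (branch_ring 0 \<sigma>) (\<delta> + m * (m - 1) div 2))"
proof -
  define b where "b = snd q"
  have q': "q = (0, b)" using q by (simp add: b_def prod_eq_iff)
  define x where "x = fst \<circ> \<gamma>"
  define v where "v = snd \<circ> \<gamma>"
  have \<gamma>t: "\<gamma> t = (x t, v t)" for t by (simp add: x_def v_def)
  have \<gamma>': "\<gamma> = (\<lambda>t. (x t, v t))" by (rule ext) (rule \<gamma>t)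
  define y where "y = (\<lambda>t. x t * v t)"
  have \<sigma>': "\<sigma> = (\<lambda>t. (x t, y t))" by (rule ext) (simp add: \<sigma> blowdown_X x_def v_def y_def)
  have x0: "x 0 = 0" and v0: "v 0 = b" using \<gamma>q q' \<gamma>t[of 0] by auto
  have xan: "x analytic_on {0}" and van: "v analytic_on {0}"
    using U unfolding analytic_at x_def v_def by blast+
  have cg: "curve_germ q \<gamma>" using \<gamma>q xan van by (simp add: curve_germ_def x_def v_def)
  have evU: "\<forall>\<^sub>F t in nhds 0. t \<in> U" by (rule eventually_nhds_in_open[OF U(1,2)])
  have \<phi>'0: "germ_eq (\<lambda>t. \<phi>' (\<gamma> t)) (\<lambda>_. 0)"
    unfolding germ_eq_def using evU by eventually_elim (rule \<phi>'U)
  from st obtain k where \<phi>': "\<phi>' \<in> hol_germs q" and k: "\<forall>\<^sub>F z in nhds q. \<phi> (blowdown ChartX z) = fst z ^ k * \<phi>' z"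
    and nd: "\<not> germ_dvd q fst \<phi>'" unfolding strict_transform_curve_def by auto
  have \<phi>: "\<phi> \<in> hol_germs 0" using irr by (simp add: germ_irreducible_def)
  \<comment> \<open>A branch inside the exceptional line would be constant, because \<phi>' has
    isolated zeros on that line; this contradicts injectivity.\<close>
  have xnz: "\<not> germ_eq x (\<lambda>_. 0)"
  proof
    assume "germ_eq x (\<lambda>_. 0)"
    hence xz: "\<forall>\<^sub>F t in nhds 0. x t = 0" by (simp add: germ_eq_def)
    have "\<forall>\<^sub>F s in at 0. \<phi>' (0, b + s) \<noteq> 0" using restriction_nonzero \<phi>' nd q' by blast
    hence "\<forall>\<^sub>F s in nhds 0. s \<noteq> 0 \<longrightarrow> \<phi>' (0, b + s) \<noteq> 0" by (simp add: eventually_at_filter)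
    moreover have "filterlim (\<lambda>t. v t - b) (nhds 0) (nhds 0)"
      by (rule analytic_germ_filterlim) (use van v0 in \<open>auto intro!: analytic_intros\<close>)
    ultimately have "\<forall>\<^sub>F t in nhds 0. v t - b \<noteq> 0 \<longrightarrow> \<phi>' (0, b + (v t - b)) \<noteq> 0"
      by (rule eventually_compose_filterlim)
    hence "\<forall>\<^sub>F t in nhds (0::complex). t = 0" using xz evU
    proof eventually_elim
      case (elim t)
      have "\<phi>' (0, v t) = 0" using \<phi>'U[OF elim(3)] elim(2) \<gamma>t by simp
      hence "v t = b" using elim(1) by auto
      hence "\<gamma> t = \<gamma> 0" using elim(2) \<gamma>t x0 v0 by simp
      thus "t = 0" using inj_onD[OF inj] elim(3) U(2) by blast
    qed
    hence "germ_eq (\<lambda>t. t) (\<lambda>_. 0)" by (simp add: germ_eq_def)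
    moreover have "has_order (\<lambda>t. t) 1" unfolding has_order_def by (intro exI[of _ "\<lambda>_. 1"]) auto
    ultimately show False using has_order_not_zero by blast
  qed
  then obtain n where n: "has_order x n" using analytic_has_order[OF xan] by blast
  then obtain u where u: "u analytic_on {0}" "u 0 \<noteq> 0" "germ_eq x (\<lambda>t. t ^ n * u t)"
    unfolding has_order_def by blast
  \<comment> \<open>The second coordinate of \<sigma> is x v, of order at least that of x, so the
    minimum is attained by x.\<close>
  have "n = m"
  proof -
    have "vanishing_order1 (fst \<circ> \<sigma>) 0 = enat n"
      using has_order_imp_vanishing_order1[OF n] by (simp add: \<sigma>' o_def)
    moreover have "enat n \<le> vanishing_order1 (snd \<circ> \<sigma>) 0"
    proof (rule vanishing_order1_ge[of "\<lambda>t. u t * v t"])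
      show "germ_eq (snd \<circ> \<sigma>) (\<lambda>t. t ^ n * (u t * v t))"
        using germ_eq_mult[OF u(3) germ_eq_refl[of v]] by (simp add: \<sigma>' o_def y_def mult.assoc)
    qed (intro analytic_on_mult u van)
    ultimately have "param_multiplicity \<sigma> = enat n" by (simp add: param_multiplicity_def min_def)
    thus ?thesis using mult by simp
  qed
  hence ord: "has_order x m" and u: "u analytic_on {0}" "u 0 \<noteq> 0" "germ_eq x (\<lambda>t. t ^ m * u t)"
    using n u by auto
  have m: "m > 0"
  proof (rule ccontr)
    assume "\<not> m > 0"
    hence "x 0 = u 0" using germ_eq_at[OF u(3)] by simp
    thus False using x0 u(2) by simp
  qed
  have yan: "y analytic_on {0}" unfolding y_def by (intro analytic_on_mult xan van)
  have y0: "y 0 = 0" by (simp add: y_def x0)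
  have injx: "inj_on (\<lambda>t. (x t, v t)) U" using inj by (simp add: \<gamma>')
  \<comment> \<open>Off t = 0 the coordinate x is nonzero and v is recovered as y / x, so
    injectivity passes to the blown-down branch near 0.\<close>
  obtain U' where U': "open U'" "0 \<in> U'" "inj_on (\<lambda>t. (x t, y t)) U'"
  proof -
    have "\<forall>\<^sub>F t in nhds 0. t \<noteq> 0 \<longrightarrow> x t \<noteq> 0" using has_order_imp_nonzero[OF ord] by (simp add: eventually_at_filter)
    with evU have "\<forall>\<^sub>F t in nhds 0. t \<in> U \<and> (t \<noteq> 0 \<longrightarrow> x t \<noteq> 0)" by eventually_elim simp
    then obtain S where S: "open S" "0 \<in> S" "\<And>t. t \<in> S \<Longrightarrow> t \<in> U \<and> (t \<noteq> 0 \<longrightarrow> x t \<noteq> 0)"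
      unfolding eventually_nhds by blast
    have "inj_on (\<lambda>t. (x t, y t)) S"
    proof (rule inj_onI)
      fix s t assume st: "s \<in> S" "t \<in> S" "(x s, y s) = (x t, y t)"
      show "s = t"
      proof (cases "x s = 0")
        case True thus ?thesis using S(3)[OF st(1)] S(3)[OF st(2)] st(3) by auto
      next
        case False
        hence "(x s, v s) = (x t, v t)" using st(3) by (auto simp: y_def)
        thus ?thesis using inj_onD[OF injx] S(3)[OF st(1)] S(3)[OF st(2)] by blast
      qed
    qed
    thus ?thesis using that S(1,2) by blast
  qed
  obtain a where a: "\<And>i. a i analytic_on {0}"
    and a1: "germ_eq (\<lambda>t. monic_germ m a (x t, v t)) (\<lambda>_. 0)"
    and a2: "\<And>f. f \<in> hol_germs (0, v 0) \<Longrightarrow> germ_eq (\<lambda>t. f (x t, v t)) (\<lambda>_. 0) \<Longrightarrow> germ_dvd (0, v 0) (monic_germ m a) f"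
    and a3: "\<not> germ_eq (\<lambda>t. partial_y (monic_germ m a) (x t, v t)) (\<lambda>_. 0)"
    and a4: "\<And>y. monic_germ m a (0, y) = (y - v 0) ^ m"
    and a5: "\<And>c i. \<forall>i<m. c i analytic_on {0} \<Longrightarrow> germ_eq (\<lambda>t. \<Sum>i<m. c i (x t) * v t ^ i) (\<lambda>_. 0) \<Longrightarrow>
        i < m \<Longrightarrow> germ_eq (c i) (\<lambda>_. 0)"
    and a6: "\<exists>N. \<forall>f. f analytic_on {0} \<longrightarrow> (\<exists>c. (\<forall>i. c i analytic_on {0}) \<and>
        germ_eq (\<lambda>t. x t ^ N * f t) (\<lambda>t. \<Sum>i<m. c i (x t) * v t ^ i))"
    by (rule branch_weierstrass[OF ord m van U(1,2) injx], rule that)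
  obtain a' where a': "\<And>i. a' i analytic_on {0}"
    and a'1: "germ_eq (\<lambda>t. monic_germ m a' (x t, y t)) (\<lambda>_. 0)"
    and a'2: "\<And>f. f \<in> hol_germs (0, y 0) \<Longrightarrow> germ_eq (\<lambda>t. f (x t, y t)) (\<lambda>_. 0) \<Longrightarrow> germ_dvd (0, y 0) (monic_germ m a') f"
    and a'3: "\<not> germ_eq (\<lambda>t. partial_y (monic_germ m a') (x t, y t)) (\<lambda>_. 0)"
    and a'4: "\<And>z. monic_germ m a' (0, z) = (z - y 0) ^ m"
    and a'5: "\<And>c i. \<forall>i<m. c i analytic_on {0} \<Longrightarrow> germ_eq (\<lambda>t. \<Sum>i<m. c i (x t) * y t ^ i) (\<lambda>_. 0) \<Longrightarrow>
        i < m \<Longrightarrow> germ_eq (c i) (\<lambda>_. 0)"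
    and a'6: "\<exists>N. \<forall>f. f analytic_on {0} \<longrightarrow> (\<exists>c. (\<forall>i. c i analytic_on {0}) \<and>
        germ_eq (\<lambda>t. x t ^ N * f t) (\<lambda>t. \<Sum>i<m. c i (x t) * y t ^ i))"
    by (rule branch_weierstrass[OF ord m yan U'], rule that)
  let ?P = "monic_germ m a" and ?P' = "monic_germ m a'"
  have P: "?P \<in> hol_germs q" by (rule monic_germ_hol) (use a q in simp)
  have P': "?P' \<in> hol_germs 0" by (rule monic_germ_hol) (use a' in simp)
  have cg\<sigma>: "curve_germ 0 \<sigma>" using xan yan x0 y0 by (simp add: curve_germ_def \<sigma>' o_def zero_prod_def)
  have zero: "(0, y 0) = (0 :: complex \<times> complex)" and qv: "(0, v 0) = q" by (simp_all add: y0 v0 q' zero_prod_def)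
  \<comment> \<open>Multiplying the relation for v by x^m gives a monic relation for y = x v with
    coefficients x^(m - i) \<open>a i\<close>. Independence of the powers of y over C{x} identifies
    them with the \<open>a' i\<close>.\<close>
  have coeff: "germ_eq (a' i) (\<lambda>s. s ^ (m - i) * a i s)" if i: "i < m" for i
  proof -
    define c where "c i s = a' i s - s ^ (m - i) * a i s" for i s
    have can: "\<forall>i<m. c i analytic_on {0}"
      unfolding c_def by (intro allI impI analytic_on_diff analytic_on_mult analytic_on_power analytic_on_ident a a')
    have "germ_eq (\<lambda>t. \<Sum>i<m. c i (x t) * y t ^ i) (\<lambda>_. 0)"
      using a1 a'1 unfolding germ_eq_def
    proof eventually_elim
      case (elim t)
      have "(\<Sum>i<m. x t ^ (m - i) * a i (x t) * y t ^ i) = (\<Sum>i<m. x t ^ m * (a i (x t) * v t ^ i))"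
      proof (intro sum.cong refl)
        fix i assume "i \<in> {..<m}"
        hence "x t ^ m = x t ^ (m - i) * x t ^ i" by (simp flip: power_add)
        thus "x t ^ (m - i) * a i (x t) * y t ^ i = x t ^ m * (a i (x t) * v t ^ i)"
          by (simp add: y_def power_mult_distrib)
      qed
      also have "\<dots> = x t ^ m * (- (v t ^ m))"
        using elim(1) by (simp add: monic_germ_def add_eq_0_iff flip: sum_distrib_left)
      also have "\<dots> = - (y t ^ m)" by (simp add: y_def power_mult_distrib)
      finally have "(\<Sum>i<m. x t ^ (m - i) * a i (x t) * y t ^ i) = - (y t ^ m)" .
      thus ?case using elim(2) by (simp add: c_def left_diff_distrib sum_subtractf monic_germ_def)
    qed
    from a'5[OF can this i] show ?thesis unfolding germ_eq_def by eventually_elim (simp add: c_def)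
  qed
  have PP': "\<forall>\<^sub>F z in nhds q. ?P' (blowdown ChartX z) = fst z ^ m * ?P z"
  proof -
    have "\<forall>\<^sub>F s in nhds 0. \<forall>i\<in>{..<m}. a' i s = s ^ (m - i) * a i s"
      by (rule eventually_ball_finite) (use coeff in \<open>auto simp: germ_eq_def\<close>)
    moreover have "filterlim fst (nhds (fst q)) (nhds q)" by (intro tendsto_intros filterlim_ident)
    ultimately have "\<forall>\<^sub>F z in nhds q. \<forall>i\<in>{..<m}. a' i (fst z) = fst z ^ (m - i) * a i (fst z)"
      using eventually_compose_filterlim q by fastforce
    thus ?thesis
    proof eventually_elim
      case (elim z)
      have "(\<Sum>i<m. a' i (fst z) * (fst z * snd z) ^ i) = (\<Sum>i<m. fst z ^ m * (a i (fst z) * snd z ^ i))"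
      proof (intro sum.cong refl)
        fix i assume i: "i \<in> {..<m}"
        hence "fst z ^ m = fst z ^ (m - i) * fst z ^ i" by (simp flip: power_add)
        thus "a' i (fst z) * (fst z * snd z) ^ i = fst z ^ m * (a i (fst z) * snd z ^ i)"
          using elim i by (simp add: power_mult_distrib)
      qed
      thus ?case by (simp add: blowdown_X monic_germ_def distrib_left sum_distrib_left power_mult_distrib)
    qed
  qed
  have \<phi>0: "germ_eq (\<lambda>t. \<phi> (\<sigma> t)) (\<lambda>_. 0)"
    using curve_germ_eventually[OF cg k] \<phi>'0 unfolding germ_eq_def by eventually_elim (simp add: \<sigma>)
  have "germ_dvd 0 ?P' \<phi>"
    using a'2[unfolded zero, OF \<phi>] \<phi>0 by (simp add: \<sigma>')
  then obtain w where w: "w \<in> hol_germs 0" "\<forall>\<^sub>F z in nhds 0. \<phi> z = w z * ?P' z"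
    unfolding germ_dvd_def by blast
  \<comment> \<open>The polynomial vanishes at the origin since m > 0. So in the factorization of
    the irreducible \<phi> it must be the cofactor w that is a unit.\<close>
  have "\<not> germ_unit 0 ?P'"
  proof
    assume "germ_unit 0 ?P'"
    then obtain h where "\<forall>\<^sub>F z in nhds 0. 1 = h z * ?P' z" unfolding germ_unit_def germ_dvd_def by blast
    from eventually_nhds_x_imp_x[OF this] have "1 = h 0 * ?P' 0" .
    moreover have "?P' 0 = 0" using a'4[of 0] m by (simp add: y0 zero_prod_def power_0_left)
    ultimately show False by simp
  qed
  hence "germ_unit 0 w" using irr w P' unfolding germ_irreducible_def by blast
  then obtain h where h: "h \<in> hol_germs 0" "\<forall>\<^sub>F z in nhds 0. 1 = h z * w z" unfolding germ_unit_def germ_dvd_def by blast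
  have dvd: "germ_dvd 0 \<phi> ?P'"
  proof -
    have "\<forall>\<^sub>F z in nhds 0. ?P' z = h z * \<phi> z"
      using h(2) w(2)
    proof eventually_elim
      case (elim z)
      have "?P' z = (h z * w z) * ?P' z" using elim(1) by simp
      thus ?case using elim(2) by simp
    qed
    thus ?thesis by (rule germ_dvdI[OF h(1)])
  qed
  have br\<sigma>: "branch_of 0 \<phi> \<sigma>"
    by (rule branch_of_divisor[OF cg\<sigma> P' _ _ \<phi> \<phi>0 dvd]) (use a'2 a'3 in \<open>simp_all add: zero \<sigma>'\<close>)
  have br: "branch_of q \<phi>' \<gamma>"
  proof -
    define w' where "w' z = w (blowdown ChartX z)" for z
    have w': "w' \<in> hol_germs q" unfolding w'_def[abs_def] by (rule hol_germs_blowdown_X[OF w(1) q])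
    have "1 = h 0 * w 0" using eventually_nhds_x_imp_x[OF h(2)] .
    hence w'q: "w' q \<noteq> 0" by (auto simp: w'_def blowdown_X q zero_prod_def)
    have eq: "\<forall>\<^sub>F z in nhds q. fst z ^ k * \<phi>' z = fst z ^ m * (w' z * ?P z)"
      using k blowdown_X_eventually[OF q w(2)] PP' by eventually_elim (simp add: w'_def mult_ac)
    have wP: "(\<lambda>z. w' z * ?P z) \<in> hol_germs (0, b)" "\<phi>' \<in> hol_germs (0, b)"
      using hol_germs_mult[OF w' P] \<phi>' by (simp_all add: q')
    \<comment> \<open>For k < m the exceptional equation would divide \<phi>'. For k > m the germ w'
      P would vanish on x = 0, where it is a nonzero factor times s^m.\<close>
    have km: "k = m"
    proof (rule linorder_cases)
      assume "k < m"
      hence "\<forall>\<^sub>F z in nhds (0, b). \<phi>' z = fst z ^ (m - k) * (w' z * ?P z)"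
        using hol_germs_cancel_fst_power[OF wP(2,1) _ eq[unfolded q']] by simp
      hence "\<forall>\<^sub>F z in nhds q. \<phi>' z = (fst z ^ (m - k - 1) * (w' z * ?P z)) * fst z"
        unfolding q'
      proof eventually_elim
        case (elim z)
        have "fst z ^ (m - k) = fst z ^ (m - k - 1) * fst z" 
          using power_Suc[of "fst z" "m - Suc k"] \<open>k < m\<close> by (simp add: Suc_diff_Suc mult.commute del: power_Suc)
        thus ?case using elim by simp
      qed
      hence "germ_dvd q fst \<phi>'" by (rule germ_dvdI[rotated]) (intro hol_germs_intros w' P)
      thus ?thesis using nd by contradiction
    next
      assume "m < k"
      hence "\<forall>\<^sub>F z in nhds (0, b). w' z * ?P z = fst z ^ (k - m) * \<phi>' z"
        using hol_germs_cancel_fst_power[OF wP, of m k] eq by (simp add: q' eq_commute)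
      hence "\<forall>\<^sub>F z in nhds (0, b). w' z * ?P z = fst z * (fst z ^ (k - m - 1) * \<phi>' z)"
      proof eventually_elim
        case (elim z)
        have "fst z ^ (k - m) = fst z * fst z ^ (k - m - 1)" 
          using power_Suc[of "fst z" "k - Suc m"] \<open>m < k\<close> by (simp add: Suc_diff_Suc del: power_Suc)
        thus ?case using elim by simp
      qed
      from dvd_fst_restriction[OF this] have "\<forall>\<^sub>F s in at 0. w' (0, b + s) * s ^ m = 0"
        by (simp add: a4 v0)
      moreover have "\<forall>\<^sub>F s in at 0. w' (0, b + s) \<noteq> 0"
        using analytic_nonzero_near[OF restriction_analytic[of w' b]] w' w'q
        by (auto simp: q' eventually_nhds_conv_at)
      moreover have "\<forall>\<^sub>F s in at (0::complex). s \<noteq> 0" by (simp add: eventually_at_filter)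
      ultimately have "\<forall>\<^sub>F s in at (0::complex). False" by eventually_elim auto
      thus ?thesis by simp
    qed
    have "\<forall>\<^sub>F z in nhds (0, b). \<phi>' z = fst z ^ (m - k) * (w' z * ?P z)"
      using hol_germs_cancel_fst_power[OF wP(2,1) _ eq[unfolded q']] km by simp
    hence eq': "\<forall>\<^sub>F z in nhds q. \<phi>' z = w' z * ?P z" by (simp add: km q')
    have "\<forall>\<^sub>F z in nhds q. w' z \<noteq> 0"
    proof -
      have "isCont w' q" using eventually_nhds_x_imp_x[OF hol_germs_eventually(2)[OF w']] .
      hence "(w' \<longlongrightarrow> w' q) (nhds q)" by (simp add: continuous_at tendsto_at_iff_tendsto_nhds)
      thus ?thesis using w'q tendsto_imp_eventually_ne by blast
    qed
    with eq' have "\<forall>\<^sub>F z in nhds q. ?P z = inverse (w' z) * \<phi>' z" by eventually_elim simp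
    hence "germ_dvd q \<phi>' ?P" by (rule germ_dvdI[OF hol_germs_inverse[OF w' w'q]])
    thus ?thesis
      by (intro branch_of_divisor[OF cg P _ _ \<phi>' \<phi>'0]) (use a2 a3 in \<open>simp_all add: qv \<gamma>'\<close>)
  qed
  obtain N where N: "\<And>f. f analytic_on {0} \<Longrightarrow> \<exists>c. (\<forall>i. c i analytic_on {0}) \<and>
        germ_eq (\<lambda>t. x t ^ N * f t) (\<lambda>t. \<Sum>i<m. c i (x t) * v t ^ i)" using a6 by blast
  obtain N' where N': "\<And>f. f analytic_on {0} \<Longrightarrow> \<exists>c. (\<forall>i. c i analytic_on {0}) \<and>
        germ_eq (\<lambda>t. x t ^ N' * f t) (\<lambda>t. \<Sum>i<m. c i (x t) * y t ^ i)" using a'6 by blast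
  have R: "branch_ring q \<gamma> = power_span m x v"
    using branch_ring_eq_power_span[OF ord m van a a1 N] by (simp add: qv \<gamma>')
  have R': "branch_ring 0 \<sigma> = power_span m x y"
    using branch_ring_eq_power_span[OF ord m yan a' a'1 N'] by (simp add: zero \<sigma>')
  have S: "germ_space (power_span m x v)" and S': "germ_space (power_span m x y)"
    by (rule germ_space_power_span[OF xan x0 van] germ_space_power_span[OF xan x0 yan])+
  have sub: "power_span m x y \<subseteq> power_span m x v"
  proof
    fix g assume "g \<in> power_span m x y"
    then obtain c where c: "\<And>i. c i analytic_on {0}" "germ_eq g (\<lambda>t. \<Sum>i<m. c i (x t) * y t ^ i)"
      unfolding power_span_def by blast
    show "g \<in> power_span m x v"
    proof (rule power_spanI)
      show "germ_eq g (\<lambda>t. \<Sum>i<m. (c i (x t) * x t ^ i) * v t ^ i)"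
        using c(2) by (simp add: y_def power_mult_distrib mult.assoc)
    qed (intro analytic_on_mult analytic_on_power analytic_on_ident c)
  qed
  obtain d where d: "qdim germs1 (power_span m x v) d"
    using qdim_power_span[OF ord m N S] by blast
  have "qdim (power_span m x v) (power_span m x y) (m * (m - 1) div 2)"
    unfolding y_def
  proof (rule power_span_blowup_index[OF xan x0])
    show "germ_eq (c i) (\<lambda>_. 0)" if "\<forall>i<m. c i analytic_on {0}"
      "germ_eq (\<lambda>t. \<Sum>i<m. c i (x t) * v t ^ i) (\<lambda>_. 0)" "i < m" for c i
      using that by (rule a5)
  qed
  from qdim_trans[OF germ_space_lin[OF S] germ_space_lin[OF S'] sub germ_space_subset[OF S] d this]
  have "qdim germs1 (power_span m x y) (d + m * (m - 1) div 2)" .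
  thus ?thesis using ord m br\<sigma> br d by (auto simp: R R' x_def)
qed

section \<open>Blowing up a form\<close>

text \<open>The a j are the coefficients of the homogeneous part of degree n. The rest lies in the
  power n + 1 of the maximal ideal and is written through the monomials generating that
  power.\<close>

definition homog_expansion :: "nat \<Rightarrow> cfun2 \<Rightarrow> (nat \<Rightarrow> complex) \<Rightarrow> bool" where
  "homog_expansion n f a \<longleftrightarrow> (\<exists>g. (\<forall>j. g j \<in> hol_germs 0) \<and> (\<forall>\<^sub>F z in nhds 0. f z =
     (\<Sum>j\<le>n. a j * fst z ^ (n - j) * snd z ^ j) + (\<Sum>j\<le>Suc n. fst z ^ (Suc n - j) * snd z ^ j * g j z)))"

lemma iterated_partials: "(partial_x ^^ i) F (x, y) = (deriv ^^ i) (\<lambda>s. F (s, y)) x"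
  "(partial_y ^^ j) F (x, y) = (deriv ^^ j) (\<lambda>s. F (x, s)) y"
proof -
  have p: "partial_x G (x, y) = deriv (\<lambda>s. G (s, y)) x" "partial_y G (x, y) = deriv (\<lambda>s. G (x, s)) y" for G x y
    by (simp_all add: partial_x_def partial_y_def)
  show "(partial_x ^^ i) F (x, y) = (deriv ^^ i) (\<lambda>s. F (s, y)) x" for x
  proof (induction i arbitrary: x)
    case (Suc i)
    have "(\<lambda>s. (partial_x ^^ i) F (s, y)) = (deriv ^^ i) (\<lambda>s. F (s, y))" using Suc by (rule ext)
    thus ?case by (simp add: p)
  qed simp
  show "(partial_y ^^ j) F (x, y) = (deriv ^^ j) (\<lambda>s. F (x, s)) y" for y
  proof (induction j arbitrary: y)
    case (Suc j)
    have "(\<lambda>s. (partial_y ^^ j) F (x, s)) = (deriv ^^ j) (\<lambda>s. F (x, s))" using Suc by (rule ext)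
    thus ?case by (simp add: p)
  qed simp
qed

text \<open>Expand first in y, then each coefficient in x. The order hypothesis kills every term of
  total degree below n.\<close>

lemma homog_expansion_exists:
  assumes f: "f \<in> hol_germs 0" and n: "enat n \<le> vanishing_order2 f 0"
  shows "homog_expansion n f (\<lambda>j. (partial_x ^^ (n - j)) ((partial_y ^^ j) f) 0 / (fact (n - j) * fact j))"
proof -
  let ?D = "\<lambda>i j. (partial_x ^^ i) ((partial_y ^^ j) f) 0"
  have D0: "?D i j = 0" if "i + j < n" for i j
  proof (rule ccontr)
    assume "?D i j \<noteq> 0"
    hence "vanishing_order2 f 0 \<le> enat (i + j)" unfolding vanishing_order2_def by (intro Inf_lower) blast
    thus False using n that by (metis enat_ord_simps(1) leD order_trans)
  qed
  have f': "f \<in> hol_germs (0, 0)" using f by (simp add: zero_prod_def)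
  obtain c h where c: "\<And>j. c j analytic_on {0}" and h: "h \<in> hol_germs (0, 0)"
    and eq: "\<forall>\<^sub>F z in nhds (0, 0). f z = (\<Sum>j<Suc n. c j (fst z) * (snd z - 0) ^ j) + (snd z - 0) ^ Suc n * h z"
    and cj: "\<And>j. \<forall>\<^sub>F x in nhds 0. c j x = (deriv ^^ j) (\<lambda>s. f (x, s)) 0 / fact j"
    by (rule hol_germs_taylor_y[OF f', of "Suc n"], rule that)
  define \<alpha> where "\<alpha> j = ?D (n - j) j / (fact (n - j) * fact j)" for j
  have "\<forall>j\<in>{..n}. \<exists>d. d analytic_on {0} \<and> (\<forall>\<^sub>F x in nhds 0. c j x = \<alpha> j * x ^ (n - j) + x ^ (Suc n - j) * d x)"
  proof
    fix j assume "j \<in> {..n}"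
    hence j: "j \<le> n" by simp
    have an: "(\<lambda>x. fact j * c j x) analytic_on {0}" by (intro analytic_intros c)
    have "\<forall>\<^sub>F x in nhds 0. fact j * c j x = (partial_y ^^ j) f (x, 0)"
      using cj[of j] by eventually_elim (simp add: iterated_partials)
    hence der: "(deriv ^^ i) (\<lambda>x. fact j * c j x) 0 = ?D i j" for i
      by (subst higher_deriv_cong_ev[where g = "\<lambda>x. (partial_y ^^ j) f (x, 0)", OF _ refl])
        (simp_all add: iterated_partials zero_prod_def)
    from analytic_taylor[OF an, of "Suc n - j"] obtain d where d: "d analytic_on {0}"
      "\<forall>\<^sub>F y in nhds 0. fact j * c j y = (\<Sum>i<Suc n - j. (deriv ^^ i) (\<lambda>x. fact j * c j x) 0 / fact i * (y - 0) ^ i)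
          + (y - 0) ^ (Suc n - j) * d y" .
    have S: "(\<Sum>i<Suc n - j. ?D i j / fact i * y ^ i) = ?D (n - j) j / fact (n - j) * y ^ (n - j)" for y
    proof -
      have "(\<Sum>i<Suc n - j. ?D i j / fact i * y ^ i) = (\<Sum>i\<in>{n - j}. ?D i j / fact i * y ^ i)"
        using j by (intro sum.mono_neutral_right) (auto simp: D0)
      thus ?thesis by simp
    qed
    have "\<forall>\<^sub>F x in nhds 0. c j x = \<alpha> j * x ^ (n - j) + x ^ (Suc n - j) * (d x / fact j)"
      using d(2)
    proof eventually_elim
      case (elim y)
      hence "fact j * c j y = ?D (n - j) j / fact (n - j) * y ^ (n - j) + y ^ (Suc n - j) * d y"
        by (simp only: der S diff_zero)
      hence "c j y = (?D (n - j) j / fact (n - j) * y ^ (n - j) + y ^ (Suc n - j) * d y) / fact j"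
        by (simp add: eq_divide_eq mult.commute)
      thus ?case by (simp add: \<alpha>_def add_divide_distrib)
    qed
    moreover have "(\<lambda>x. d x / fact j) analytic_on {0}" using d(1) by (intro analytic_intros) auto
    ultimately show "\<exists>d. d analytic_on {0} \<and> (\<forall>\<^sub>F x in nhds 0. c j x = \<alpha> j * x ^ (n - j) + x ^ (Suc n - j) * d x)"
      by (intro exI[of _ "\<lambda>x. d x / fact j"] conjI)
  qed
  from bchoice[OF this] obtain d where "\<forall>j\<in>{..n}. d j analytic_on {0} \<and>
      (\<forall>\<^sub>F x in nhds 0. c j x = \<alpha> j * x ^ (n - j) + x ^ (Suc n - j) * d j x)" by blast
  hence d: "\<And>j. j \<le> n \<Longrightarrow> d j analytic_on {0}"
    "\<And>j. j \<le> n \<Longrightarrow> \<forall>\<^sub>F x in nhds 0. c j x = \<alpha> j * x ^ (n - j) + x ^ (Suc n - j) * d j x" by simp_all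
  \<comment> \<open>For j \<le> n the remainder comes from the expansion in x; the index n + 1
    carries the remainder of the expansion in y.\<close>
  define g where "g j = (if j \<le> n then (\<lambda>z. d j (fst z)) else h)" for j
  have "g j \<in> hol_germs 0" for j
    using d(1) h by (auto simp: g_def zero_prod_def intro!: hol_germs_analytic_fst)
  moreover have "\<forall>\<^sub>F z in nhds 0. f z =
     (\<Sum>j\<le>n. \<alpha> j * fst z ^ (n - j) * snd z ^ j) + (\<Sum>j\<le>Suc n. fst z ^ (Suc n - j) * snd z ^ j * g j z)"
  proof -
    have "\<forall>\<^sub>F x in nhds 0. \<forall>j\<in>{..n}. c j x = \<alpha> j * x ^ (n - j) + x ^ (Suc n - j) * d j x"
      by (rule eventually_ball_finite) (use d(2) in auto)
    moreover have "filterlim fst (nhds 0) (nhds (0::complex, 0::complex))"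
      by (rule tendsto_eq_rhs[OF tendsto_fst[OF filterlim_ident]]) simp
    ultimately have "\<forall>\<^sub>F z in nhds (0::complex, 0::complex). \<forall>j\<in>{..n}. c j (fst z) = \<alpha> j * fst z ^ (n - j) + fst z ^ (Suc n - j) * d j (fst z)"
      by (rule eventually_compose_filterlim)
    thus ?thesis using eq unfolding zero_prod_def
    proof eventually_elim
      case (elim z)
      have "f z = (\<Sum>j\<le>n. c j (fst z) * snd z ^ j) + snd z ^ Suc n * h z"
        using elim(2) by (simp only: lessThan_Suc_atMost diff_zero)
      also have "(\<Sum>j\<le>n. c j (fst z) * snd z ^ j) =
          (\<Sum>j\<le>n. \<alpha> j * fst z ^ (n - j) * snd z ^ j + fst z ^ (Suc n - j) * snd z ^ j * g j z)"
        using elim(1) by (intro sum.cong refl) (simp add: g_def algebra_simps)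
      finally show ?case by (simp add: sum.distrib g_def)
    qed
  qed
  ultimately show ?thesis unfolding homog_expansion_def \<alpha>_def by blast
qed

text \<open>A finite infimum excludes the empty set, and a nonempty set of extended naturals
  contains its infimum.\<close>

lemma vanishing_order2_attained:
  assumes "vanishing_order2 f 0 = enat n"
  shows "\<exists>j\<le>n. (partial_x ^^ (n - j)) ((partial_y ^^ j) f) 0 \<noteq> 0"
proof -
  define S where "S = {enat (i + j) |i j. (partial_x ^^ i) ((partial_y ^^ j) f) 0 \<noteq> 0}"
  have inf: "Inf S = enat n" using assms by (simp add: vanishing_order2_def S_def)
  have "S \<noteq> {}"
  proof
    assume "S = {}"
    with inf show False by (simp add: Inf_enat_def)
  qed
  then obtain s where "s \<in> S" by blast
  hence "Inf S \<in> S" by (rule wellorder_InfI)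
  hence "enat n \<in> S" by (simp only: inf)
  then obtain i j where ij: "enat n = enat (i + j)" "(partial_x ^^ i) ((partial_y ^^ j) f) 0 \<noteq> 0"
    unfolding S_def by blast
  hence "n - j = i" "j \<le> n" by auto
  with ij(2) show ?thesis by blast
qed

lemma alg_multiplicity_expansions:
  assumes "fst \<omega> \<in> hol_germs 0" "snd \<omega> \<in> hol_germs 0" "alg_multiplicity 0 \<omega> = enat \<nu>"
  obtains a b where "homog_expansion \<nu> (fst \<omega>) a" "homog_expansion \<nu> (snd \<omega>) b" "\<exists>j\<le>\<nu>. a j \<noteq> 0 \<or> b j \<noteq> 0"
proof -
  let ?a = "\<lambda>f j. (partial_x ^^ (\<nu> - j)) ((partial_y ^^ j) f) 0 / (fact (\<nu> - j) * fact j)"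
  have mn: "enat \<nu> = min (vanishing_order2 (fst \<omega>) 0) (vanishing_order2 (snd \<omega>) 0)"
    using assms(3) by (simp add: alg_multiplicity_def)
  have "homog_expansion \<nu> (fst \<omega>) (?a (fst \<omega>))" "homog_expansion \<nu> (snd \<omega>) (?a (snd \<omega>))"
    by (intro homog_expansion_exists assms(1,2); simp add: mn)+
  moreover have "vanishing_order2 (fst \<omega>) 0 = enat \<nu> \<or> vanishing_order2 (snd \<omega>) 0 = enat \<nu>"
    using mn by (auto simp: min_def split: if_splits)
  hence "\<exists>j\<le>\<nu>. ?a (fst \<omega>) j \<noteq> 0 \<or> ?a (snd \<omega>) j \<noteq> 0" using vanishing_order2_attained by fastforce
  ultimately show ?thesis by (rule that)
qed

lemma homog_expansion_swap:
  assumes "homog_expansion n f a" shows "homog_expansion n (f \<circ> prod.swap) (\<lambda>j. a (n - j))"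
proof -
  from assms obtain g where g: "\<And>j. g j \<in> hol_germs 0" "\<forall>\<^sub>F z in nhds 0. f z =
     (\<Sum>j\<le>n. a j * fst z ^ (n - j) * snd z ^ j) + (\<Sum>j\<le>Suc n. fst z ^ (Suc n - j) * snd z ^ j * g j z)"
    unfolding homog_expansion_def by blast
  have sw0: "prod.swap 0 = (0 :: complex \<times> complex)" by (simp add: zero_prod_def)
  have rev: "(\<Sum>j\<le>k. F j) = (\<Sum>j\<le>k. F (k - j))" for F :: "nat \<Rightarrow> complex" and k :: nat
    using sum.atLeastAtMost_rev[of F 0 k] by (simp add: atMost_atLeast0)
  have lim: "filterlim prod.swap (nhds 0) (nhds (0 :: complex \<times> complex))"
    unfolding prod.swap_def[abs_def]
    by (rule tendsto_eq_rhs[OF tendsto_Pair[OF tendsto_snd[OF filterlim_ident] tendsto_fst[OF filterlim_ident]]])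
      (simp add: zero_prod_def)
  have "\<forall>\<^sub>F z in nhds 0. (f \<circ> prod.swap) z = (\<Sum>j\<le>n. a (n - j) * fst z ^ (n - j) * snd z ^ j) +
     (\<Sum>j\<le>Suc n. fst z ^ (Suc n - j) * snd z ^ j * (g (Suc n - j) \<circ> prod.swap) z)"
    using eventually_compose_filterlim[OF g(2) lim]
  proof eventually_elim
    case (elim z)
    have "(\<Sum>j\<le>n. a j * snd z ^ (n - j) * fst z ^ j) = (\<Sum>j\<le>n. a (n - j) * fst z ^ (n - j) * snd z ^ j)"
      by (subst rev) (intro sum.cong refl, simp)
    moreover have "(\<Sum>j\<le>Suc n. snd z ^ (Suc n - j) * fst z ^ j * g j (prod.swap z)) =
      (\<Sum>j\<le>Suc n. fst z ^ (Suc n - j) * snd z ^ j * g (Suc n - j) (prod.swap z))"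
      by (subst rev) (intro sum.cong refl, simp add: mult.commute)
    ultimately show ?case using elim by (simp add: o_def del: sum.atMost_Suc)
  qed
  moreover have "g (Suc n - j) \<circ> prod.swap \<in> hol_germs 0" for j
    using hol_germs_swap[OF g(1)[of "Suc n - j"]] by (simp only: sw0)
  ultimately show ?thesis unfolding homog_expansion_def by (intro exI[of _ "\<lambda>j. g (Suc n - j) \<circ> prod.swap"] conjI) auto
qed

text \<open>A monomial of degree k becomes x^k v^j, so x^n factors out and the rest keeps one more
  x.\<close>

lemma homog_expansion_blowdown_X:
  assumes "homog_expansion n f a" and q: "fst q = 0"
  obtains G where "G \<in> hol_germs q"
    "\<forall>\<^sub>F z in nhds q. f (blowdown ChartX z) = fst z ^ n * ((\<Sum>j\<le>n. a j * snd z ^ j) + fst z * G z)"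
proof -
  from assms(1) obtain g where g: "\<And>j. g j \<in> hol_germs 0" "\<forall>\<^sub>F z in nhds 0. f z =
     (\<Sum>j\<le>n. a j * fst z ^ (n - j) * snd z ^ j) + (\<Sum>j\<le>Suc n. fst z ^ (Suc n - j) * snd z ^ j * g j z)"
    unfolding homog_expansion_def by blast
  define G where "G z = (\<Sum>j\<le>Suc n. snd z ^ j * g j (blowdown ChartX z))" for z
  have "G \<in> hol_germs q" unfolding G_def[abs_def] by (intro hol_germs_intros hol_germs_blowdown_X g q)
  moreover have "\<forall>\<^sub>F z in nhds q. f (blowdown ChartX z) = fst z ^ n * ((\<Sum>j\<le>n. a j * snd z ^ j) + fst z * G z)"
    using blowdown_X_eventually[OF q g(2)]
  proof eventually_elim
    case (elim z)
    have p: "fst z ^ (k - j) * (fst z * snd z) ^ j = fst z ^ k * snd z ^ j" if "j \<le> k" for j k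
    proof -
      have "fst z ^ k = fst z ^ (k - j) * fst z ^ j" using that by (simp flip: power_add)
      thus ?thesis by (simp add: power_mult_distrib)
    qed
    have "(\<Sum>j\<le>n. a j * fst z ^ (n - j) * (fst z * snd z) ^ j) = fst z ^ n * (\<Sum>j\<le>n. a j * snd z ^ j)"
      unfolding sum_distrib_left using p by (intro sum.cong refl) (simp add: mult_ac)
    moreover have "(\<Sum>j\<le>Suc n. fst z ^ (Suc n - j) * (fst z * snd z) ^ j * g j (blowdown ChartX z)) = fst z ^ Suc n * G z"
      unfolding sum_distrib_left G_def using p[of _ "Suc n"] by (intro sum.cong refl) (simp only: atMost_iff mult.assoc)
    ultimately show ?case using elim
      by (simp add: blowdown_X[of z] distrib_left mult_ac del: sum.atMost_Suc)
  qed
  ultimately show ?thesis by (rule that)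
qed

lemma polynomial_eventually_zero:
  fixes c :: "nat \<Rightarrow> complex"
  assumes "\<forall>\<^sub>F s in at 0. (\<Sum>l\<le>n. c l * (b + s) ^ l) = 0" and "l \<le> n"
  shows "c l = 0"
proof -
  define p where "p = (\<Sum>l\<le>n. monom (c l) l)"
  have ev: "poly p y = (\<Sum>l\<le>n. c l * y ^ l)" for y by (simp add: p_def poly_sum poly_monom)
  have "p = 0"
  proof (rule ccontr)
    assume "p \<noteq> 0"
    hence fin: "finite ({y. poly p y = 0} - {b})" using poly_roots_finite by blast
    have "\<forall>\<^sub>F y in nhds b. y \<in> - ({y. poly p y = 0} - {b})"
      by (rule eventually_nhds_in_open[OF open_Compl[OF finite_imp_closed[OF fin]]]) simp
    moreover have "filterlim (\<lambda>s. b + s) (nhds b) (nhds 0)"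
      by (rule tendsto_eq_rhs[OF tendsto_add[OF tendsto_const filterlim_ident]]) simp
    ultimately have "\<forall>\<^sub>F s in nhds 0. b + s \<in> - ({y. poly p y = 0} - {b})"
      by (rule eventually_compose_filterlim)
    hence "\<forall>\<^sub>F s in at 0. s \<noteq> 0 \<longrightarrow> poly p (b + s) \<noteq> 0"
      unfolding eventually_nhds_conv_at by (auto elim!: eventually_mono)
    moreover have "\<forall>\<^sub>F s in at (0::complex). s \<noteq> 0" by (simp add: eventually_at_filter)
    ultimately have "\<forall>\<^sub>F s in at (0::complex). False" using assms(1) unfolding ev[symmetric] by eventually_elim auto
    thus False by simp
  qed
  hence "coeff p l = 0" by simp
  thus ?thesis using assms(2) by (simp add: p_def coeff_sum)
qed

text \<open>With A, B the homogeneous parts of degree n of the two components, these are the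
  coefficients of A(1, y) + y B(1, y), the dehomogenized tangent cone x A + y B. Its degree can
  reach n + 1.\<close>

definition tangent_coeff :: "nat \<Rightarrow> (nat \<Rightarrow> complex) \<Rightarrow> (nat \<Rightarrow> complex) \<Rightarrow> nat \<Rightarrow> complex" where
  "tangent_coeff n a b l = (if l \<le> n then a l else 0) + (if l = 0 then 0 else b (l - 1))"

lemma tangent_coeff_sum:
  "(\<Sum>l\<le>Suc n. tangent_coeff n a b l * y ^ l) = (\<Sum>j\<le>n. a j * y ^ j) + y * (\<Sum>j\<le>n. b j * y ^ j)"
proof -
  have "(\<Sum>l\<le>Suc n. tangent_coeff n a b l * y ^ l) =
    (\<Sum>l\<le>Suc n. (if l \<le> n then a l else 0) * y ^ l) + (\<Sum>l\<le>Suc n. (if l = 0 then 0 else b (l - 1)) * y ^ l)"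
    by (simp only: tangent_coeff_def distrib_right sum.distrib)
  also have "(\<Sum>l\<le>Suc n. (if l \<le> n then a l else 0) * y ^ l) = (\<Sum>j\<le>n. a j * y ^ j)" by simp
  also have "(\<Sum>l\<le>Suc n. (if l = 0 then 0 else b (l - 1)) * y ^ l) = (\<Sum>j\<le>n. b j * y ^ Suc j)"
    by (subst sum.atMost_Suc_shift) simp
  also have "\<dots> = y * (\<Sum>j\<le>n. b j * y ^ j)" by (simp add: sum_distrib_left mult_ac)
  finally show ?thesis .
qed

lemma pullback2_blowdown_X:
  "fst (pullback2 (blowdown ChartX) \<omega>) z = fst \<omega> (blowdown ChartX z) + snd z * snd \<omega> (blowdown ChartX z)"
  "snd (pullback2 (blowdown ChartX) \<omega>) z = fst z * snd \<omega> (blowdown ChartX z)"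
proof -
  obtain x v where z: "z = (x, v)" by (cases z)
  have "deriv (\<lambda>s. s * v) x = v" "deriv (\<lambda>s. x * s) v = x"
    by (rule DERIV_imp_deriv, auto intro!: derivative_eq_intros)+
  thus "fst (pullback2 (blowdown ChartX) \<omega>) z = fst \<omega> (blowdown ChartX z) + snd z * snd \<omega> (blowdown ChartX z)"
    "snd (pullback2 (blowdown ChartX) \<omega>) z = fst z * snd \<omega> (blowdown ChartX z)"
    by (simp_all add: pullback2_def partial_x_def partial_y_def z)
qed

lemma hol_germs_dvd_of_power_eq:
  assumes f: "f \<in> hol_germs (0, b)" and g: "g \<in> hol_germs (0, b)" and "k < n"
    and eq: "\<forall>\<^sub>F z in nhds (0, b). fst z ^ k * f z = fst z ^ n * g z"
  shows "germ_dvd (0, b) fst f"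
proof -
  have "\<forall>\<^sub>F z in nhds (0, b). f z = fst z ^ (n - k) * g z"
    using hol_germs_cancel_fst_power[OF f g _ eq] assms(3) by simp
  hence "\<forall>\<^sub>F z in nhds (0, b). f z = (fst z ^ (n - Suc k) * g z) * fst z"
  proof eventually_elim
    case (elim z)
    have "fst z ^ (n - k) = fst z ^ (n - Suc k) * fst z"
      using power_Suc[of "fst z" "n - Suc k"] \<open>k < n\<close> by (simp add: Suc_diff_Suc mult.commute del: power_Suc)
    thus ?case using elim by simp
  qed
  thus ?thesis by (rule germ_dvdI[rotated]) (intro hol_germs_intros g)
qed

text \<open>The pullback is x^\<nu> (P dx + x Q dv), where on x = 0 the germ P restricts to the
  tangent cone and Q to B(1, v). If the cone is nonzero, only x^\<nu> divides and the dv-coefficient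
  keeps a factor x: the divisor is invariant. If the cone vanishes, one more x comes out, and the
  dv-coefficient becomes Q, which is nonzero on x = 0.\<close>

lemma strict_transform_power_X:
  assumes A: "homog_expansion \<nu> (fst \<omega>) a" and B: "homog_expansion \<nu> (snd \<omega>) b"
    and nz: "\<exists>j\<le>\<nu>. a j \<noteq> 0 \<or> b j \<noteq> 0"
    and st: "strict_transform_form ChartX q \<omega> \<omega>'" and q: "fst q = 0"
  obtains k where
    "\<forall>\<^sub>F z in nhds q. fst (pullback2 (blowdown ChartX) \<omega>) z = fst z ^ k * fst \<omega>' z \<and>
       snd (pullback2 (blowdown ChartX) \<omega>) z = fst z ^ k * snd \<omega>' z"
    "if \<forall>l\<le>Suc \<nu>. tangent_coeff \<nu> a b l = 0 then k = Suc \<nu> \<and> \<not> germ_dvd q fst (snd \<omega>')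
     else k = \<nu> \<and> germ_dvd q fst (snd \<omega>')"
proof -
  define c where "c = snd q"
  have q': "q = (0, c)" using q by (simp add: c_def prod_eq_iff)
  from st obtain k where w: "fst \<omega>' \<in> hol_germs q" "snd \<omega>' \<in> hol_germs q"
    and k: "\<forall>\<^sub>F z in nhds q. fst (pullback2 (blowdown ChartX) \<omega>) z = fst z ^ k * fst \<omega>' z \<and>
       snd (pullback2 (blowdown ChartX) \<omega>) z = fst z ^ k * snd \<omega>' z"
    and nd: "\<not> (germ_dvd q fst (fst \<omega>') \<and> germ_dvd q fst (snd \<omega>'))"
    unfolding strict_transform_form_def by auto
  obtain G where G: "G \<in> hol_germs q"
    "\<forall>\<^sub>F z in nhds q. fst \<omega> (blowdown ChartX z) = fst z ^ \<nu> * ((\<Sum>j\<le>\<nu>. a j * snd z ^ j) + fst z * G z)"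
    by (rule homog_expansion_blowdown_X[OF A q])
  obtain H where H: "H \<in> hol_germs q"
    "\<forall>\<^sub>F z in nhds q. snd \<omega> (blowdown ChartX z) = fst z ^ \<nu> * ((\<Sum>j\<le>\<nu>. b j * snd z ^ j) + fst z * H z)"
    by (rule homog_expansion_blowdown_X[OF B q])
  define T where "T y = (\<Sum>l\<le>Suc \<nu>. tangent_coeff \<nu> a b l * y ^ l)" for y
  define \<beta> where "\<beta> y = (\<Sum>j\<le>\<nu>. b j * y ^ j)" for y
  define K where "K z = G z + snd z * H z" for z
  define P where "P z = T (snd z) + fst z * K z" for z
  define Q where "Q z = \<beta> (snd z) + fst z * H z" for z
  have K: "K \<in> hol_germs (0, c)" using G(1) H(1) unfolding K_def[abs_def] q' by (intro hol_germs_intros)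
  have PQ: "P \<in> hol_germs (0, c)" "Q \<in> hol_germs (0, c)"
    using H(1) K unfolding P_def[abs_def] Q_def[abs_def] T_def \<beta>_def q' by (intro hol_germs_intros; simp)+
  have e1: "\<forall>\<^sub>F z in nhds (0, c). fst z ^ k * fst \<omega>' z = fst z ^ \<nu> * P z"
    using k G(2) H(2) unfolding q'
  proof eventually_elim
    case (elim z)
    have "fst z ^ k * fst \<omega>' z = fst \<omega> (blowdown ChartX z) + snd z * snd \<omega> (blowdown ChartX z)"
      using elim(1) by (simp only: pullback2_blowdown_X)
    thus ?case unfolding elim(2,3) P_def T_def tangent_coeff_sum K_def by (simp only: algebra_simps)
  qed
  have e2: "\<forall>\<^sub>F z in nhds (0, c). fst z ^ k * snd \<omega>' z = fst z ^ Suc \<nu> * Q z"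
    using k H(2) unfolding q'
  proof eventually_elim
    case (elim z)
    have "fst z ^ k * snd \<omega>' z = fst z * snd \<omega> (blowdown ChartX z)"
      using elim(1) by (simp only: pullback2_blowdown_X)
    thus ?case unfolding elim(2) Q_def \<beta>_def by simp
  qed
  note w' = w[unfolded q'] and nd' = nd[unfolded q']
  have restr: "\<forall>\<^sub>F s in at 0. F (c + s) = 0"
    if dvd: "germ_dvd (0, c) fst R" and R: "\<And>z. R z = F (snd z) + fst z * S z" for R F S
  proof -
    from dvd obtain h where h: "\<forall>\<^sub>F z in nhds (0, c). R z = h z * fst z" unfolding germ_dvd_def by blast
    hence "\<forall>\<^sub>F z in nhds (0, c). R z = fst z * h z" by (simp add: mult.commute)
    from dvd_fst_restriction[OF this] show ?thesis by (simp add: R)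
  qed
  have \<beta>0: "b j = 0" if "germ_dvd (0, c) fst Q" "j \<le> \<nu>" for j
    using polynomial_eventually_zero[of b c \<nu> j] restr[OF that(1), of \<beta> H] that(2) by (simp add: Q_def \<beta>_def)
  have T0: "tangent_coeff \<nu> a b l = 0" if "germ_dvd (0, c) fst P" "l \<le> Suc \<nu>" for l
    using polynomial_eventually_zero[of "tangent_coeff \<nu> a b" c "Suc \<nu>" l] restr[OF that(1), of T K] that(2)
    by (simp add: P_def T_def del: sum.atMost_Suc)
  show ?thesis
  proof (cases "\<forall>l\<le>Suc \<nu>. tangent_coeff \<nu> a b l = 0")
    case False
    have "k = \<nu>"
    proof (rule linorder_cases)
      assume "k < \<nu>"
      hence "germ_dvd (0, c) fst (fst \<omega>')" "germ_dvd (0, c) fst (snd \<omega>')"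
        using hol_germs_dvd_of_power_eq[OF w'(1) PQ(1) _ e1] hol_germs_dvd_of_power_eq[OF w'(2) PQ(2) _ e2] by auto
      thus ?thesis using nd' by blast
    next
      assume "\<nu> < k"
      have "\<forall>\<^sub>F z in nhds (0, c). fst z ^ \<nu> * P z = fst z ^ k * fst \<omega>' z"
        using e1 by eventually_elim simp
      from hol_germs_dvd_of_power_eq[OF PQ(1) w'(1) \<open>\<nu> < k\<close> this] show ?thesis using T0 False by blast
    qed
    moreover from this have "germ_dvd (0, c) fst (snd \<omega>')"
      using hol_germs_dvd_of_power_eq[OF w'(2) PQ(2) _ e2] by simp
    ultimately show ?thesis using that[OF k] False by (simp add: q')
  next
    case True
    \<comment> \<open>When the cone vanishes, a 0 = 0 and a j = - b (j - 1) for j > 0, so vanishing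
      of all b would force all a to vanish.\<close>
    have bnz: "\<exists>j\<le>\<nu>. b j \<noteq> 0"
    proof (rule ccontr)
      assume no: "\<not> ?thesis"
      have "a j = 0" if "j \<le> \<nu>" for j
        using True[rule_format, of j] no that by (auto simp: tangent_coeff_def split: if_splits)
      thus False using nz no by blast
    qed
    have e1': "\<forall>\<^sub>F z in nhds (0, c). fst z ^ k * fst \<omega>' z = fst z ^ Suc \<nu> * K z"
      using e1
    proof eventually_elim
      case (elim z)
      have "T (snd z) = 0" unfolding T_def using True by (intro sum.neutral) auto
      thus ?case using elim by (simp add: P_def)
    qed
    have "k = Suc \<nu>"
    proof (rule linorder_cases)
      assume "k < Suc \<nu>"
      hence "germ_dvd (0, c) fst (fst \<omega>')" "germ_dvd (0, c) fst (snd \<omega>')"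
        using hol_germs_dvd_of_power_eq[OF w'(1) K _ e1'] hol_germs_dvd_of_power_eq[OF w'(2) PQ(2) _ e2] by auto
      thus ?thesis using nd' by blast
    next
      assume "Suc \<nu> < k"
      have "\<forall>\<^sub>F z in nhds (0, c). fst z ^ Suc \<nu> * Q z = fst z ^ k * snd \<omega>' z"
        using e2 by eventually_elim simp
      from hol_germs_dvd_of_power_eq[OF PQ(2) w'(2) \<open>Suc \<nu> < k\<close> this] show ?thesis using \<beta>0 bnz by blast
    qed
    moreover have "\<not> germ_dvd (0, c) fst (snd \<omega>')"
    proof
      assume "germ_dvd (0, c) fst (snd \<omega>')"
      then obtain h where h: "h \<in> hol_germs (0, c)" "\<forall>\<^sub>F z in nhds (0, c). snd \<omega>' z = h z * fst z"
        unfolding germ_dvd_def by blast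
      have "\<forall>\<^sub>F z in nhds (0, c). fst z ^ Suc \<nu> * Q z = fst z ^ k * snd \<omega>' z"
        using e2 by eventually_elim simp
      from hol_germs_cancel_fst_power[OF PQ(2) w'(2) _ this] \<open>k = Suc \<nu>\<close>
      have "\<forall>\<^sub>F z in nhds (0, c). Q z = fst z ^ (k - Suc \<nu>) * snd \<omega>' z" by simp
      hence "\<forall>\<^sub>F z in nhds (0, c). Q z = h z * fst z"
        using h(2) by eventually_elim (simp add: \<open>k = Suc \<nu>\<close>)
      from \<beta>0[OF germ_dvdI[OF h(1) this]] bnz show False by blast
    qed
    ultimately show ?thesis using that[OF k] True by (simp add: q')
  qed
qed

section \<open>The second chart\<close>

lemma germ_dvd_swap:
  assumes "germ_dvd p f g" shows "germ_dvd (prod.swap p) (f \<circ> prod.swap) (g \<circ> prod.swap)"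
proof -
  from assms obtain h where h: "h \<in> hol_germs p" "\<forall>\<^sub>F z in nhds p. g z = h z * f z"
    unfolding germ_dvd_def by blast
  have "filterlim prod.swap (nhds (prod.swap (prod.swap p))) (nhds (prod.swap p))"
    unfolding prod.swap_def[abs_def]
    by (intro tendsto_Pair tendsto_fst tendsto_snd filterlim_ident)
  hence "filterlim prod.swap (nhds p) (nhds (prod.swap p))" by simp
  from eventually_compose_filterlim[OF h(2) this]
  show ?thesis by (intro germ_dvdI[OF hol_germs_swap[OF h(1)]]) simp
qed

lemma swap_comp_cancel [simp]: "f \<circ> prod.swap \<circ> prod.swap = f"
  by (simp add: comp_assoc)

lemma germ_dvd_swap_iff: "germ_dvd (prod.swap p) (f \<circ> prod.swap) (g \<circ> prod.swap) \<longleftrightarrow> germ_dvd p f g"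
  using germ_dvd_swap[of p f g] germ_dvd_swap[of "prod.swap p" "f \<circ> prod.swap" "g \<circ> prod.swap"] by auto

lemma hol_germs_swap_iff: "f \<circ> prod.swap \<in> hol_germs (prod.swap p) \<longleftrightarrow> f \<in> hol_germs p"
  using hol_germs_swap[of f p] hol_germs_swap[of "f \<circ> prod.swap" "prod.swap p"] by auto

lemma eventually_swap:
  fixes p :: "complex \<times> complex"
  assumes "\<forall>\<^sub>F z in nhds p. P z" shows "\<forall>\<^sub>F z in nhds (prod.swap p). P (prod.swap z)"
proof -
  have "filterlim prod.swap (nhds (prod.swap (prod.swap p))) (nhds (prod.swap p))"
    unfolding prod.swap_def[abs_def]
    by (intro tendsto_Pair tendsto_fst tendsto_snd filterlim_ident)
  thus ?thesis using eventually_compose_filterlim[OF assms] by simp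
qed

lemma swap_zero [simp]: "prod.swap 0 = (0 :: complex \<times> complex)"
  by (simp add: zero_prod_def)

lemma germ_unit_swap: "germ_unit p f \<Longrightarrow> germ_unit (prod.swap p) (f \<circ> prod.swap)"
  unfolding germ_unit_def using germ_dvd_swap[of p f "\<lambda>_. 1"] by (simp add: o_def)

lemma germ_irreducible_swap:
  assumes "germ_irreducible p f" shows "germ_irreducible (prod.swap p) (f \<circ> prod.swap)"
  unfolding germ_irreducible_def
proof (intro conjI ballI impI)
  show "f \<circ> prod.swap \<in> hol_germs (prod.swap p)" using assms by (simp add: germ_irreducible_def hol_germs_swap_iff)
  show "\<not> (\<forall>\<^sub>F z in nhds (prod.swap p). (f \<circ> prod.swap) z = 0)"
    using assms eventually_swap[of "\<lambda>z. (f \<circ> prod.swap) z = 0" "prod.swap p"] by (auto simp: germ_irreducible_def)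
  show "\<not> germ_unit (prod.swap p) (f \<circ> prod.swap)"
    using assms germ_unit_swap[of "prod.swap p" "f \<circ> prod.swap"] by (auto simp: germ_irreducible_def)
  fix a b assume ab: "a \<in> hol_germs (prod.swap p)" "b \<in> hol_germs (prod.swap p)"
    "\<forall>\<^sub>F z in nhds (prod.swap p). (f \<circ> prod.swap) z = a z * b z"
  have "a \<circ> prod.swap \<in> hol_germs p" "b \<circ> prod.swap \<in> hol_germs p"
    using hol_germs_swap[OF ab(1)] hol_germs_swap[OF ab(2)] by simp_all
  moreover have "\<forall>\<^sub>F z in nhds p. f z = (a \<circ> prod.swap) z * (b \<circ> prod.swap) z"
    using eventually_swap[OF ab(3)] by simp
  ultimately have "germ_unit p (a \<circ> prod.swap) \<or> germ_unit p (b \<circ> prod.swap)"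
    using assms unfolding germ_irreducible_def by blast
  thus "germ_unit (prod.swap p) a \<or> germ_unit (prod.swap p) b"
    using germ_unit_swap[of p "a \<circ> prod.swap"] germ_unit_swap[of p "b \<circ> prod.swap"] by auto
qed

lemma exc_swap: "fst \<circ> prod.swap = snd" "snd \<circ> prod.swap = fst"
  by (auto simp: fun_eq_iff)

text \<open>Swapping coordinates above and below exchanges the charts; every statement on
  \<open>ChartY\<close> is reduced to \<open>ChartX\<close> in this way.\<close>

lemma blowdown_Y: "blowdown ChartY z = prod.swap (blowdown ChartX (prod.swap z))"
  by (cases z) (simp add: mult.commute)

lemma strict_transform_curve_swap:
  assumes "strict_transform_curve ChartY q \<phi> \<phi>'"
  shows "strict_transform_curve ChartX (prod.swap q) (\<phi> \<circ> prod.swap) (\<phi>' \<circ> prod.swap)"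
proof -
  from assms obtain k where \<phi>': "\<phi>' \<in> hol_germs q" and k: "\<forall>\<^sub>F z in nhds q. \<phi> (blowdown ChartY z) = snd z ^ k * \<phi>' z"
    and nd: "\<not> germ_dvd q snd \<phi>'" unfolding strict_transform_curve_def by auto
  have "\<forall>\<^sub>F z in nhds (prod.swap q). (\<phi> \<circ> prod.swap) (blowdown ChartX z) = fst z ^ k * (\<phi>' \<circ> prod.swap) z"
    using eventually_swap[OF k] by (simp add: blowdown_Y)
  moreover have "\<not> germ_dvd (prod.swap q) fst (\<phi>' \<circ> prod.swap)"
    using nd germ_dvd_swap_iff[of q snd \<phi>'] by (simp add: exc_swap)
  ultimately show ?thesis using hol_germs_swap[OF \<phi>'] unfolding strict_transform_curve_def by auto
qed

lemma curve_germ_swap: "curve_germ (prod.swap p) (prod.swap \<circ> \<gamma>) \<longleftrightarrow> curve_germ p \<gamma>"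
  unfolding curve_germ_def by (auto simp: comp_assoc[symmetric] exc_swap prod_eq_iff)

lemma branch_of_swap:
  assumes "branch_of (prod.swap p) (\<phi> \<circ> prod.swap) (prod.swap \<circ> \<gamma>)" shows "branch_of p \<phi> \<gamma>"
  unfolding branch_of_def
proof (intro conjI ballI impI)
  show "curve_germ p \<gamma>" "\<phi> \<in> hol_germs p" "germ_eq (\<lambda>t. \<phi> (\<gamma> t)) (\<lambda>_. 0)"
    using assms by (simp_all add: branch_of_def curve_germ_swap hol_germs_swap_iff)
  show "\<not> (germ_eq (\<lambda>t. partial_x \<phi> (\<gamma> t)) (\<lambda>_. 0) \<and> germ_eq (\<lambda>t. partial_y \<phi> (\<gamma> t)) (\<lambda>_. 0))"
    using assms by (auto simp: branch_of_def partial_swap)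
  fix f assume f: "f \<in> hol_germs p" "germ_eq (\<lambda>t. f (\<gamma> t)) (\<lambda>_. 0)"
  have "germ_dvd (prod.swap p) (\<phi> \<circ> prod.swap) (f \<circ> prod.swap)"
    using assms hol_germs_swap[OF f(1)] f(2) unfolding branch_of_def by simp
  thus "germ_dvd p \<phi> f" by (simp add: germ_dvd_swap_iff)
qed

lemma branch_ring_swap: "branch_ring (prod.swap p) (prod.swap \<circ> \<gamma>) = branch_ring p \<gamma>"
proof (intro equalityI subsetI)
  fix g assume "g \<in> branch_ring (prod.swap p) (prod.swap \<circ> \<gamma>)"
  then obtain f where f: "f \<in> hol_germs (prod.swap p)" "germ_eq g (\<lambda>t. f ((prod.swap \<circ> \<gamma>) t))"
    unfolding branch_ring_def by blast
  show "g \<in> branch_ring p \<gamma>"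
    by (rule branch_ringI[of "f \<circ> prod.swap"]) (use f hol_germs_swap[OF f(1)] in simp_all)
next
  fix g assume "g \<in> branch_ring p \<gamma>"
  then obtain f where f: "f \<in> hol_germs p" "germ_eq g (\<lambda>t. f (\<gamma> t))" unfolding branch_ring_def by blast
  show "g \<in> branch_ring (prod.swap p) (prod.swap \<circ> \<gamma>)"
    by (rule branch_ringI[OF hol_germs_swap[OF f(1)]]) (use f(2) in simp)
qed

theorem curve_blowup:
  assumes irr: "germ_irreducible 0 \<phi>" and st: "strict_transform_curve c q \<phi> \<phi>'"
    and q: "exc c q = 0" and norm: "curve_normalization q \<phi>' \<gamma>"
    and \<sigma>: "\<sigma> = blowdown c \<circ> \<gamma>" and mult: "param_multiplicity \<sigma> = enat m"
  shows "has_order (exc c \<circ> \<gamma>) m \<and> m > 0 \<and> branch_of 0 \<phi> \<sigma> \<and> branch_of q \<phi>' \<gamma> \<and>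
    (\<exists>\<delta>. qdim germs1 (branch_ring q \<gamma>) \<delta> \<and> qdim germs1 (branch_ring 0 \<sigma>) (\<delta> + m * (m - 1) div 2))"
proof -
  from norm obtain U V \<delta> where \<gamma>q: "\<gamma> 0 = q"
    and U: "open U" "0 \<in> U" "(fst \<circ> \<gamma>) holomorphic_on U" "(snd \<circ> \<gamma>) holomorphic_on U"
    and hom: "homeomorphism U {z\<in>V. \<phi>' z = 0} \<gamma> \<delta>"
    unfolding curve_normalization_def by blast
  have inj: "inj_on \<gamma> U" using hom unfolding homeomorphism_def by (metis inj_on_inverseI)
  have \<phi>'U: "\<phi>' (\<gamma> t) = 0" if "t \<in> U" for t using hom that unfolding homeomorphism_def by blast
  show ?thesis
  proof (cases c)
    case ChartX
    have "has_order (fst \<circ> \<gamma>) m \<and> m > 0 \<and> branch_of 0 \<phi> \<sigma> \<and> branch_of q \<phi>' \<gamma> \<and>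
      (\<exists>\<delta>. qdim germs1 (branch_ring q \<gamma>) \<delta> \<and> qdim germs1 (branch_ring 0 \<sigma>) (\<delta> + m * (m - 1) div 2))"
    proof (rule curve_blowup_X[OF irr _ _ \<gamma>q U inj _ _ mult])
      show "strict_transform_curve ChartX q \<phi> \<phi>'" using st ChartX by simp
      show "fst q = 0" using q ChartX by simp
      show "\<phi>' (\<gamma> t) = 0" if "t \<in> U" for t by (rule \<phi>'U[OF that])
      show "\<sigma> = blowdown ChartX \<circ> \<gamma>" using \<sigma> ChartX by simp
    qed
    thus ?thesis by (simp add: ChartX)
  next
    case ChartY
    let ?s = prod.swap
    have "has_order (fst \<circ> (?s \<circ> \<gamma>)) m \<and> m > 0 \<and> branch_of 0 (\<phi> \<circ> ?s) (?s \<circ> \<sigma>) \<and>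
      branch_of (?s q) (\<phi>' \<circ> ?s) (?s \<circ> \<gamma>) \<and>
      (\<exists>\<delta>. qdim germs1 (branch_ring (?s q) (?s \<circ> \<gamma>)) \<delta> \<and>
        qdim germs1 (branch_ring 0 (?s \<circ> \<sigma>)) (\<delta> + m * (m - 1) div 2))"
    proof (rule curve_blowup_X[where U = U])
      show "germ_irreducible 0 (\<phi> \<circ> ?s)" using germ_irreducible_swap[OF irr] by simp
      show "strict_transform_curve ChartX (?s q) (\<phi> \<circ> ?s) (\<phi>' \<circ> ?s)"
        using strict_transform_curve_swap st ChartY by simp
      show "fst (?s q) = 0" using q ChartY by simp
      show "(?s \<circ> \<gamma>) 0 = ?s q" using \<gamma>q by simp
      show "(fst \<circ> (?s \<circ> \<gamma>)) holomorphic_on U" "(snd \<circ> (?s \<circ> \<gamma>)) holomorphic_on U"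
        using U by (simp_all add: comp_assoc[symmetric] exc_swap)
      show "inj_on (?s \<circ> \<gamma>) U" by (rule comp_inj_on[OF inj]) (auto simp: inj_on_def prod_eq_iff)
      show "(\<phi>' \<circ> ?s) ((?s \<circ> \<gamma>) t) = 0" if "t \<in> U" for t using \<phi>'U[OF that] by simp
      show "?s \<circ> \<sigma> = blowdown ChartX \<circ> (?s \<circ> \<gamma>)" using \<sigma> ChartY by (auto simp: blowdown_Y fun_eq_iff)
      have "fst \<circ> (?s \<circ> \<sigma>) = snd \<circ> \<sigma>" "snd \<circ> (?s \<circ> \<sigma>) = fst \<circ> \<sigma>" by (simp_all add: comp_assoc[symmetric] exc_swap)
      thus "param_multiplicity (?s \<circ> \<sigma>) = enat m"
        using mult by (simp only: param_multiplicity_def min.commute)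
    qed (use U in auto)
    moreover have "fst \<circ> (?s \<circ> \<gamma>) = snd \<circ> \<gamma>" by (simp add: comp_assoc[symmetric] exc_swap)
    ultimately show ?thesis
      using branch_of_swap[of 0 \<phi> \<sigma>] branch_of_swap[of q \<phi>' \<gamma>] branch_ring_swap[of q \<gamma>] branch_ring_swap[of 0 \<sigma>]
      by (simp add: ChartY)
  qed
qed

lemma germ_dvd_uminus: "germ_dvd p f (\<lambda>z. - g z) \<longleftrightarrow> germ_dvd p f g"
proof -
  have "germ_dvd p f (\<lambda>z. - g z)" if "germ_dvd p f g" for g
  proof -
    from that obtain h where h: "h \<in> hol_germs p" "\<forall>\<^sub>F z in nhds p. g z = h z * f z"
      unfolding germ_dvd_def by blast
    from h(2) have "\<forall>\<^sub>F z in nhds p. - g z = - h z * f z" by eventually_elim simp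
    thus ?thesis by (rule germ_dvdI[OF hol_germs_uminus[OF h(1)]])
  qed
  from this[of g] this[of "\<lambda>z. - g z"] show ?thesis by auto
qed

lemma partials_coordinates:
  "partial_x fst = (\<lambda>_. 1)" "partial_y fst = (\<lambda>_. 0)" "partial_x snd = (\<lambda>_. 0)" "partial_y snd = (\<lambda>_. 1)"
  by (auto simp: partial_x_def partial_y_def)

text \<open>For the form A dx + B dy, the wedge product with dx has coefficient - B and the one with
  dy has coefficient A.\<close>

lemma invariant_exc:
  "invariant_curve p \<omega> (exc ChartX) \<longleftrightarrow> germ_dvd p fst (snd \<omega>)"
  "invariant_curve p \<omega> (exc ChartY) \<longleftrightarrow> germ_dvd p snd (fst \<omega>)"
  using germ_dvd_uminus[of p fst "snd \<omega>"] by (simp_all add: invariant_curve_def partials_coordinates)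

text \<open>The pullback under the swap, where dx and dy trade places too.\<close>

definition swap_form :: "form2 \<Rightarrow> form2" where
  "swap_form \<omega> = (snd \<omega> \<circ> prod.swap, fst \<omega> \<circ> prod.swap)"

lemma pullback2_blowdown_Y:
  "fst (pullback2 (blowdown ChartY) \<omega>) z = snd z * fst \<omega> (blowdown ChartY z)"
  "snd (pullback2 (blowdown ChartY) \<omega>) z = fst z * fst \<omega> (blowdown ChartY z) + snd \<omega> (blowdown ChartY z)"
proof -
  obtain u y where z: "z = (u, y)" by (cases z)
  have "deriv (\<lambda>s. s * y) u = y" "deriv (\<lambda>s. u * s) y = u"
    by (rule DERIV_imp_deriv, auto intro!: derivative_eq_intros)+
  thus "fst (pullback2 (blowdown ChartY) \<omega>) z = snd z * fst \<omega> (blowdown ChartY z)"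
    "snd (pullback2 (blowdown ChartY) \<omega>) z = fst z * fst \<omega> (blowdown ChartY z) + snd \<omega> (blowdown ChartY z)"
    by (simp_all add: pullback2_def partial_x_def partial_y_def z)
qed

lemma pullback2_swap:
  "fst (pullback2 (blowdown ChartX) (swap_form \<omega>)) z = snd (pullback2 (blowdown ChartY) \<omega>) (prod.swap z)"
  "snd (pullback2 (blowdown ChartX) (swap_form \<omega>)) z = fst (pullback2 (blowdown ChartY) \<omega>) (prod.swap z)"
  unfolding pullback2_blowdown_X pullback2_blowdown_Y by (simp_all add: swap_form_def blowdown_Y add.commute)

lemma strict_transform_form_swap:
  assumes "strict_transform_form ChartY q \<omega> \<omega>'"
  shows "strict_transform_form ChartX (prod.swap q) (swap_form \<omega>) (swap_form \<omega>')"
proof -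
  from assms obtain k where w: "fst \<omega>' \<in> hol_germs q" "snd \<omega>' \<in> hol_germs q"
    and k: "\<forall>\<^sub>F z in nhds q. fst (pullback2 (blowdown ChartY) \<omega>) z = snd z ^ k * fst \<omega>' z \<and>
       snd (pullback2 (blowdown ChartY) \<omega>) z = snd z ^ k * snd \<omega>' z"
    and nd: "\<not> (germ_dvd q snd (fst \<omega>') \<and> germ_dvd q snd (snd \<omega>'))"
    unfolding strict_transform_form_def by auto
  have "\<forall>\<^sub>F z in nhds (prod.swap q).
      fst (pullback2 (blowdown ChartX) (swap_form \<omega>)) z = exc ChartX z ^ k * fst (swap_form \<omega>') z \<and>
      snd (pullback2 (blowdown ChartX) (swap_form \<omega>)) z = exc ChartX z ^ k * snd (swap_form \<omega>') z"
    unfolding pullback2_swap using eventually_swap[OF k] by eventually_elim (simp add: swap_form_def)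
  moreover have "\<not> (germ_dvd (prod.swap q) (exc ChartX) (fst (swap_form \<omega>')) \<and>
      germ_dvd (prod.swap q) (exc ChartX) (snd (swap_form \<omega>')))"
    using nd germ_dvd_swap_iff[of q snd "fst \<omega>'"] germ_dvd_swap_iff[of q snd "snd \<omega>'"]
    by (auto simp: swap_form_def exc_swap)
  ultimately show ?thesis unfolding strict_transform_form_def
    using hol_germs_swap[OF w(1)] hol_germs_swap[OF w(2)] by (auto simp: swap_form_def)
qed

text \<open>The two charts dehomogenize the same tangent cone, so its coefficients appear in reverse
  order.\<close>

lemma tangent_coeff_swap:
  assumes "l \<le> Suc n"
  shows "tangent_coeff n (\<lambda>j. b (n - j)) (\<lambda>j. a (n - j)) l = tangent_coeff n a b (Suc n - l)"
proof (cases "l = 0")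
  case False
  hence "n - (l - 1) = Suc n - l" using assms by simp
  thus ?thesis using assms False by (auto simp: tangent_coeff_def)
qed (simp add: tangent_coeff_def)

text \<open>The case distinction involves only the leading parts of \<omega>, not the chart, the
  point or the strict transform. A single point therefore decides whether the blow-up is
  dicritical.\<close>

lemma strict_transform_power:
  assumes A: "homog_expansion \<nu> (fst \<omega>) a" and B: "homog_expansion \<nu> (snd \<omega>) b"
    and nz: "\<exists>j\<le>\<nu>. a j \<noteq> 0 \<or> b j \<noteq> 0"
    and st: "strict_transform_form c q \<omega> \<omega>'" and q: "exc c q = 0"
  shows "\<exists>k. (\<forall>\<^sub>F z in nhds q. fst (pullback2 (blowdown c) \<omega>) z = exc c z ^ k * fst \<omega>' z \<and>
       snd (pullback2 (blowdown c) \<omega>) z = exc c z ^ k * snd \<omega>' z) \<and>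
    (if \<forall>l\<le>Suc \<nu>. tangent_coeff \<nu> a b l = 0 then k = Suc \<nu> \<and> \<not> invariant_curve q \<omega>' (exc c)
     else k = \<nu> \<and> invariant_curve q \<omega>' (exc c))"
proof (cases c)
  case ChartX
  obtain k where "\<forall>\<^sub>F z in nhds q. fst (pullback2 (blowdown ChartX) \<omega>) z = fst z ^ k * fst \<omega>' z \<and>
       snd (pullback2 (blowdown ChartX) \<omega>) z = fst z ^ k * snd \<omega>' z"
    "if \<forall>l\<le>Suc \<nu>. tangent_coeff \<nu> a b l = 0 then k = Suc \<nu> \<and> \<not> germ_dvd q fst (snd \<omega>')
     else k = \<nu> \<and> germ_dvd q fst (snd \<omega>')"
    by (rule strict_transform_power_X[OF A B nz]) (use st q ChartX in auto)
  thus ?thesis unfolding ChartX invariant_exc by (intro exI[of _ k]) auto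
next
  case ChartY
  let ?s = prod.swap
  have A': "homog_expansion \<nu> (fst (swap_form \<omega>)) (\<lambda>j. b (\<nu> - j))"
    and B': "homog_expansion \<nu> (snd (swap_form \<omega>)) (\<lambda>j. a (\<nu> - j))"
    using homog_expansion_swap[OF B] homog_expansion_swap[OF A] by (simp_all add: swap_form_def)
  from nz obtain j where "j \<le> \<nu>" "a j \<noteq> 0 \<or> b j \<noteq> 0" by blast
  hence nz': "\<exists>j\<le>\<nu>. b (\<nu> - j) \<noteq> 0 \<or> a (\<nu> - j) \<noteq> 0" by (intro exI[of _ "\<nu> - j"]) auto
  have "(\<forall>l\<le>Suc \<nu>. tangent_coeff \<nu> (\<lambda>j. b (\<nu> - j)) (\<lambda>j. a (\<nu> - j)) l = 0) \<longleftrightarrow>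
      (\<forall>l\<le>Suc \<nu>. tangent_coeff \<nu> a b (Suc \<nu> - l) = 0)"
    using tangent_coeff_swap by simp
  also have "\<dots> \<longleftrightarrow> (\<forall>l\<le>Suc \<nu>. tangent_coeff \<nu> a b l = 0)"
    by (metis diff_diff_cancel diff_le_self)
  finally have T: "(\<forall>l\<le>Suc \<nu>. tangent_coeff \<nu> (\<lambda>j. b (\<nu> - j)) (\<lambda>j. a (\<nu> - j)) l = 0) \<longleftrightarrow>
      (\<forall>l\<le>Suc \<nu>. tangent_coeff \<nu> a b l = 0)" .
  have st': "strict_transform_form ChartX (?s q) (swap_form \<omega>) (swap_form \<omega>')"
    using strict_transform_form_swap[of q \<omega> \<omega>'] st ChartY by simp
  obtain k where k: "\<forall>\<^sub>F z in nhds (?s q). fst (pullback2 (blowdown ChartX) (swap_form \<omega>)) z = fst z ^ k * fst (swap_form \<omega>') z \<and>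
       snd (pullback2 (blowdown ChartX) (swap_form \<omega>)) z = fst z ^ k * snd (swap_form \<omega>') z"
    "if \<forall>l\<le>Suc \<nu>. tangent_coeff \<nu> (\<lambda>j. b (\<nu> - j)) (\<lambda>j. a (\<nu> - j)) l = 0
     then k = Suc \<nu> \<and> \<not> germ_dvd (?s q) fst (snd (swap_form \<omega>'))
     else k = \<nu> \<and> germ_dvd (?s q) fst (snd (swap_form \<omega>'))"
    by (rule strict_transform_power_X[OF A' B' nz' st']) (use q ChartY in auto)
  have eq: "germ_dvd (?s q) fst (snd (swap_form \<omega>')) \<longleftrightarrow> germ_dvd q snd (fst \<omega>')"
    using germ_dvd_swap_iff[of q snd "fst \<omega>'"] by (simp add: swap_form_def exc_swap)
  have "if \<forall>l\<le>Suc \<nu>. tangent_coeff \<nu> a b l = 0 then k = Suc \<nu> \<and> \<not> invariant_curve q \<omega>' (exc c)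
     else k = \<nu> \<and> invariant_curve q \<omega>' (exc c)" 
    using k(2) unfolding T eq ChartY invariant_exc .
  moreover have "\<forall>\<^sub>F z in nhds q. fst (pullback2 (blowdown c) \<omega>) z = exc c z ^ k * fst \<omega>' z \<and>
       snd (pullback2 (blowdown c) \<omega>) z = exc c z ^ k * snd \<omega>' z"
    using eventually_swap[OF k(1)[unfolded pullback2_swap]] unfolding swap_swap ChartY exc.simps
    by eventually_elim (simp add: swap_form_def)
  ultimately show ?thesis by blast
qed

section \<open>Forms along the branch and its blow-down\<close>

lemma blowdown_germs:
  assumes "exc c q = 0"
  shows "fst \<circ> blowdown c \<in> hol_germs q" "snd \<circ> blowdown c \<in> hol_germs q" "blowdown c q = 0"
    and "f \<in> hol_germs 0 \<Longrightarrow> (\<lambda>z. f (blowdown c z)) \<in> hol_germs q"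
proof -
  have Y: "blowdown ChartY z = (fst z * snd z, snd z)" for z by (cases z) simp
  show 1: "fst \<circ> blowdown c \<in> hol_germs q" and 2: "snd \<circ> blowdown c \<in> hol_germs q"
    by (cases c; simp add: o_def blowdown_X Y hol_germs_fst hol_germs_snd hol_germs_mult)+
  show 3: "blowdown c q = 0" using assms by (cases c) (simp_all add: blowdown_X Y zero_prod_def)
  show "(\<lambda>z. f (blowdown c z)) \<in> hol_germs q" if "f \<in> hol_germs 0"
    using hol_germs_compose[of f "fst \<circ> blowdown c" q "snd \<circ> blowdown c"] 1 2 3 that by (simp add: zero_prod_def)
qed

lemma pullback2_along_curve:
  assumes \<gamma>: "curve_germ q \<gamma>" and q: "exc c q = 0"
  shows "germ_eq (\<lambda>t. fst \<omega> (blowdown c (\<gamma> t)) * deriv (fst \<circ> (blowdown c \<circ> \<gamma>)) t +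
      snd \<omega> (blowdown c (\<gamma> t)) * deriv (snd \<circ> (blowdown c \<circ> \<gamma>)) t)
    (\<lambda>t. fst (pullback2 (blowdown c) \<omega>) (\<gamma> t) * deriv (fst \<circ> \<gamma>) t +
      snd (pullback2 (blowdown c) \<omega>) (\<gamma> t) * deriv (snd \<circ> \<gamma>) t)"
  unfolding germ_eq_def
  using curve_germ_chain[OF \<gamma> blowdown_germs(1)[OF q]] curve_germ_chain[OF \<gamma> blowdown_germs(2)[OF q]]
proof eventually_elim
  case (elim t)
  from elim[THEN DERIV_imp_deriv] show ?case
    by (simp add: pullback2_def o_def algebra_simps)
qed

text \<open>Pulling back along the blown-down branch is pulling back under the blow-down and then
  along \<gamma>.\<close>

lemma pulled_back_forms_blowdown_subset:
  assumes \<gamma>: "curve_germ q \<gamma>" and q: "exc c q = 0"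
  shows "pulled_back_forms 0 (blowdown c \<circ> \<gamma>) \<subseteq> pulled_back_forms q \<gamma>"
proof
  fix g assume "g \<in> pulled_back_forms 0 (blowdown c \<circ> \<gamma>)"
  then obtain a b where ab: "a \<in> hol_germs 0" "b \<in> hol_germs 0"
    and g: "\<forall>\<^sub>F t in nhds 0. g t = a ((blowdown c \<circ> \<gamma>) t) * deriv (fst \<circ> (blowdown c \<circ> \<gamma>)) t +
      b ((blowdown c \<circ> \<gamma>) t) * deriv (snd \<circ> (blowdown c \<circ> \<gamma>)) t"
    unfolding pulled_back_forms_def by blast
  let ?p = "pullback2 (blowdown c) (a, b)"
  have "fst ?p \<in> hol_germs q" "snd ?p \<in> hol_germs q"
    unfolding pullback2_def fst_conv snd_conv
    by (intro hol_germs_add hol_germs_mult hol_germs_partial_x hol_germs_partial_y blowdown_germs[OF q] ab)+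
  moreover have "\<forall>\<^sub>F t in nhds 0. g t = fst ?p (\<gamma> t) * deriv (fst \<circ> \<gamma>) t + snd ?p (\<gamma> t) * deriv (snd \<circ> \<gamma>) t"
    using g pullback2_along_curve[OF \<gamma> q, of "(a, b)"] unfolding germ_eq_def by eventually_elim simp
  ultimately show "g \<in> pulled_back_forms q \<gamma>" unfolding pulled_back_forms_def by blast
qed

text \<open>For m > 0 the m-th derivative of f at 0 is a derivative of \<open>deriv f\<close>, and
  it is nonzero. A constant shows why order 0 is excluded.\<close>

lemma deriv_not_zero_germ:
  assumes "has_order f m" "m > 0" shows "\<not> germ_eq (deriv f) (\<lambda>_. 0)"
proof
  assume z: "germ_eq (deriv f) (\<lambda>_. 0)"
  from assms obtain u where u: "u analytic_on {0}" "u 0 \<noteq> 0" "germ_eq f (\<lambda>t. t ^ m * u t)"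
    unfolding has_order_def by blast
  obtain k where k: "m = Suc k" using assms(2) by (cases m) auto
  have "(deriv ^^ m) f 0 = (deriv ^^ k) (deriv f) 0" unfolding k by (simp add: funpow_swap1)
  also have "\<dots> = (deriv ^^ k) (\<lambda>_. 0) 0"
    using z unfolding germ_eq_def by (intro higher_deriv_cong_ev) auto
  also have "\<dots> = 0" by (induction k) simp_all
  finally show False using higher_deriv_0_has_order[OF u(1,3), of m] u(2) by simp
qed

text \<open>If \<omega> vanished along the branch, both \<omega> and d\<phi> would annihilate its
  nonzero velocity. Their determinant would vanish on the branch, so \<phi> would divide it and the
  curve would be invariant.\<close>

lemma not_invariant_imp_form_nonzero:
  assumes br: "branch_of p \<phi> \<gamma>" and \<omega>: "fst \<omega> \<in> hol_germs p" "snd \<omega> \<in> hol_germs p"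
    and nz: "\<not> (germ_eq (deriv (fst \<circ> \<gamma>)) (\<lambda>_. 0) \<and> germ_eq (deriv (snd \<circ> \<gamma>)) (\<lambda>_. 0))"
    and ninv: "\<not> invariant_curve p \<omega> \<phi>"
  shows "\<not> germ_eq (\<lambda>t. fst \<omega> (\<gamma> t) * deriv (fst \<circ> \<gamma>) t + snd \<omega> (\<gamma> t) * deriv (snd \<circ> \<gamma>) t) (\<lambda>_. 0)"
proof
  assume z: "germ_eq (\<lambda>t. fst \<omega> (\<gamma> t) * deriv (fst \<circ> \<gamma>) t + snd \<omega> (\<gamma> t) * deriv (snd \<circ> \<gamma>) t) (\<lambda>_. 0)"
  from br have \<gamma>: "curve_germ p \<gamma>" and \<phi>: "\<phi> \<in> hol_germs p" and \<phi>0: "germ_eq (\<lambda>t. \<phi> (\<gamma> t)) (\<lambda>_. 0)"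
    and ker: "\<And>f. f \<in> hol_germs p \<Longrightarrow> germ_eq (\<lambda>t. f (\<gamma> t)) (\<lambda>_. 0) \<Longrightarrow> germ_dvd p \<phi> f"
    by (auto simp: branch_of_def)
  let ?\<alpha> = "deriv (fst \<circ> \<gamma>)" and ?\<beta> = "deriv (snd \<circ> \<gamma>)"
  have an: "?\<alpha> analytic_on {0}" "?\<beta> analytic_on {0}"
    using \<gamma> by (auto simp: curve_germ_def intro: analytic_deriv)
  define K where "K z = fst \<omega> z * partial_y \<phi> z - snd \<omega> z * partial_x \<phi> z" for z
  have K: "K \<in> hol_germs p"
    unfolding K_def[abs_def] by (intro hol_germs_diff hol_germs_mult \<omega> hol_germs_partial_x hol_germs_partial_y \<phi>)
  note tangent = curve_germ_deriv_zero[OF \<gamma> \<phi> \<phi>0]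
  note cancel = germ_eq_cancel[OF curve_germ_compose_analytic[OF \<gamma> K] analytic_on_const]
  have "germ_eq (\<lambda>t. ?\<alpha> t * K (\<gamma> t)) (\<lambda>t. ?\<alpha> t * 0)"
    using z tangent unfolding germ_eq_def K_def by eventually_elim algebra
  moreover have "germ_eq (\<lambda>t. ?\<beta> t * K (\<gamma> t)) (\<lambda>t. ?\<beta> t * 0)"
    using z tangent unfolding germ_eq_def K_def by eventually_elim algebra
  ultimately have "germ_eq (\<lambda>t. K (\<gamma> t)) (\<lambda>_. 0)" using nz cancel[OF an(1)] cancel[OF an(2)] by blast
  from ker[OF K this] show False using ninv by (simp add: invariant_curve_def K_def[abs_def])
qed

theorem corollary6p6:
  fixes \<omega> \<omega>' :: form2 and \<phi> \<phi>' :: cfun2 and c :: chart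
    and q :: "complex \<times> complex" and \<gamma> \<sigma> :: "complex \<Rightarrow> complex \<times> complex"
    and \<nu> m :: nat
  assumes "foliation_form 0 \<omega>" and "singular_at 0 \<omega>"
    and "germ_irreducible 0 \<phi>"
    and "\<not> invariant_curve 0 \<omega> \<phi>"
    and "exc c q = 0"
    and "strict_transform_form c q \<omega> \<omega>'"
    and "strict_transform_curve c q \<phi> \<phi>'" and "\<phi>' q = 0"
    and "curve_normalization q \<phi>' \<gamma>" and "\<sigma> = blowdown c \<circ> \<gamma>"
    and "param_multiplicity \<sigma> = enat m"
    and "alg_multiplicity 0 \<omega> = enat \<nu>"
  shows "(\<not> dicritical \<omega> \<longrightarrow>
            (\<exists>\<mu> \<mu>' D :: nat. mu_BR_rel 0 \<omega> \<phi> = enat \<mu> \<and> mu_BR_rel q \<omega>' \<phi>' = enat \<mu>' \<and>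
               quot_dim (pulled_back_forms q \<gamma>) (pulled_back_forms 0 \<sigma>) = enat D \<and>
               int \<mu> = int \<mu>' + int (\<nu> * m) + int (m * (m - 1) div 2) - int D))
       \<and> (dicritical \<omega> \<longrightarrow>
            (\<exists>\<mu> \<mu>' D :: nat. mu_BR_rel 0 \<omega> \<phi> = enat \<mu> \<and> mu_BR_rel q \<omega>' \<phi>' = enat \<mu>' \<and>
               quot_dim (pulled_back_forms q \<gamma>) (pulled_back_forms 0 \<sigma>) = enat D \<and>
               int \<mu> = int \<mu>' + int ((\<nu> + 1) * m) + int (m * (m - 1) div 2) - int D))"
proof -
  note q = \<open>exc c q = 0\<close> and st = \<open>strict_transform_form c q \<omega> \<omega>'\<close>
  have \<sigma>: "\<sigma> = blowdown c \<circ> \<gamma>" by fact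
  have \<omega>: "fst \<omega> \<in> hol_germs 0" "snd \<omega> \<in> hol_germs 0"
    using \<open>foliation_form 0 \<omega>\<close> by (auto simp: foliation_form_def)
  have \<omega>': "fst \<omega>' \<in> hol_germs q" "snd \<omega>' \<in> hol_germs q"
    using st by (auto simp: strict_transform_form_def)
  obtain a b where A: "homog_expansion \<nu> (fst \<omega>) a" and B: "homog_expansion \<nu> (snd \<omega>) b"
    and nz: "\<exists>j\<le>\<nu>. a j \<noteq> 0 \<or> b j \<noteq> 0"
    by (rule alg_multiplicity_expansions[OF \<omega> \<open>alg_multiplicity 0 \<omega> = enat \<nu>\<close>])
  define T where "T \<longleftrightarrow> (\<forall>l\<le>Suc \<nu>. tangent_coeff \<nu> a b l = 0)"
  obtain k where k: "\<forall>\<^sub>F z in nhds q. fst (pullback2 (blowdown c) \<omega>) z = exc c z ^ k * fst \<omega>' z \<and>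
       snd (pullback2 (blowdown c) \<omega>) z = exc c z ^ k * snd \<omega>' z"
    and kT: "if T then k = Suc \<nu> \<and> \<not> invariant_curve q \<omega>' (exc c) else k = \<nu> \<and> invariant_curve q \<omega>' (exc c)"
    using strict_transform_power[OF A B nz st q] unfolding T_def by blast
  \<comment> \<open>\<open>dicritical\<close> ranges over all points of both charts, whereas T
    depends on none of them; so the given q already decides.\<close>
  have "dicritical \<omega> \<longleftrightarrow> T"
  proof
    assume "dicritical \<omega>"
    then obtain c' p \<omega>'' where *: "exc c' p = 0" "strict_transform_form c' p \<omega> \<omega>''" "\<not> invariant_curve p \<omega>'' (exc c')"
      unfolding dicritical_def by blast
    from strict_transform_power[OF A B nz *(2,1)] *(3) show T unfolding T_def by (metis (no_types))
  next
    assume T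
    hence "\<not> invariant_curve q \<omega>' (exc c)" using kT by simp
    thus "dicritical \<omega>" using q st unfolding dicritical_def by blast
  qed
  hence k_eq: "k = (if dicritical \<omega> then \<nu> + 1 else \<nu>)" using kT by auto
  obtain \<delta> where ord: "has_order (exc c \<circ> \<gamma>) m" and m: "m > 0" and br: "branch_of 0 \<phi> \<sigma>" and br': "branch_of q \<phi>' \<gamma>"
    and \<delta>': "qdim germs1 (branch_ring q \<gamma>) \<delta>" and \<delta>: "qdim germs1 (branch_ring 0 \<sigma>) (\<delta> + m * (m - 1) div 2)"
    using curve_blowup[OF \<open>germ_irreducible 0 \<phi>\<close> \<open>strict_transform_curve c q \<phi> \<phi>'\<close> q
        \<open>curve_normalization q \<phi>' \<gamma>\<close> \<sigma> \<open>param_multiplicity \<sigma> = enat m\<close>] by blast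
  have \<gamma>: "curve_germ q \<gamma>" and cg\<sigma>: "curve_germ 0 \<sigma>" using br br' by (auto simp: branch_of_def)
  have nz\<gamma>: "\<not> (germ_eq (deriv (fst \<circ> \<gamma>)) (\<lambda>_. 0) \<and> germ_eq (deriv (snd \<circ> \<gamma>)) (\<lambda>_. 0))"
    using deriv_not_zero_germ[OF ord m] by (cases c) auto
  have exc\<sigma>: "exc c \<circ> \<sigma> = exc c \<circ> \<gamma>" unfolding \<sigma> by (rule ext) (cases c; simp add: blowdown_X blowdown_Y)
  have nz\<sigma>: "\<not> (germ_eq (deriv (fst \<circ> \<sigma>)) (\<lambda>_. 0) \<and> germ_eq (deriv (snd \<circ> \<sigma>)) (\<lambda>_. 0))"
    using deriv_not_zero_germ[OF ord m] exc\<sigma> by (cases c) auto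
  define h where "h t = fst \<omega> (\<sigma> t) * deriv (fst \<circ> \<sigma>) t + snd \<omega> (\<sigma> t) * deriv (snd \<circ> \<sigma>) t" for t
  define h' where "h' t = fst \<omega>' (\<gamma> t) * deriv (fst \<circ> \<gamma>) t + snd \<omega>' (\<gamma> t) * deriv (snd \<circ> \<gamma>) t" for t
  \<comment> \<open>The exceptional equation has order m along the branch, so the orders of the two
    restricted forms differ by k m.\<close>
  have hh': "germ_eq h (\<lambda>t. (exc c \<circ> \<gamma>) t ^ k * h' t)"
    using pullback2_along_curve[OF \<gamma> q, of \<omega>] curve_germ_eventually[OF \<gamma> k]
    unfolding germ_eq_def h_def h'_def \<sigma>
  proof eventually_elim
    case (elim t)
    thus ?case by (simp add: algebra_simps)
  qed
  have hnz: "\<not> germ_eq h (\<lambda>_. 0)"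
    unfolding h_def by (rule not_invariant_imp_form_nonzero[OF br \<omega> nz\<sigma> \<open>\<not> invariant_curve 0 \<omega> \<phi>\<close>])
  have h'nz: "\<not> germ_eq h' (\<lambda>_. 0)"
  proof
    assume "germ_eq h' (\<lambda>_. 0)"
    with hh' have "germ_eq h (\<lambda>_. 0)" unfolding germ_eq_def by eventually_elim simp
    thus False using hnz by contradiction
  qed
  have "deriv (fst \<circ> \<gamma>) analytic_on {0}" "deriv (snd \<circ> \<gamma>) analytic_on {0}"
    using \<gamma> by (auto simp: curve_germ_def intro: analytic_deriv)
  hence "h' analytic_on {0}" unfolding h'_def
    by (intro analytic_on_add analytic_on_mult curve_germ_compose_analytic[OF \<gamma>] \<omega>')
  then obtain n where n: "has_order h' n" using analytic_has_order h'nz by blast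
  have ordh: "has_order h (m * k + n)"
    using has_order_mult[OF has_order_power[OF ord] n] has_order_cong[OF hh'] by blast
  have ordh_eq: "has_order (\<lambda>t. fst \<omega> (\<sigma> t) * deriv (fst \<circ> \<sigma>) t + snd \<omega> (\<sigma> t) * deriv (snd \<circ> \<sigma>) t) (m * k + n)"
    using ordh unfolding h_def[abs_def] .
  have n_eq: "has_order (\<lambda>t. fst \<omega>' (\<gamma> t) * deriv (fst \<circ> \<gamma>) t + snd \<omega>' (\<gamma> t) * deriv (snd \<circ> \<gamma>) t) n"
    using n unfolding h'_def[abs_def] .
  note mu = mu_BR_rel_formula[OF br \<omega> nz\<sigma> ordh_eq \<delta>] and mu' = mu_BR_rel_formula[OF br' \<omega>' nz\<gamma> n_eq \<delta>']
  obtain \<mu> d where \<mu>: "mu_BR_rel 0 \<omega> \<phi> = enat \<mu>" "qdim germs1 (pulled_back_forms 0 \<sigma>) d"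
    "\<mu> + d = (m * k + n) + (\<delta> + m * (m - 1) div 2)" using mu(2) by blast
  obtain \<mu>' d' where \<mu>': "mu_BR_rel q \<omega>' \<phi>' = enat \<mu>'" "qdim germs1 (pulled_back_forms q \<gamma>) d'"
    "\<mu>' + d' = n + \<delta>" using mu'(2) by blast
  have sub: "pulled_back_forms 0 \<sigma> \<subseteq> pulled_back_forms q \<gamma>"
    unfolding \<sigma> by (rule pulled_back_forms_blowdown_subset[OF \<gamma> q])
  note lin = germ_space_lin[OF mu(1)] and lin' = germ_space_lin[OF mu'(1)]
  \<comment> \<open>The codimension of the smaller module of forms is finite, so it splits into that
    of the larger one and D.\<close>
  obtain d'' D where D: "qdim germs1 (pulled_back_forms q \<gamma>) d''" "qdim (pulled_back_forms q \<gamma>) (pulled_back_forms 0 \<sigma>) D"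
    by (rule qdim_intermediate[OF lin lin' sub germ_space_subset[OF mu'(1)] \<mu>(2)])
  have "d'' = d'" by (rule qdim_unique[OF lin' D(1) \<mu>'(2)])
  moreover have "d'' + D = d"
    by (rule qdim_unique[OF lin qdim_trans[OF lin' lin sub germ_space_subset[OF mu'(1)] D] \<mu>(2)])
  \<comment> \<open>The two codimension formulas are subtracted: n and \<delta> cancel, and d - d'
    is D.\<close>
  ultimately have "\<mu> + D = \<mu>' + m * k + m * (m - 1) div 2" using \<mu>(3) \<mu>'(3) by linarith
  hence "int \<mu> + int D = int \<mu>' + int (k * m) + int (m * (m - 1) div 2)"
    by (metis mult.commute of_nat_add)
  hence "int \<mu> = int \<mu>' + int (k * m) + int (m * (m - 1) div 2) - int D" by linarith
  moreover have "quot_dim (pulled_back_forms q \<gamma>) (pulled_back_forms 0 \<sigma>) = enat D"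
    by (rule qdim_imp_quot_dim[OF lin D(2)])
  ultimately have "\<exists>\<mu> \<mu>' D :: nat. mu_BR_rel 0 \<omega> \<phi> = enat \<mu> \<and> mu_BR_rel q \<omega>' \<phi>' = enat \<mu>' \<and>
      quot_dim (pulled_back_forms q \<gamma>) (pulled_back_forms 0 \<sigma>) = enat D \<and>
      int \<mu> = int \<mu>' + int (k * m) + int (m * (m - 1) div 2) - int D" using \<mu>(1) \<mu>'(1) by blast
  thus ?thesis unfolding k_eq
    by (cases "dicritical \<omega>") (simp_all only: if_True if_False simp_thms)
qed

end
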